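(* Assume the setting described in the context. Let $\Omega=(0,\infty)\times\mathbb{R}^n$ and let $\varphi\in C(\mathbb{R}^n)$ be bounded. Then $u(t,x):=\int_{\mathbb{R}^n}\Gamma(0,y;t,x)\varphi(y)\,dy$, $(t,x)\in\Omega$, is the unique bounded classical solution of the Cauchy problem $\mathcal{H}u=0$ in $\Omega$, $u(0,x)=\varphi(x)$ for $x\in\mathbb{R}^n$; furthermore $\sup_\Omega|u|\le\sup_{\mathbb{R}^n}|\varphi|$.
   Context: Let $X_1,\dots,X_m$ be smooth vector fields on $\mathbb{R}^n$, linearly independent in the vector space of smooth vector fields, satisfying: (H.1) there are reals $1=\sigma_1\le\dots\le\sigma_n$ such that, with $\delta_\lambda(x)=(\lambda^{\sigma_1}x_1,\dots,\lambda^{\sigma_n}x_n)$, $X_j(f\circ\delta_\lambda)=\lambda(X_jf)\circ\delta_\lambda$ for all $\lambda>0$, $f\in C^\infty(\mathbb{R}^n)$; (H.2) $\dim\{Y(0):Y\in\mathrm{Lie}\{X_1,\dots,X_m\}\}=n$. Let $N=\dim\mathrm{Lie}\{X_1,\dots,X_m\}$, assume $N>n$, $p=N-n$. Let $\mathcal{H}=\sum_jX_j^2-\partial_t$ on $\mathbb{R}^{1+n}$. Fix a homogeneous Carnot group $\mathbb{G}=(\mathbb{R}^N,\star)$ on $\mathbb{R}^N=\mathbb{R}^n_x\times\mathbb{R}^p_\xi$ with dilations $D_\lambda(x,\xi)=(\delta_\lambda(x),\delta^*_\lambda(\xi))$, $\delta^*_\lambda(\xi)=(\lambda^{\sigma^*_1}\xi_1,\dots,\lambda^{\sigma^*_p}\xi_p)$,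 and left-invariant $D_\lambda$-homogeneous of degree 1 vector fields $Z_1,\dots,Z_m$ Lie-generating its Lie algebra with $Z_i(f\circ\pi)(x,\xi)=(X_if)(x)$ for $f\in C^\infty(\mathbb{R}^n)$, $\pi(x,\xi)=x$ (such objects exist). Let $\gamma_{\mathbb{G}}$ be the unique fundamental solution of $\sum_jZ_j^2-\partial_t$ on $\mathbb{R}^{1+N}$ with pole at the origin vanishing at infinity, and $\Gamma(t,x;s,y)=\int_{\mathbb{R}^p}\gamma_{\mathbb{G}}(s-t,(x,0)^{-1}\star(y,\eta))\,d\eta$. A classical solution of the Cauchy problem is a function $u\in C^2(\Omega)$ with $\mathcal{H}u=0$ on $\Omega$, continuous up to $\overline{\Omega}$, with $u(0,x)=\varphi(x)$ for every $x\in\mathbb{R}^n$. *)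

theory Defs
  imports "HOL-Analysis.Analysis"
begin

definition pd :: "'a::euclidean_space \<Rightarrow> ('a \<Rightarrow> 'b::real_normed_vector) \<Rightarrow> 'a \<Rightarrow> 'b" where
  "pd b f x = frechet_derivative f (at x) b"

primrec dpart :: "'a::euclidean_space list \<Rightarrow> ('a \<Rightarrow> 'b::real_normed_vector) \<Rightarrow> 'a \<Rightarrow> 'b" where
  "dpart [] f = f"
| "dpart (b # bs) f = pd b (dpart bs f)"

definition smooth_on :: "'a::euclidean_space set \<Rightarrow> ('a \<Rightarrow> 'b::real_normed_vector) \<Rightarrow> bool" where
  "smooth_on S f \<longleftrightarrow> (\<forall>bs. set bs \<subseteq> Basis \<longrightarrow> (\<forall>x\<in>S. dpart bs f differentiable (at x)))"

abbreviation smooth :: "('a::euclidean_space \<Rightarrow> 'b::real_normed_vector) \<Rightarrow> bool" where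
  "smooth f \<equiv> smooth_on UNIV f"

definition C2_on :: "'a::euclidean_space set \<Rightarrow> ('a \<Rightarrow> real) \<Rightarrow> bool" where
  "C2_on S u \<longleftrightarrow>
     (\<forall>bs. set bs \<subseteq> Basis \<and> length bs \<le> 1 \<longrightarrow> (\<forall>x\<in>S. dpart bs u differentiable (at x))) \<and>
     (\<forall>bs. set bs \<subseteq> Basis \<and> length bs = 2 \<longrightarrow> continuous_on S (dpart bs u))"

text \<open>A vector field on 'a is given by its coefficient map V; acting as sum_k V_k d_k.\<close>
definition vf :: "('a::euclidean_space \<Rightarrow> 'a) \<Rightarrow> ('a \<Rightarrow> 'b::real_normed_vector) \<Rightarrow> 'a \<Rightarrow> 'b" where
  "vf V f x = (\<Sum>b\<in>Basis. (V x \<bullet> b) *\<^sub>R pd b f x)"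

definition vf_adj :: "('a::euclidean_space \<Rightarrow> 'a) \<Rightarrow> ('a \<Rightarrow> real) \<Rightarrow> 'a \<Rightarrow> real" where
  "vf_adj V \<phi> x = - (\<Sum>b\<in>Basis. pd b (\<lambda>y. (V y \<bullet> b) * \<phi> y) x)"

definition lie_br :: "('a::euclidean_space \<Rightarrow> 'a) \<Rightarrow> ('a \<Rightarrow> 'a) \<Rightarrow> 'a \<Rightarrow> 'a" where
  "lie_br V W x = vf V W x - vf W V x"

inductive_set lie_gen :: "('a::euclidean_space \<Rightarrow> 'a) set \<Rightarrow> ('a \<Rightarrow> 'a) set" for S where
  base: "V \<in> S \<Longrightarrow> V \<in> lie_gen S"
| add: "V \<in> lie_gen S \<Longrightarrow> W \<in> lie_gen S \<Longrightarrow> (\<lambda>x. V x + W x) \<in> lie_gen S"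
| scale: "V \<in> lie_gen S \<Longrightarrow> (\<lambda>x. c *\<^sub>R V x) \<in> lie_gen S"
| br: "V \<in> lie_gen S \<Longrightarrow> W \<in> lie_gen S \<Longrightarrow> lie_br V W \<in> lie_gen S"

definition vf_indep :: "nat \<Rightarrow> (nat \<Rightarrow> 'a \<Rightarrow> 'a::real_vector) \<Rightarrow> bool" where
  "vf_indep k V \<longleftrightarrow> (\<forall>c. (\<forall>x. (\<Sum>i<k. c i *\<^sub>R V i x) = 0) \<longrightarrow> (\<forall>i<k. c i = 0))"

definition vf_dim :: "('a \<Rightarrow> 'a::real_vector) set \<Rightarrow> nat \<Rightarrow> bool" where
  "vf_dim L d \<longleftrightarrow> (\<exists>B. (\<forall>i<d. B i \<in> L) \<and> vf_indep d B \<and>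
      (\<forall>V\<in>L. \<exists>c. V = (\<lambda>x. \<Sum>i<d. c i *\<^sub>R B i x)))"

definition dil :: "real^'n \<Rightarrow> real \<Rightarrow> real^'n \<Rightarrow> real^'n" where
  "dil \<sigma> r x = (\<chi> i. (r powr (\<sigma> $ i)) * x $ i)"

definition Dil :: "real^'n \<Rightarrow> real^'p \<Rightarrow> real \<Rightarrow> (real^'n) \<times> (real^'p) \<Rightarrow> (real^'n) \<times> (real^'p)" where
  "Dil \<sigma> \<sigma>' r z = (dil \<sigma> r (fst z), dil \<sigma>' r (snd z))"

text \<open>Standing hypotheses on X_1..X_m: smooth, linearly independent, (H.1), (H.2),
  and dim Lie{X} = N = n + p (so N > n, p = N - n).\<close>
definition hyp_X :: "nat \<Rightarrow> (nat \<Rightarrow> real^'n \<Rightarrow> real^'n) \<Rightarrow> real^'n \<Rightarrow> 'p itself \<Rightarrow> bool" where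
  "hyp_X m X \<sigma> _ \<longleftrightarrow>
     (\<forall>j<m. smooth (X j)) \<and> vf_indep m X \<and>
     (\<forall>i. 1 \<le> \<sigma> $ i) \<and> (\<exists>i. \<sigma> $ i = 1) \<and>
     (\<forall>j<m. \<forall>r>0. \<forall>f::real^'n \<Rightarrow> real. smooth f \<longrightarrow>
        (\<forall>x. vf (X j) (f \<circ> dil \<sigma> r) x = r * vf (X j) f (dil \<sigma> r x))) \<and>
     dim ((\<lambda>Y. Y 0) ` lie_gen (X ` {..<m})) = CARD('n) \<and>
     vf_dim (lie_gen (X ` {..<m})) (CARD('n) + CARD('p))"

definition carnot_lift ::
  "nat \<Rightarrow> (nat \<Rightarrow> real^'n \<Rightarrow> real^'n) \<Rightarrow> real^'n \<Rightarrow> real^'p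
   \<Rightarrow> ((real^'n) \<times> (real^'p) \<Rightarrow> (real^'n) \<times> (real^'p) \<Rightarrow> (real^'n) \<times> (real^'p))
   \<Rightarrow> ((real^'n) \<times> (real^'p) \<Rightarrow> (real^'n) \<times> (real^'p))
   \<Rightarrow> (nat \<Rightarrow> (real^'n) \<times> (real^'p) \<Rightarrow> (real^'n) \<times> (real^'p)) \<Rightarrow> bool" where
  "carnot_lift m X \<sigma> \<sigma>' gop ginv Z \<longleftrightarrow>
     (\<forall>a b c. gop (gop a b) c = gop a (gop b c)) \<and>
     (\<forall>a. gop 0 a = a \<and> gop a 0 = a \<and> gop a (ginv a) = 0 \<and> gop (ginv a) a = 0) \<and>
     smooth (\<lambda>w. gop (fst w) (snd w)) \<and> smooth ginv \<and>
     (\<forall>k. 1 \<le> \<sigma>' $ k) \<and>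
     (\<forall>r>0. \<forall>a b. Dil \<sigma> \<sigma>' r (gop a b) = gop (Dil \<sigma> \<sigma>' r a) (Dil \<sigma> \<sigma>' r b)) \<and>
     (\<forall>j<m. smooth (Z j)) \<and>
     (\<forall>j<m. \<forall>a. \<forall>f::(real^'n) \<times> (real^'p) \<Rightarrow> real. smooth f \<longrightarrow>
        (\<forall>z. vf (Z j) (\<lambda>y. f (gop a y)) z = vf (Z j) f (gop a z))) \<and>
     (\<forall>j<m. \<forall>r>0. \<forall>f::(real^'n) \<times> (real^'p) \<Rightarrow> real. smooth f \<longrightarrow>
        (\<forall>z. vf (Z j) (f \<circ> Dil \<sigma> \<sigma>' r) z = r * vf (Z j) f (Dil \<sigma> \<sigma>' r z))) \<and>
     lie_gen (Z ` {..<m}) =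
       {V. smooth V \<and> (\<forall>a. \<forall>f::(real^'n) \<times> (real^'p) \<Rightarrow> real. smooth f \<longrightarrow>
              (\<forall>z. vf V (\<lambda>y. f (gop a y)) z = vf V f (gop a z)))} \<and>
     (\<forall>j<m. \<forall>f::real^'n \<Rightarrow> real. smooth f \<longrightarrow>
        (\<forall>z. vf (Z j) (\<lambda>w. f (fst w)) z = vf (X j) f (fst z)))"

definition liftx :: "('a::euclidean_space \<Rightarrow> 'a) \<Rightarrow> real \<times> 'a \<Rightarrow> real \<times> 'a" where
  "liftx V z = (0, V (snd z))"

definition heat_op :: "nat \<Rightarrow> (nat \<Rightarrow> 'a::euclidean_space \<Rightarrow> 'a) \<Rightarrow> (real \<times> 'a \<Rightarrow> real) \<Rightarrow> real \<times> 'a \<Rightarrow> real" where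
  "heat_op m V u z = (\<Sum>j<m. vf (liftx (V j)) (vf (liftx (V j)) u) z) - pd (1, 0) u z"

definition heat_op_adj :: "nat \<Rightarrow> (nat \<Rightarrow> 'a::euclidean_space \<Rightarrow> 'a) \<Rightarrow> (real \<times> 'a \<Rightarrow> real) \<Rightarrow> real \<times> 'a \<Rightarrow> real" where
  "heat_op_adj m V \<phi> z = (\<Sum>j<m. vf_adj (liftx (V j)) (vf_adj (liftx (V j)) \<phi>) z) + pd (1, 0) \<phi> z"

definition fund_sol_0 :: "nat \<Rightarrow> (nat \<Rightarrow> 'a::euclidean_space \<Rightarrow> 'a) \<Rightarrow> (real \<times> 'a \<Rightarrow> real) \<Rightarrow> bool" where
  "fund_sol_0 m V \<gamma> \<longleftrightarrow>
     (\<forall>K. compact K \<longrightarrow> set_integrable lborel K \<gamma>) \<and>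
     smooth_on (UNIV - {0}) \<gamma> \<and>
     (\<gamma> \<longlongrightarrow> 0) at_infinity \<and>
     (\<forall>\<phi>. smooth \<phi> \<and> bounded {z. \<phi> z \<noteq> 0} \<longrightarrow>
        integrable lborel (\<lambda>z. \<gamma> z * heat_op_adj m V \<phi> z) \<and>
        (LINT z|lborel. \<gamma> z * heat_op_adj m V \<phi> z) = - \<phi> 0)"

definition Gam ::
  "(real \<times> ((real^'n) \<times> (real^'p)) \<Rightarrow> real) \<Rightarrow> ((real^'n) \<times> (real^'p) \<Rightarrow> (real^'n) \<times> (real^'p) \<Rightarrow> (real^'n) \<times> (real^'p))
   \<Rightarrow> ((real^'n) \<times> (real^'p) \<Rightarrow> (real^'n) \<times> (real^'p)) \<Rightarrow> real \<Rightarrow> real^'n \<Rightarrow> real \<Rightarrow> real^'n \<Rightarrow> real" where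
  "Gam \<gamma> gop ginv t x s y = (LINT \<eta>|lborel. \<gamma> (s - t, gop (ginv (x, 0)) (y, \<eta>)))"

definition classical_sol :: "nat \<Rightarrow> (nat \<Rightarrow> real^'n \<Rightarrow> real^'n) \<Rightarrow> (real^'n \<Rightarrow> real) \<Rightarrow> (real \<times> (real^'n) \<Rightarrow> real) \<Rightarrow> bool" where
  "classical_sol m X \<phi> u \<longleftrightarrow>
     C2_on ({0<..} \<times> UNIV) u \<and>
     (\<forall>z\<in>{0<..} \<times> UNIV. heat_op m X u z = 0) \<and>
     continuous_on ({0..} \<times> UNIV) u \<and>
     (\<forall>x. u (0, x) = \<phi> x)"

end

theory Submission
  imports Defs
begin

text \<open>
  Mollifying from the left on the group turns the distributional equation for \<open>\<gamma>\<close> into a pointwise one,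
  so the classical maximum principle applies. It gives \<open>\<gamma> \<ge> 0\<close>, the vanishing of \<open>\<gamma>\<close> for \<open>t \<le> 0\<close>
  and, by uniqueness, the homogeneity of \<open>\<gamma>\<close> of degree \<open>-Q\<close> under the parabolic dilations. Since \<open>\<gamma>\<close> is
  smooth off the origin and vanishes for \<open>t \<le> 0\<close>, homogeneity also makes it and its derivatives decay like
  the power \<open>-(Q + 1)\<close> of a homogeneous norm, locally uniformly in \<open>t > 0\<close>. Hence \<open>\<gamma>\<close> may be integrated over the group, it
  has mass 1, and its convolution with \<open>\<phi> \<circ> fst\<close> solves the Cauchy problem on the group. Right
  translations descend to \<open>\<real>\<^sup>n\<close>, so that solution depends on \<open>x\<close> only, and a measure-preserving
  change of variables identifies it with \<open>u\<close>. Uniqueness on \<open>\<real>\<^sup>n\<close> follows by comparison with a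
  slowly varying, rescaled bump function.
\<close>

section \<open>Differentiability classes\<close>

text \<open>The hypothesis \<open>fund_sol_0\<close> offers a distributional equation, smoothness
  off the pole and decay at infinity, but no rate and no sign. Mollification acts on the left
  because the fields are left-invariant: averaging left translates commutes with the operator and
  replaces the point source by a bump. The equation then holds at every point with a right side of
  one sign, and no singularity obstructs the maximum principle. The decay exponent is the delicate
  point. At fixed time, homogeneity of degree -Q by itself yields decay of order -Q in a homogeneous
  norm, which just fails to be integrable over a group of homogeneous dimension Q. Away from the
  pole the kernel is smooth and vanishes for negative times, hence is O(t) near t = 0; time has
  weight 2, so rescaling gains two powers, of which one is spent. Lie generation enters through the
  projection to the base. Only the generators are assumed to project, and generation extends this to
  every left-invariant field, and from there to right translations.\<close>

primrec Ck :: "nat \<Rightarrow> 'a::euclidean_space set \<Rightarrow> ('a \<Rightarrow> 'b::real_normed_vector) \<Rightarrow> bool" where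
  "Ck 0 S f \<longleftrightarrow> continuous_on S f"
| "Ck (Suc k) S f \<longleftrightarrow> (\<forall>x\<in>S. f differentiable (at x)) \<and> (\<forall>b\<in>Basis. Ck k S (pd b f))"

lemmas frechet_derivative_worksI = frechet_derivative_works[THEN iffD1]

lemma has_derivative_pd: "(f has_derivative F) (at x) \<Longrightarrow> pd b f x = F b"
  unfolding pd_def using frechet_derivative_at by metis

lemma frechet_derivative_pd:
  fixes f :: "'a::euclidean_space \<Rightarrow> 'b::real_normed_vector"
  assumes "f differentiable (at x)"
  shows "frechet_derivative f (at x) h = (\<Sum>b\<in>Basis. (h \<bullet> b) *\<^sub>R pd b f x)"
proof -
  interpret linear "frechet_derivative f (at x)"
    by (rule linear_frechet_derivative[OF assms])
  have "frechet_derivative f (at x) h = frechet_derivative f (at x) (\<Sum>b\<in>Basis. (h \<bullet> b) *\<^sub>R b)"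
    by (simp add: euclidean_representation)
  then show ?thesis by (simp add: sum scale pd_def)
qed

lemma differentiable_pd:
  fixes f :: "'a::euclidean_space \<Rightarrow> 'b::real_normed_vector"
  assumes "f differentiable (at x)"
  shows "(f has_derivative (\<lambda>h. \<Sum>b\<in>Basis. (h \<bullet> b) *\<^sub>R pd b f x)) (at x)"
proof -
  have "frechet_derivative f (at x) = (\<lambda>h. \<Sum>b\<in>Basis. (h \<bullet> b) *\<^sub>R pd b f x)"
    using frechet_derivative_pd[OF assms] by blast
  then show ?thesis using frechet_derivative_worksI[OF assms] by simp
qed

lemma vf_eq_frechet:
  fixes f :: "'a::euclidean_space \<Rightarrow> 'b::real_normed_vector"
  assumes "f differentiable (at x)"
  shows "vf V f x = frechet_derivative f (at x) (V x)"
  unfolding vf_def frechet_derivative_pd[OF assms] ..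

lemma has_derivative_vf: "(f has_derivative F) (at x) \<Longrightarrow> vf V f x = F (V x)"
  using vf_eq_frechet frechet_derivative_at differentiableI by metis

lemma pd_cong_open:
  assumes "open S" "x \<in> S" "\<And>y. y \<in> S \<Longrightarrow> f y = g y"
  shows "pd b f x = pd b g x"
proof (cases "f differentiable (at x)")
  case True
  then have F: "(f has_derivative frechet_derivative f (at x)) (at x)"
    by (rule frechet_derivative_worksI)
  then have "(g has_derivative frechet_derivative f (at x)) (at x)"
    by (rule has_derivative_transform_within_open[OF _ assms(1,2)]) (use assms in auto)
  then show ?thesis using F by (simp add: has_derivative_pd)
next
  case False
  \<comment> \<open>\<open>frechet_derivative\<close> is a choice from the set of all derivatives,
    so equal sets give equal values even when both are empty.\<close>
  have "\<And>F. (f has_derivative F) (at x) = (g has_derivative F) (at x)"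
    by (metis (no_types, lifting) assms has_derivative_transform_within_open)
  then show ?thesis unfolding pd_def frechet_derivative_def by simp
qed

lemma differentiable_cong_open:
  assumes "open S" "x \<in> S" "\<And>y. y \<in> S \<Longrightarrow> f y = g y"
  shows "f differentiable (at x) \<longleftrightarrow> g differentiable (at x)"
  unfolding differentiable_def
  by (metis (no_types, lifting) assms has_derivative_transform_within_open)

lemma dpart_cong_open:
  assumes "open S" "x \<in> S" "\<And>y. y \<in> S \<Longrightarrow> f y = g y"
  shows "dpart bs f x = dpart bs g x"
  using assms(2) by (induction bs arbitrary: x) (auto intro!: assms(3) pd_cong_open[OF assms(1)])

lemma dpart_append: "dpart (as @ bs) f = dpart as (dpart bs f)"
  by (induction as) auto

lemma Ck_cong:
  assumes "open S" "\<And>y. y \<in> S \<Longrightarrow> f y = g y"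
  shows "Ck k S f \<longleftrightarrow> Ck k S g"
  using assms(2)
proof (induction k arbitrary: f g)
  case 0
  then show ?case by (simp cong: continuous_on_cong)
next
  case (Suc k)
  have "Ck k S (pd b f) = Ck k S (pd b g)" for b
    using Suc.prems assms(1) by (intro Suc.IH pd_cong_open[of S]) auto
  moreover have "(\<forall>x\<in>S. f differentiable (at x)) = (\<forall>x\<in>S. g differentiable (at x))"
    using Suc.prems assms(1) differentiable_cong_open[of S _ f g] by auto
  ultimately show ?case by simp
qed

lemma Ck_subset: "Ck k S f \<Longrightarrow> T \<subseteq> S \<Longrightarrow> Ck k T f"
  by (induction k arbitrary: f) (auto intro: continuous_on_subset)

lemma Ck_differentiable: "Ck k S f \<Longrightarrow> 0 < k \<Longrightarrow> x \<in> S \<Longrightarrow> f differentiable (at x)"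
  by (cases k) auto

lemma Ck_pd: "Ck (Suc k) S f \<Longrightarrow> b \<in> Basis \<Longrightarrow> Ck k S (pd b f)"
  by simp

lemma Ck_continuous: "Ck k S f \<Longrightarrow> continuous_on S f"
  by (cases k) (auto intro!: continuous_at_imp_continuous_on differentiable_imp_continuous_within)

lemma Ck_Suc: "Ck (Suc k) S f \<Longrightarrow> Ck k S f"
proof (induction k arbitrary: f)
  case 0
  then show ?case using Ck_continuous by fastforce
qed auto

lemma Ck_mono: "Ck l S f \<Longrightarrow> k \<le> l \<Longrightarrow> Ck k S f"
  using Ck_Suc by (induction l) (auto simp: le_Suc_eq simp del: Ck.simps)

lemma Ck_local:
  fixes S :: "'a::euclidean_space set"
  assumes "\<And>x. x \<in> S \<Longrightarrow> \<exists>T. open T \<and> x \<in> T \<and> Ck k T f"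
  shows "Ck k S f"
  using assms
proof (induction k arbitrary: f)
  case 0
  then show ?case
    by (metis Ck.simps(1) continuous_at_imp_continuous_on continuous_on_eq_continuous_at)
next
  case (Suc k)
  have "f differentiable (at x)" if "x \<in> S" for x
    using Suc.prems[OF that] by auto
  moreover have "Ck k S (pd b f)" if "b \<in> Basis" for b
    by (rule Suc.IH) (use Suc.prems that in fastforce)
  ultimately show ?case by simp
qed

lemma Ck_dpart_append:
  "Ck (length bs + k) S f \<Longrightarrow> set bs \<subseteq> Basis \<Longrightarrow> Ck k S (dpart bs f)"
proof (induction bs arbitrary: k)
  case (Cons b bs)
  have "Ck (Suc k) S (dpart bs f)"
    by (rule Cons.IH) (use Cons.prems in auto)
  then show ?case using Cons.prems by simp
qed simp

lemma Ck_dpart: "Ck l S f \<Longrightarrow> set bs \<subseteq> Basis \<Longrightarrow> length bs + k \<le> l \<Longrightarrow> Ck k S (dpart bs f)"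
  by (rule Ck_dpart_append) (auto intro: Ck_mono)

text \<open>\<open>Ck\<close> peels off the innermost derivative, which is the last entry of a
  \<open>dpart\<close> list, so that products and compositions go through by induction on the order.
  This lemma returns to the list form in which \<open>smooth_on\<close> and \<open>C2_on\<close> are
  stated.\<close>

lemma Ck_iff_dpart:
  fixes S :: "'a::euclidean_space set"
  shows
  "Ck k S f \<longleftrightarrow> (\<forall>bs. set bs \<subseteq> Basis \<and> length bs < k \<longrightarrow> (\<forall>x\<in>S. dpart bs f differentiable (at x))) \<and>
     (\<forall>bs. set bs \<subseteq> Basis \<and> length bs = k \<longrightarrow> continuous_on S (dpart bs f))"
proof (induction k arbitrary: f)
  case (Suc k)
  have 1: "(\<forall>bs. set bs \<subseteq> Basis \<and> length bs < Suc k \<longrightarrow> (\<forall>x\<in>S. dpart bs f differentiable (at x))) \<longleftrightarrow>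
     (\<forall>x\<in>S. f differentiable (at x)) \<and> (\<forall>b\<in>Basis. \<forall>bs. set bs \<subseteq> Basis \<and> length bs < k \<longrightarrow>
        (\<forall>x\<in>S. dpart bs (pd b f) differentiable (at x)))" (is "?L = ?R")
  proof
    assume L: ?L
    have "dpart bs (pd b f) differentiable (at x)"
      if "b \<in> Basis" "set bs \<subseteq> Basis" "length bs < k" "x \<in> S" for b :: 'a and bs and x
      using L[rule_format, of "bs @ [b]" x] that by (simp add: dpart_append)
    then show ?R using L[rule_format, of "[]"] by simp
  next
    assume R: ?R
    show ?L
    proof (intro allI impI ballI)
      fix bs :: "'a list" and x assume "set bs \<subseteq> Basis \<and> length bs < Suc k" "x \<in> S"
      then show "dpart bs f differentiable (at x)"
        using R by (cases bs rule: rev_cases) (auto simp: dpart_append)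
    qed
  qed
  have 2: "(\<forall>bs. set bs \<subseteq> Basis \<and> length bs = Suc k \<longrightarrow> continuous_on S (dpart bs f)) \<longleftrightarrow>
     (\<forall>b\<in>Basis. \<forall>bs. set bs \<subseteq> Basis \<and> length bs = k \<longrightarrow> continuous_on S (dpart bs (pd b f)))" (is "?L = ?R")
  proof
    assume L: ?L
    have "continuous_on S (dpart bs (pd b f))"
      if "b \<in> Basis" "set bs \<subseteq> Basis" "length bs = k" for b :: 'a and bs 
      using L[rule_format, of "bs @ [b]"] that by (simp add: dpart_append)
    then show ?R by simp
  next
    assume R: ?R
    show ?L
    proof (intro allI impI)
      fix bs :: "'a list" assume "set bs \<subseteq> Basis \<and> length bs = Suc k"
      then show "continuous_on S (dpart bs f)"
        using R by (cases bs rule: rev_cases) (auto simp: dpart_append)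
    qed
  qed
  show ?case unfolding 1 2 Ck.simps Suc.IH by blast
qed simp

lemma C2_on_iff_Ck: "C2_on S u \<longleftrightarrow> Ck 2 S u"
  unfolding C2_on_def Ck_iff_dpart by (simp add: less_Suc_eq_le numeral_2_eq_2)

lemma smooth_on_iff_Ck:
  fixes S :: "'a::euclidean_space set"
  shows "smooth_on S f \<longleftrightarrow> (\<forall>k. Ck k S f)"
proof
  assume L: "smooth_on S f"
  show "\<forall>k. Ck k S f"
    unfolding Ck_iff_dpart using L unfolding smooth_on_def
    by (auto intro!: continuous_at_imp_continuous_on differentiable_imp_continuous_within)
next
  assume R: "\<forall>k. Ck k S f"
  have "dpart bs f differentiable (at x)" if "set bs \<subseteq> Basis" "x \<in> S" for bs :: "'a list" and x
    using R[rule_format, of "Suc (length bs)"] that unfolding Ck_iff_dpart by auto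
  then show "smooth_on S f" unfolding smooth_on_def by blast
qed

lemma smooth_on_Ck: "smooth_on S f \<Longrightarrow> Ck k S f"
  by (simp add: smooth_on_iff_Ck)

lemma Ck_SucI:
  fixes S :: "'a::euclidean_space set"
  assumes "open S" "\<And>x. x \<in> S \<Longrightarrow> (f has_derivative F x) (at x)"
    "\<And>b. b \<in> Basis \<Longrightarrow> Ck k S (\<lambda>x. F x b)"
  shows "Ck (Suc k) S f"
proof -
  have "Ck k S (pd b f)" if "b \<in> Basis" for b
    using assms(3)[OF that] Ck_cong[OF assms(1), of "pd b f" "\<lambda>x. F x b" k]
      has_derivative_pd[OF assms(2)] by blast
  then show ?thesis using differentiableI[OF assms(2)] by simp
qed

lemma Ck_const [intro, simp]:
  fixes S :: "'a::euclidean_space set"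
  shows "Ck k S (\<lambda>x. c)"
proof (induction k arbitrary: c)
  case (Suc k)
  have "pd b (\<lambda>x. c) = (\<lambda>x. 0)" for b :: 'a
    by (rule ext, rule has_derivative_pd[OF has_derivative_const])
  then show ?case using Suc by simp
qed simp

lemma Ck_bounded_linear:
  fixes S :: "'a::euclidean_space set"
  assumes L: "bounded_linear L" and "open S" "Ck k S f"
  shows "Ck k S (\<lambda>x. L (f x))"
  using assms(3)
proof (induction k arbitrary: f)
  case 0
  then show ?case using linear_continuous_on_compose
    by (metis Ck.simps(1) L continuous_on_compose2 linear_continuous_on subset_UNIV)
next
  case (Suc k)
  show ?case
  proof (rule Ck_SucI[OF \<open>open S\<close>])
    fix x assume "x \<in> S"
    then have "(f has_derivative frechet_derivative f (at x)) (at x)"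
      using Suc.prems by (intro frechet_derivative_worksI) auto
    then show "((\<lambda>x. L (f x)) has_derivative (\<lambda>h. L (frechet_derivative f (at x) h))) (at x)"
      by (rule bounded_linear.has_derivative[OF L])
  next
    fix b :: 'a assume "b \<in> Basis"
    then show "Ck k S (\<lambda>x. L (frechet_derivative f (at x) b))"
      using Suc.IH[of "pd b f"] Suc.prems by (simp add: pd_def[abs_def])
  qed
qed

lemma Ck_ident [intro, simp]: "open S \<Longrightarrow> Ck k S (\<lambda>x. x)"
  by (cases k) (auto simp del: Ck.simps(2) intro!: Ck_SucI[where F="\<lambda>x h. h"])

lemma Ck_linear: "bounded_linear L \<Longrightarrow> open S \<Longrightarrow> Ck k S L"
  using Ck_bounded_linear[of L S k "\<lambda>x. x"] by simp

lemma Ck_add: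
  fixes S :: "'a::euclidean_space set"
  assumes "open S" "Ck k S f" "Ck k S g"
  shows "Ck k S (\<lambda>x. f x + g x)"
  using assms(2,3)
proof (induction k arbitrary: f g)
  case (Suc k)
  show ?case
  proof (rule Ck_SucI[OF \<open>open S\<close>])
    fix x assume "x \<in> S"
    then show "((\<lambda>x. f x + g x) has_derivative
        (\<lambda>h. frechet_derivative f (at x) h + frechet_derivative g (at x) h)) (at x)"
      using Suc.prems by (intro has_derivative_add frechet_derivative_worksI) auto
  next
    fix b :: 'a assume "b \<in> Basis"
    then show "Ck k S (\<lambda>x. frechet_derivative f (at x) b + frechet_derivative g (at x) b)"
      using Suc.IH[of "pd b f" "pd b g"] Suc.prems by (simp add: pd_def[abs_def])
  qed
qed (auto intro: continuous_on_add)

lemma Ck_bilinear: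
  fixes S :: "'a::euclidean_space set"
  assumes B: "bounded_bilinear B" and "open S" "Ck k S f" "Ck k S g"
  shows "Ck k S (\<lambda>x. B (f x) (g x))"
  using assms(3,4)
proof (induction k arbitrary: f g)
  case 0
  then show ?case by (simp add: bounded_bilinear.continuous_on[OF B])
next
  case (Suc k)
  show ?case
  proof (rule Ck_SucI[OF \<open>open S\<close>])
    fix x assume "x \<in> S"
    then show "((\<lambda>x. B (f x) (g x)) has_derivative
        (\<lambda>h. B (f x) (frechet_derivative g (at x) h) + B (frechet_derivative f (at x) h) (g x))) (at x)"
      using Suc.prems by (intro bounded_bilinear.FDERIV[OF B] frechet_derivative_worksI) auto
  next
    fix b :: 'a assume b: "b \<in> Basis"
    have "Ck k S f" "Ck k S g" using Suc.prems Ck_Suc by blast+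
    moreover have "Ck k S (\<lambda>x. frechet_derivative f (at x) b)" "Ck k S (\<lambda>x. frechet_derivative g (at x) b)"
      using Suc.prems b by (auto simp: pd_def[abs_def])
    ultimately show "Ck k S (\<lambda>x. B (f x) (frechet_derivative g (at x) b) + B (frechet_derivative f (at x) b) (g x))"
      by (intro Ck_add[OF \<open>open S\<close>] Suc.IH)
  qed
qed

lemmas Ck_mult = Ck_bilinear[OF bounded_bilinear_mult]
lemmas Ck_scaleR = Ck_bilinear[OF bounded_bilinear_scaleR]
lemmas Ck_inner = Ck_bilinear[OF bounded_bilinear_inner]

lemma Ck_uminus: "open S \<Longrightarrow> Ck k S f \<Longrightarrow> Ck k S (\<lambda>x. - f x)"
  using Ck_bounded_linear[OF bounded_linear_minus[OF bounded_linear_ident]] by blast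

lemma Ck_diff: "open S \<Longrightarrow> Ck k S f \<Longrightarrow> Ck k S g \<Longrightarrow> Ck k S (\<lambda>x. f x - g x)"
  using Ck_add[of S k f "\<lambda>x. - g x"] Ck_uminus[of S k g] by simp

lemma Ck_cmult: "open S \<Longrightarrow> Ck k S f \<Longrightarrow> Ck k S (\<lambda>x. (c::real) * f x)"
  using Ck_bounded_linear[OF bounded_linear_mult_right] by blast

lemma Ck_sum: "open S \<Longrightarrow> (\<And>i. i \<in> I \<Longrightarrow> Ck k S (f i)) \<Longrightarrow> Ck k S (\<lambda>x. \<Sum>i\<in>I. f i x)"
  by (induction I rule: infinite_finite_induct) (auto intro!: Ck_add)

lemma Ck_fst: "open S \<Longrightarrow> Ck k S f \<Longrightarrow> Ck k S (\<lambda>x. fst (f x))"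
  using Ck_bounded_linear[OF bounded_linear_fst] by blast

lemma Ck_snd: "open S \<Longrightarrow> Ck k S f \<Longrightarrow> Ck k S (\<lambda>x. snd (f x))"
  using Ck_bounded_linear[OF bounded_linear_snd] by blast

lemma Ck_Pair:
  fixes f :: "'a::euclidean_space \<Rightarrow> 'b::real_normed_vector" and g :: "'a \<Rightarrow> 'c::real_normed_vector"
  assumes "open S" "Ck k S f" "Ck k S g"
  shows "Ck k S (\<lambda>x. (f x, g x))"
proof -
  have "Ck k S (\<lambda>x. (f x, 0::'c))" "Ck k S (\<lambda>x. (0::'b, g x))"
    using assms by (auto intro!: Ck_bounded_linear[of "\<lambda>v. (v, 0::'c)"] Ck_bounded_linear[of "\<lambda>v. (0::'b, v)"]
        bounded_linear_Pair bounded_linear_ident bounded_linear_zero)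
  from Ck_add[OF assms(1) this] show ?thesis by simp
qed

lemma Ck_compose:
  fixes f :: "'b::euclidean_space \<Rightarrow> 'c::real_normed_vector" and g :: "'a::euclidean_space \<Rightarrow> 'b"
  assumes "open S" "open T" and g: "Ck k S g" "g ` S \<subseteq> T" and "Ck k T f"
  shows "Ck k S (\<lambda>x. f (g x))"
  using g(1) assms(5)
proof (induction k arbitrary: f)
  case 0
  then show ?case using g(2) continuous_on_compose2 by (metis Ck.simps(1))
next
  case (Suc k)
  show ?case
  proof (rule Ck_SucI[OF \<open>open S\<close>])
    fix x assume x: "x \<in> S"
    then have "(g has_derivative frechet_derivative g (at x)) (at x)"
      using Suc.prems by (intro frechet_derivative_worksI) auto
    moreover have "(f has_derivative (\<lambda>h. \<Sum>c\<in>Basis. (h \<bullet> c) *\<^sub>R pd c f (g x))) (at (g x))"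
      using Suc.prems(2) x g(2) by (intro differentiable_pd) auto
    ultimately show "((\<lambda>x. f (g x)) has_derivative
        (\<lambda>h. \<Sum>c\<in>Basis. (frechet_derivative g (at x) h \<bullet> c) *\<^sub>R pd c f (g x))) (at x)"
      using diff_chain_at[of g _ x f] by (simp add: o_def)
  next
    fix b :: 'a assume b: "b \<in> Basis"
    have g': "Ck k S g" using Suc.prems Ck_Suc by blast
    have "Ck k S (\<lambda>x. frechet_derivative g (at x) b)"
      using Suc.prems b by (auto simp: pd_def[abs_def])
    moreover have "Ck k S (\<lambda>x. pd c f (g x))" if "c \<in> Basis" for c
      using that Suc.IH[OF g', of "pd c f"] Suc.prems(2) by auto
    ultimately show "Ck k S (\<lambda>x. \<Sum>c\<in>Basis. (frechet_derivative g (at x) b \<bullet> c) *\<^sub>R pd c f (g x))"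
      using \<open>open S\<close> by (intro Ck_sum Ck_scaleR Ck_inner) auto
  qed
qed

lemma Ck_compose_UNIV:
  "open S \<Longrightarrow> Ck k S g \<Longrightarrow> Ck k UNIV f \<Longrightarrow> Ck k S (\<lambda>x. f (g x))"
  by (rule Ck_compose[of S UNIV]) auto

lemma Ck_vf:
  fixes f :: "'a::euclidean_space \<Rightarrow> 'b::real_normed_vector"
  assumes "open S" "Ck k S V" "Ck (Suc k) S f"
  shows "Ck k S (vf V f)"
  unfolding vf_def using assms by (intro Ck_sum Ck_scaleR Ck_inner) auto

lemma Ck_joint_slice:
  fixes F :: "'a::euclidean_space \<times> 'b::euclidean_space \<Rightarrow> 'c::real_normed_vector"
  assumes "open O'" "Ck k O' F"
  shows "Ck k {x. (x, y) \<in> O'} (\<lambda>x. F (x, y))"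
proof (rule Ck_compose[OF _ assms(1) _ _ assms(2)])
  show "open {x. (x, y) \<in> O'}"
  proof -
    have "{x. (x, y) \<in> O'} = (\<lambda>x. (x, y)) -` O'" by auto
    moreover have "open \<dots>" by (rule open_vimage[OF assms(1)]) (intro continuous_intros)
    ultimately show ?thesis by simp
  qed
  then show "Ck k {x. (x, y) \<in> O'} (\<lambda>x. (x, y))" by (intro Ck_Pair) auto
qed auto

lemma dpart_slice:
  fixes F :: "'a::euclidean_space \<times> 'b::euclidean_space \<Rightarrow> 'c::real_normed_vector"
  assumes "open O'" "Ck (length bs) O' F" "set bs \<subseteq> Basis" "(x, y) \<in> O'"
  shows "dpart bs (\<lambda>x. F (x, y)) x = dpart (map (\<lambda>b. (b, 0)) bs) F (x, y)"
  using assms(2-)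
proof (induction bs arbitrary: x)
  case (Cons b bs)
  let ?G = "dpart (map (\<lambda>b. (b, 0)) bs) F"
  let ?S = "{x. (x, y) \<in> O'}"
  have S: "open ?S"
  proof -
    have "?S = (\<lambda>x. (x, y)) -` O'" by auto
    moreover have "open \<dots>" by (rule open_vimage[OF assms(1)]) (intro continuous_intros)
    ultimately show ?thesis by simp
  qed
  have "Ck 1 O' ?G"
    by (rule Ck_dpart[OF Cons.prems(1)]) (use Cons.prems in \<open>auto simp: Basis_prod_def\<close>)
  then have "?G differentiable (at (x, y))" using Cons.prems(3) by auto
  then have G: "(?G has_derivative frechet_derivative ?G (at (x, y))) (at (x, y))"
    by (rule frechet_derivative_worksI)
  have "((\<lambda>x. ?G (x, y)) has_derivative (\<lambda>h. frechet_derivative ?G (at (x, y)) (h, 0))) (at x)"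
    by (rule has_derivative_compose[where f="\<lambda>x. (x, y)" and g="?G", OF _ G])
      (auto intro!: derivative_eq_intros)
  then have "pd b (\<lambda>x. ?G (x, y)) x = pd (b, 0) ?G (x, y)"
    by (subst has_derivative_pd) (auto simp: pd_def)
  moreover have "pd b (dpart bs (\<lambda>x. F (x, y))) x = pd b (\<lambda>x. ?G (x, y)) x"
    using Cons.prems Ck_mono[OF Cons.prems(1), of "length bs"]
    by (intro pd_cong_open[OF S]) (auto intro!: Cons.IH)
  ultimately show ?case by simp
qed simp

section \<open>Smooth bump functions\<close>

definition flat :: "real \<Rightarrow> real" where
  "flat x = (if x \<le> 0 then 0 else exp (- 1 / x))"

lemma flat_nonneg [simp]: "0 \<le> flat x"
  and flat_pos_iff [simp]: "0 < flat x \<longleftrightarrow> 0 < x"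
  and flat_le_1: "flat x \<le> 1"
  by (auto simp: flat_def)

lemma flat_over_power_tendsto: "((\<lambda>x. flat x / x ^ n) \<longlongrightarrow> 0) (at 0)"
proof -
  have "((\<lambda>x. inverse x ^ n / exp (inverse x)) \<longlongrightarrow> 0) (at_right (0::real))"
    using filterlim_compose[OF tendsto_power_div_exp_0 filterlim_inverse_at_top_right] by simp
  then have "((\<lambda>x. flat x / x ^ n) \<longlongrightarrow> 0) (at_right 0)"
    by (rule Lim_transform_eventually)
      (auto simp: flat_def eventually_at_right_less field_simps exp_minus power_inverse
        intro!: eventually_at_rightI[of 0 1])
  moreover have "((\<lambda>x. flat x / x ^ n) \<longlongrightarrow> 0) (at_left 0)"
    by (rule Lim_transform_eventually[OF tendsto_const])
      (auto simp: flat_def intro!: eventually_at_leftI[of "-1" 0])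
  ultimately show ?thesis by (simp add: filterlim_split_at)
qed

text \<open>The family \<open>flat x / x ^ n\<close> is closed under differentiation up to linear
  combinations, so a single induction over the order, for all \<open>n\<close> at once, makes
  \<open>flat\<close> smooth. At 0 every member has the value 0, which is its limit there because
  the exponential beats each power.\<close>

lemma flat_over_power_deriv:
  "((\<lambda>x. flat x / x ^ n) has_real_derivative
      flat x / x ^ (n + 2) - real n * (flat x / x ^ (n + 1))) (at x)"
proof -
  consider "x < 0" | "x = 0" | "x > 0" by linarith
  then show ?thesis
  proof cases
    case 1
    have "((\<lambda>x. 0) has_real_derivative 0) (at x)" by simp
    then have "((\<lambda>x. flat x / x ^ n) has_real_derivative 0) (at x)"
      by (rule has_field_derivative_transform_within_open[of _ _ _ "{..<0}"]) (use 1 in \<open>auto simp: flat_def\<close>)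
    then show ?thesis using 1 by (simp add: flat_def)
  next
    case 2
    have "((\<lambda>h. (flat h / h ^ n - 0) / h) \<longlongrightarrow> 0) (at 0)"
      using flat_over_power_tendsto[of "Suc n"] by (simp add: field_simps)
    moreover have "flat 0 = 0" by (simp add: flat_def)
    ultimately show ?thesis using 2 by (simp add: DERIV_def)
  next
    case 3
    have "((\<lambda>x. exp (- 1 / x) / x ^ n) has_real_derivative
      exp (- 1 / x) / x ^ (n + 2) - real n * (exp (- 1 / x) / x ^ (n + 1))) (at x)"
    proof -
      have "((\<lambda>x. x ^ n) has_real_derivative real n * x ^ n / x) (at x)"
        using 3 DERIV_pow[of n x UNIV] by (cases n) auto
      moreover have "((\<lambda>x. exp (- 1 / x)) has_real_derivative exp (- 1 / x) * (1 / x\<^sup>2)) (at x)"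
        using 3 by (auto intro!: derivative_eq_intros simp: power2_eq_square)
      ultimately show ?thesis
        using DERIV_divide[of "\<lambda>x. exp (- 1 / x)" _ x UNIV "\<lambda>x. x ^ n"] 3
        by (fastforce intro: DERIV_cong simp: field_simps power2_eq_square)
    qed
    then have "((\<lambda>x. flat x / x ^ n) has_real_derivative
      exp (- 1 / x) / x ^ (n + 2) - real n * (exp (- 1 / x) / x ^ (n + 1))) (at x)"
      by (rule has_field_derivative_transform_within_open[of _ _ _ "{0<..}"]) (use 3 in \<open>auto simp: flat_def\<close>)
    then show ?thesis using 3 by (simp add: flat_def)
  qed
qed

lemma Ck_flat: "Ck k UNIV flat"
proof -
  have "Ck k UNIV (\<lambda>x. flat x / x ^ n)" for n
  proof (induction k arbitrary: n)
    case 0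
    show ?case using flat_over_power_deriv DERIV_isCont
      by (metis Ck.simps(1) continuous_at_imp_continuous_on)
  next
    case (Suc k)
    show ?case
    proof (rule Ck_SucI)
      show "((\<lambda>x. flat x / x ^ n) has_derivative
        (\<lambda>h. (flat x / x ^ (n + 2) - real n * (flat x / x ^ (n + 1))) * h)) (at x)" for x
        using flat_over_power_deriv[of n x] by (simp add: has_field_derivative_def)
      show "Ck k UNIV (\<lambda>x. (flat x / x ^ (n + 2) - real n * (flat x / x ^ (n + 1))) * b)" for b
        by (intro Ck_mult Ck_diff Ck_cmult Suc.IH) auto
    qed auto
  qed
  from this[of 0] show ?thesis by simp
qed

definition bump :: "'a::euclidean_space \<Rightarrow> real \<Rightarrow> 'a \<Rightarrow> real" where
  "bump c r x = flat (r\<^sup>2 - (x - c) \<bullet> (x - c))"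

lemma Ck_bump: "Ck k UNIV (bump c r)"
  unfolding bump_def
  by (intro Ck_compose_UNIV[OF _ _ Ck_flat] Ck_diff Ck_inner) auto

lemma bump_nonneg [simp]: "0 \<le> bump c r x"
  and bump_le_1: "bump c r x \<le> 1"
  by (auto simp: bump_def flat_le_1)

lemma bump_pos_iff: "0 < r \<Longrightarrow> 0 < bump c r x \<longleftrightarrow> x \<in> ball c r"
proof -
  assume "0 < r"
  have "0 < bump c r x \<longleftrightarrow> (norm (x - c))\<^sup>2 < r\<^sup>2"
    by (simp add: bump_def power2_norm_eq_inner)
  also have "\<dots> \<longleftrightarrow> norm (x - c) < r"
    using \<open>0 < r\<close> by (meson less_imp_le norm_ge_zero power2_less_imp_less power_strict_mono zero_less_numeral)
  finally show ?thesis by (simp add: dist_norm norm_minus_commute)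
qed

lemma bump_eq_0: "0 < r \<Longrightarrow> x \<notin> ball c r \<Longrightarrow> bump c r x = 0"
  using bump_pos_iff[of r c x] bump_nonneg[of c r x] by linarith

lemma smooth_bump: "smooth (bump c r)"
  by (simp add: smooth_on_iff_Ck Ck_bump)

section \<open>Dilations and maps preserving Lebesgue measure\<close>

lemma nn_integral_lborel_plus:
  fixes f :: "'a::euclidean_space \<Rightarrow> ennreal"
  assumes [measurable]: "f \<in> borel_measurable borel"
  shows "(\<integral>\<^sup>+x. f (c + x) \<partial>lborel) = (\<integral>\<^sup>+x. f x \<partial>lborel)"
  by (subst (2) lborel_distr_plus[of c, symmetric]) (simp add: nn_integral_distr)

lemma nn_integral_shear:
  fixes f :: "'a::euclidean_space \<Rightarrow> ennreal"
  assumes [measurable]: "f \<in> borel_measurable borel" "q \<in> borel_measurable borel"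
    and b: "b \<in> Basis" and q: "\<And>w s. q (w + s *\<^sub>R b) = q w"
  shows "(\<integral>\<^sup>+w. f (w + q w *\<^sub>R b) \<partial>lborel) = (\<integral>\<^sup>+w. f w \<partial>lborel)"
proof -
  \<comment> \<open>Spreading the integral over all translates along \<open>b\<close> and translating in the extra variable
    turns both sides into the same double integral.\<close>
  have average: "(\<integral>\<^sup>+w. f (w + p w *\<^sub>R b) \<partial>lborel) =
      (\<integral>\<^sup>+w. \<integral>\<^sup>+s. f (w - s *\<^sub>R b) * indicator {0..1} (w \<bullet> b) \<partial>lborel \<partial>lborel)"
    if p: "\<And>w s. p (w + s *\<^sub>R b) = p w" and [measurable]: "p \<in> borel_measurable borel"
    for p :: "'a \<Rightarrow> real"
  proof -
    have "(\<integral>\<^sup>+s. indicator {0..1} (w \<bullet> b + s) \<partial>lborel) = (1::ennreal)" for w :: 'a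
      using nn_integral_lborel_plus[of "indicator {0..1::real}" "w \<bullet> b"] by simp
    then have "(\<integral>\<^sup>+w. f (w + p w *\<^sub>R b) \<partial>lborel) =
        (\<integral>\<^sup>+w. \<integral>\<^sup>+s. f (w + p w *\<^sub>R b) * indicator {0..1} (w \<bullet> b + s) \<partial>lborel \<partial>lborel)"
      by (simp add: nn_integral_cmult)
    also have "\<dots> = (\<integral>\<^sup>+s. \<integral>\<^sup>+w. f (w + p w *\<^sub>R b) * indicator {0..1} (w \<bullet> b + s) \<partial>lborel \<partial>lborel)"
      by (rule lborel_pair.Fubini') measurable
    also have "\<dots> = (\<integral>\<^sup>+s. \<integral>\<^sup>+w. f (w + (p w - s) *\<^sub>R b) * indicator {0..1} (w \<bullet> b) \<partial>lborel \<partial>lborel)"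
    proof (rule nn_integral_cong)
      fix s :: real
      have "p (w - s *\<^sub>R b) = p w" for w using p[of w "- s"] by simp
      then show "(\<integral>\<^sup>+w. f (w + p w *\<^sub>R b) * indicator {0..1} (w \<bullet> b + s) \<partial>lborel) =
          (\<integral>\<^sup>+w. f (w + (p w - s) *\<^sub>R b) * indicator {0..1} (w \<bullet> b) \<partial>lborel)"
        using b nn_integral_lborel_plus[of "\<lambda>w. f (w + p w *\<^sub>R b) * indicator {0..1} (w \<bullet> b + s)" "- (s *\<^sub>R b)"]
        by (simp add: algebra_simps inner_simps)
    qed
    also have "\<dots> = (\<integral>\<^sup>+w. \<integral>\<^sup>+s. f (w + (p w - s) *\<^sub>R b) * indicator {0..1} (w \<bullet> b) \<partial>lborel \<partial>lborel)"
      by (rule lborel_pair.Fubini'[symmetric]) measurable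
    also have "\<dots> = (\<integral>\<^sup>+w. \<integral>\<^sup>+s. f (w - s *\<^sub>R b) * indicator {0..1} (w \<bullet> b) \<partial>lborel \<partial>lborel)"
    proof (rule nn_integral_cong)
      fix w
      show "(\<integral>\<^sup>+s. f (w + (p w - s) *\<^sub>R b) * indicator {0..1} (w \<bullet> b) \<partial>lborel) =
          (\<integral>\<^sup>+s. f (w - s *\<^sub>R b) * indicator {0..1} (w \<bullet> b) \<partial>lborel)"
        using nn_integral_lborel_plus[of "\<lambda>s. f (w + (p w - s) *\<^sub>R b) * indicator {0..1} (w \<bullet> b)" "p w"]
        by simp
    qed
    finally show ?thesis .
  qed
  show ?thesis using average[of q] average[of "\<lambda>_. 0"] q by simp
qed

text \<open>The map multiplies one coordinate by the sign \<open>e\<close>. It is needed because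
  group inversion has derivative minus the identity at the origin.\<close>

lemma nn_integral_reflect:
  fixes f :: "'a::euclidean_space \<Rightarrow> ennreal"
  assumes [measurable]: "f \<in> borel_measurable borel" and b: "b \<in> Basis" and e: "\<bar>e\<bar> = 1"
  shows "(\<integral>\<^sup>+w. f (w + ((e - 1) * (w \<bullet> b)) *\<^sub>R b) \<partial>lborel) = (\<integral>\<^sup>+w. f w \<partial>lborel)"
proof -
  let ?c = "\<lambda>j. if j = b then e else 1"
  let ?T = "\<lambda>x. 0 + (\<Sum>j\<in>Basis. (?c j * (x \<bullet> j)) *\<^sub>R j)"
  have T: "?T x = x + ((e - 1) * (x \<bullet> b)) *\<^sub>R b" for x :: 'a
  proof (rule euclidean_eqI)
    fix i :: 'a assume i: "i \<in> Basis"
    have "?T x \<bullet> i = ?c i * (x \<bullet> i)" using i by simp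
    then show "?T x \<bullet> i = (x + ((e - 1) * (x \<bullet> b)) *\<^sub>R b) \<bullet> i"
      using i b by (simp add: inner_add_left inner_Basis algebra_simps)
  qed
  have "(\<Prod>j\<in>Basis. \<bar>?c j\<bar>) = 1" using e by (intro prod.neutral) auto
  moreover have "?c j \<noteq> 0" for j using e by auto
  ultimately have "lborel = distr lborel borel ?T"
    using lborel_affine_euclidean[of ?c 0] by (simp add: density_1)
  then have "(\<integral>\<^sup>+w. f w \<partial>lborel) = (\<integral>\<^sup>+w. f w \<partial>distr lborel borel ?T)" by simp
  also have "\<dots> = (\<integral>\<^sup>+w. f (?T w) \<partial>lborel)" by (rule nn_integral_distr) measurable
  finally show ?thesis unfolding T by simp
qed

text \<open>\<open>T\<close> is a composition of one sign change and one shear per coordinate, and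
  each of these preserves the measure. Coordinates are treated in order of decreasing weight: the
  shear in direction \<open>b\<close> is governed only by coordinates of weight strictly below that
  of \<open>b\<close>, which the earlier factors have left untouched.\<close>

lemma triangular_lborel:
  fixes T :: "'a::euclidean_space \<Rightarrow> 'a" and wt :: "'a \<Rightarrow> real"
  assumes [measurable]: "T \<in> borel_measurable borel"
    and e: "\<And>b. b \<in> Basis \<Longrightarrow> \<bar>e b\<bar> = 1"
    and T: "\<And>b c w s. b \<in> Basis \<Longrightarrow> c \<in> Basis \<Longrightarrow> wt b \<le> wt c \<Longrightarrow>
      T (w + s *\<^sub>R c) \<bullet> b = T w \<bullet> b + s * (if c = b then e b else 0)"
  shows "distr lborel borel T = lborel"
proof -
  \<comment> \<open>The part of coordinate \<open>b\<close> of \<open>T\<close> that is left after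
    the diagonal term; it is constant along \<open>b\<close> and along all directions of at least
    its weight.\<close>
  define q where "q b w = T w \<bullet> b - e b * (w \<bullet> b)" for b w
  have q_m [measurable]: "q b \<in> borel_measurable borel" for b by (simp add: q_def[abs_def])
  have q: "q b (w + s *\<^sub>R c) = q b w" if "b \<in> Basis" "c \<in> Basis" "wt b \<le> wt c" for b c w s
    using T[OF that] that by (auto simp: q_def inner_simps inner_Basis algebra_simps)
  \<comment> \<open>Interpolates between the identity, for \<open>B\<close> empty, and
    \<open>T\<close>, for \<open>B = Basis\<close>: the coordinates in \<open>B\<close> are those of
    \<open>T\<close>, the others are unchanged.\<close>
  define TB where "TB B w = w + (\<Sum>b\<in>B. (T w \<bullet> b - w \<bullet> b) *\<^sub>R b)" for B w
  have TB_m [measurable]: "TB B \<in> borel_measurable borel" for B by (simp add: TB_def[abs_def])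
  have q_sum: "q b (w + (\<Sum>c\<in>B. s c *\<^sub>R c)) = q b w"
    if "b \<in> Basis" "finite B" "B \<subseteq> Basis" "\<And>c. c \<in> B \<Longrightarrow> wt b \<le> wt c" for b B w and s :: "'a \<Rightarrow> real"
    using that(2-4)
  proof (induction B)
    case (insert c B)
    have "q b (w + (\<Sum>c\<in>insert c B. s c *\<^sub>R c)) = q b ((w + (\<Sum>c\<in>B. s c *\<^sub>R c)) + s c *\<^sub>R c)"
      using insert by (simp add: algebra_simps)
    then show ?case using q[OF \<open>b \<in> Basis\<close>, of c] insert by simp
  qed simp
  have main: "B \<subseteq> Basis \<longrightarrow> (\<forall>f\<in>borel_measurable borel. (\<integral>\<^sup>+w. f (TB B w) \<partial>lborel) = (\<integral>\<^sup>+w. (f w::ennreal) \<partial>lborel))"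
    if "finite B" for B
    using that
  proof (induction B rule: finite_ranking_induct[where f="\<lambda>b. - wt b"])
    case empty
    show ?case by (simp add: TB_def)
  next
    case (insert b B)
    show ?case
    proof (cases "b \<in> B")
      case True
      then show ?thesis using insert by (simp add: insert_absorb)
    next
      case False
      show ?thesis
      proof (intro impI ballI)
        assume sub: "insert b B \<subseteq> Basis"
        fix f :: "'a \<Rightarrow> ennreal" assume [measurable]: "f \<in> borel_measurable borel"
        have b: "b \<in> Basis" and B: "B \<subseteq> Basis" using sub by auto
        let ?R = "\<lambda>w. w + ((e b - 1) * (w \<bullet> b)) *\<^sub>R b"
        let ?S = "\<lambda>w. w + q b w *\<^sub>R b"
        have "TB (insert b B) w = ?S (?R (TB B w))" for w
        proof -
          have "TB B w \<bullet> b = w \<bullet> b + (\<Sum>c\<in>B. (T w \<bullet> c - w \<bullet> c) * (c \<bullet> b))"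
            by (simp add: TB_def inner_simps inner_sum_left)
          also have "(\<Sum>c\<in>B. (T w \<bullet> c - w \<bullet> c) * (c \<bullet> b)) = 0"
            using b B False by (intro sum.neutral) (auto simp: inner_Basis split: if_splits)
          finally have 1: "TB B w \<bullet> b = w \<bullet> b" by simp
          have "q b (?R (TB B w)) = q b (TB B w)" by (rule q[OF b b]) simp
          also have "\<dots> = q b w" unfolding TB_def
            by (rule q_sum[OF b]) (use insert.hyps B in auto)
          finally have "?S (?R (TB B w)) = TB B w + ((e b - 1) * (w \<bullet> b) + q b w) *\<^sub>R b"
            using 1 by (simp add: algebra_simps)
          moreover have "TB (insert b B) w = TB B w + (T w \<bullet> b - w \<bullet> b) *\<^sub>R b"
            using False insert.hyps by (simp add: TB_def)
          moreover have "(e b - 1) * (w \<bullet> b) + q b w = T w \<bullet> b - w \<bullet> b"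
            by (simp add: q_def algebra_simps)
          ultimately show ?thesis by metis
        qed
        then have "(\<integral>\<^sup>+w. f (TB (insert b B) w) \<partial>lborel) = (\<integral>\<^sup>+w. f (?S (?R (TB B w))) \<partial>lborel)" by simp
        also have "\<dots> = (\<integral>\<^sup>+w. f (?S (?R w)) \<partial>lborel)"
          using insert.IH B by (subst bspec[OF mp[OF insert.IH B], of "\<lambda>w. f (?S (?R w))"]) measurable
        also have "\<dots> = (\<integral>\<^sup>+w. f (?S w) \<partial>lborel)"
          by (rule nn_integral_reflect[where f="\<lambda>w. f (?S w)"]) (use b e in \<open>measurable\<close>)
        also have "\<dots> = (\<integral>\<^sup>+w. f w \<partial>lborel)"
          by (rule nn_integral_shear) (use b q[OF b b] in auto)
        finally show "(\<integral>\<^sup>+w. f (TB (insert b B) w) \<partial>lborel) = (\<integral>\<^sup>+w. f w \<partial>lborel)" .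
      qed
    qed
  qed
  have "TB Basis w = T w" for w
    unfolding TB_def inner_diff_left[symmetric] euclidean_representation by simp
  then have eq: "(\<integral>\<^sup>+w. f (T w) \<partial>lborel) = (\<integral>\<^sup>+w. f w \<partial>lborel)"
    if "f \<in> borel_measurable borel" for f :: "'a \<Rightarrow> ennreal"
    using main[of Basis] that by simp
  show ?thesis
  proof (rule measure_eqI)
    fix A assume "A \<in> sets (distr lborel borel T)"
    then have [measurable]: "A \<in> sets borel" by simp
    have "emeasure (distr lborel borel T) A = (\<integral>\<^sup>+w. indicator A w \<partial>distr lborel borel T)" by simp
    also have "\<dots> = (\<integral>\<^sup>+w. indicator A (T w) \<partial>lborel)" by (rule nn_integral_distr) measurable
    also have "\<dots> = emeasure lborel A" by (subst eq) auto
    finally show "emeasure (distr lborel borel T) A = emeasure lborel A" .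
  qed simp
qed

text \<open>Common form of \<open>dil\<close> and \<open>Dil\<close> on any Euclidean space, with
  the weights packed into one vector. The same facts then serve the base, the group, space-time and
  the domain of the convolution kernel.\<close>

definition dl :: "'a::euclidean_space \<Rightarrow> real \<Rightarrow> 'a \<Rightarrow> 'a" where
  "dl \<omega> r x = (\<Sum>b\<in>Basis. (r powr (\<omega> \<bullet> b) * (x \<bullet> b)) *\<^sub>R b)"

text \<open>The homogeneous dimension: Lebesgue measure scales under \<open>dl \<omega> r\<close> by
  \<open>r powr hdim \<omega>\<close>.\<close>

definition hdim :: "'a::euclidean_space \<Rightarrow> real" where
  "hdim \<omega> = (\<Sum>b\<in>Basis. \<omega> \<bullet> b)"

lemma dl_inner: "b \<in> Basis \<Longrightarrow> dl \<omega> r x \<bullet> b = r powr (\<omega> \<bullet> b) * (x \<bullet> b)"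
  by (simp add: dl_def)

lemma dl_Basis: "b \<in> Basis \<Longrightarrow> dl \<omega> r b = (r powr (\<omega> \<bullet> b)) *\<^sub>R b"
  by (rule euclidean_eqI) (auto simp: dl_inner inner_Basis)

lemma bounded_linear_dl: "bounded_linear (dl \<omega> r)"
  unfolding dl_def[abs_def]
  by (intro bounded_linear_sum bounded_linear_compose[OF bounded_linear_scaleR_left]
      bounded_linear_compose[OF bounded_linear_mult_right] bounded_linear_inner_left)

lemma dl_measurable [measurable]: "dl \<omega> r \<in> borel_measurable borel"
  unfolding dl_def[abs_def] by measurable

lemma dl_zero [simp]: "dl \<omega> r 0 = 0"
  by (simp add: dl_def)

lemma dl_one [simp]: "dl \<omega> 1 x = x"
  by (simp add: dl_def euclidean_representation)

lemma dl_dl: "0 \<le> r \<Longrightarrow> 0 \<le> s \<Longrightarrow> dl \<omega> r (dl \<omega> s x) = dl \<omega> (r * s) x"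
  by (rule euclidean_eqI) (simp add: dl_inner powr_mult)

lemma dl_inverse: "0 < r \<Longrightarrow> dl \<omega> r (dl \<omega> (1 / r) x) = x" "0 < r \<Longrightarrow> dl \<omega> (1 / r) (dl \<omega> r x) = x"
  by (simp_all add: dl_dl)

lemma dl_eq_0_iff: "0 < r \<Longrightarrow> dl \<omega> r x = 0 \<longleftrightarrow> x = 0"
  by (metis dl_inverse(2) dl_zero)

lemma dl_0: "dl \<omega> 0 x = 0"
  by (simp add: dl_def)

lemma dl_Pair: "dl (\<omega>, \<omega>') r (x, y) = (dl \<omega> r x, dl \<omega>' r y)"
  by (rule euclidean_eqI) (auto simp: dl_inner Basis_prod_def)

lemma norm_dl_le:
  assumes "0 \<le> r" "r \<le> 1" "\<And>b. b \<in> Basis \<Longrightarrow> 1 \<le> \<omega> \<bullet> b"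
  shows "norm (dl \<omega> r x) \<le> r * norm x"
proof -
  have "norm (dl \<omega> r x) \<le> norm (r *\<^sub>R x)"
  proof (rule norm_le_componentwise)
    fix b :: 'a assume b: "b \<in> Basis"
    have "r powr (\<omega> \<bullet> b) \<le> r powr 1"
      by (rule powr_mono') (use assms b in auto)
    then have "r powr (\<omega> \<bullet> b) \<le> r" using assms(1) by (cases "r = 0") auto
    then show "\<bar>dl \<omega> r x \<bullet> b\<bar> \<le> \<bar>r *\<^sub>R x \<bullet> b\<bar>"
      using assms b by (simp add: dl_inner abs_mult mult_right_mono)
  qed
  then show ?thesis using assms by simp
qed

lemma dl_tendsto_0:
  assumes "\<And>b. b \<in> Basis \<Longrightarrow> 0 < \<omega> \<bullet> b"
  shows "((\<lambda>r. dl \<omega> r x) \<longlongrightarrow> 0) (at_right 0)"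
proof -
  have "((\<lambda>r. dl \<omega> r x) \<longlongrightarrow> (\<Sum>b\<in>Basis. (0 * (x \<bullet> b)) *\<^sub>R b)) (at_right 0)"
    unfolding dl_def
  proof (intro tendsto_sum tendsto_scaleR tendsto_mult tendsto_const)
    fix b :: 'a assume "b \<in> Basis"
    then have "0 < \<omega> \<bullet> b" by (rule assms)
    then show "((\<lambda>r. r powr (\<omega> \<bullet> b)) \<longlongrightarrow> 0) (at_right 0)"
      using tendsto_powr'[of "\<lambda>r. r" 0 "at_right 0" "\<lambda>_. \<omega> \<bullet> b" "\<omega> \<bullet> b"]
      by (auto simp: tendsto_ident_at eventually_at_right_less eventually_at_topological)
  qed
  then show ?thesis by simp
qed

lemma lborel_dl:
  assumes "0 < r"
  shows "(lborel :: 'a::euclidean_space measure) = density (distr lborel borel (dl \<omega> r)) (\<lambda>_. ennreal (r powr hdim \<omega>))"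
proof -
  have "(\<Prod>j\<in>Basis. \<bar>r powr (\<omega> \<bullet> j)\<bar>) = r powr hdim \<omega>"
    using assms by (simp add: hdim_def powr_sum)
  then show ?thesis
    using lborel_affine_euclidean[of "\<lambda>j. r powr (\<omega> \<bullet> j)" 0] assms
    by (simp add: dl_def[abs_def])
qed

lemma integrable_dl_iff:
  fixes f :: "'a::euclidean_space \<Rightarrow> real"
  assumes [measurable]: "f \<in> borel_measurable borel" and "0 < r"
  shows "integrable lborel (\<lambda>x. f (dl \<omega> r x)) \<longleftrightarrow> integrable lborel f"
  using assms(2)
  by (subst (2) lborel_dl[OF assms(2)])
    (simp add: integrable_density integrable_distr_eq)

lemma integral_dl:
  fixes f :: "'a::euclidean_space \<Rightarrow> real"
  assumes [measurable]: "f \<in> borel_measurable borel" and "0 < r"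
  shows "(\<integral>x. f x \<partial>lborel) = r powr hdim \<omega> * (\<integral>x. f (dl \<omega> r x) \<partial>lborel)"
  using assms(2)
  by (subst lborel_dl[OF assms(2)]) (simp add: integral_density integral_distr)

text \<open>The derivative in direction \<open>c\<close> is homogeneous of degree
  \<open>d - \<omega> \<bullet> c\<close>, which is not positive, and it is continuous at the
  origin. Contracting \<open>z\<close> to 0 forces it to vanish when this degree is negative and to
  be constant when the degree is 0.\<close>

lemma pd_homogeneous:
  fixes g :: "'a::euclidean_space \<Rightarrow> real"
  assumes g: "Ck 1 UNIV g" and hom: "\<And>r z. 0 < r \<Longrightarrow> g (dl \<omega> r z) = r powr d * g z"
    and \<omega>: "\<And>b. b \<in> Basis \<Longrightarrow> 0 < \<omega> \<bullet> b" and c: "c \<in> Basis" and d: "d \<le> \<omega> \<bullet> c"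
  shows "pd c g z = (if d = \<omega> \<bullet> c then pd c g 0 else 0)"
proof -
  have eq: "pd c g z = r powr (\<omega> \<bullet> c - d) * pd c g (dl \<omega> r z)" if "0 < r" for r
  proof -
    have gd: "g differentiable (at z)" for z using g by simp
    have "((\<lambda>z. g (dl \<omega> r z)) has_derivative (\<lambda>h. frechet_derivative g (at (dl \<omega> r z)) (dl \<omega> r h))) (at z)"
      using diff_chain_at[OF bounded_linear_imp_has_derivative[OF bounded_linear_dl] frechet_derivative_worksI[OF gd]]
      by (simp add: o_def)
    moreover have "(\<lambda>z. g (dl \<omega> r z)) = (\<lambda>z. r powr d * g z)" using hom[OF that] by auto
    moreover have "((\<lambda>z. r powr d * g z) has_derivative (\<lambda>h. r powr d * frechet_derivative g (at z) h)) (at z)"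
      by (intro has_derivative_mult_right frechet_derivative_worksI gd)
    ultimately have "(\<lambda>h. frechet_derivative g (at (dl \<omega> r z)) (dl \<omega> r h)) = (\<lambda>h. r powr d * frechet_derivative g (at z) h)"
      using has_derivative_unique by metis
    from fun_cong[OF this, of c] have "r powr (\<omega> \<bullet> c) * pd c g (dl \<omega> r z) = r powr d * pd c g z"
      using c linear_scale[OF linear_frechet_derivative[OF gd]] by (simp add: dl_Basis pd_def)
    then show ?thesis using that by (simp add: powr_diff field_simps)
  qed
  have "continuous_on UNIV (pd c g)" using g c by simp
  then have "isCont (pd c g) 0" by (simp add: continuous_on_eq_continuous_at)
  then have lim: "((\<lambda>r. pd c g (dl \<omega> r z)) \<longlongrightarrow> pd c g 0) (at_right 0)"
    using isCont_tendsto_compose dl_tendsto_0[OF \<omega>] by blast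
  have pos: "eventually (\<lambda>r::real. 0 < r) (at_right 0)" by (simp add: eventually_at_right_less)
  show ?thesis
  proof (cases "d = \<omega> \<bullet> c")
    case True
    have "eventually (\<lambda>r. pd c g (dl \<omega> r z) = pd c g z) (at_right 0)"
      using pos by eventually_elim (use eq True in simp)
    then have "((\<lambda>r. pd c g (dl \<omega> r z)) \<longlongrightarrow> pd c g z) (at_right 0)"
      by (simp add: tendsto_eventually)
    then show ?thesis using lim True tendsto_unique by (metis trivial_limit_at_right_real)
  next
    case False
    then have "((\<lambda>r. r powr (\<omega> \<bullet> c - d)) \<longlongrightarrow> 0) (at_right 0)"
      using d tendsto_powr'[of "\<lambda>r. r" 0 "at_right 0" "\<lambda>_. \<omega> \<bullet> c - d" "\<omega> \<bullet> c - d"]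
      by (auto simp: tendsto_ident_at eventually_at_right_less eventually_at_topological)
    then have "((\<lambda>r. r powr (\<omega> \<bullet> c - d) * pd c g (dl \<omega> r z)) \<longlongrightarrow> 0) (at_right 0)"
      using tendsto_mult[OF _ lim] by fastforce
    moreover have "((\<lambda>r. r powr (\<omega> \<bullet> c - d) * pd c g (dl \<omega> r z)) \<longlongrightarrow> pd c g z) (at_right 0)"
      by (rule tendsto_eventually) (use pos in \<open>eventually_elim, simp add: eq[symmetric]\<close>)
    ultimately show ?thesis using False tendsto_unique by (metis trivial_limit_at_right_real)
  qed
qed

text \<open>Components of a homogeneous map can only depend nonlinearly on coordinates of strictly lower
  weight, so such a map is triangular and no Jacobian determinant is needed.\<close>

lemma homogeneous_lborel:
  fixes F :: "'p::euclidean_space \<times> 'a::euclidean_space \<Rightarrow> 'a"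
  assumes F: "Ck 1 UNIV F"
    and hom: "\<And>r p w. 0 < r \<Longrightarrow> F (dl \<omega>p r p, dl \<omega> r w) = dl \<omega> r (F (p, w))"
    and \<omega>p: "\<And>b. b \<in> Basis \<Longrightarrow> 0 < \<omega>p \<bullet> b" and \<omega>: "\<And>b. b \<in> Basis \<Longrightarrow> 0 < \<omega> \<bullet> b"
    and e: "\<And>b. b \<in> Basis \<Longrightarrow> \<bar>e b\<bar> = 1"
    and F0: "\<And>w. F (0, w) = G w" and G: "(G has_derivative G') (at 0)"
    and G': "\<And>c. c \<in> Basis \<Longrightarrow> G' c = e c *\<^sub>R c"
  shows "distr lborel borel (\<lambda>w. F (p, w)) = lborel"
proof (rule triangular_lborel[where wt="\<lambda>b. \<omega> \<bullet> b" and e=e])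
  have "continuous_on UNIV F" using Ck_continuous[OF F] .
  then have "continuous_on UNIV (\<lambda>w. F (p, w))"
    by (rule continuous_on_compose2) (auto intro: continuous_on_Pair continuous_on_const continuous_on_id)
  then show "(\<lambda>w. F (p, w)) \<in> borel_measurable borel"
    by (rule borel_measurable_continuous_onI)
  fix b c w and s :: real assume b: "b \<in> Basis" and c: "c \<in> Basis" and bc: "\<omega> \<bullet> b \<le> \<omega> \<bullet> c"
  have Fd: "(F has_derivative frechet_derivative F (at z)) (at z)" for z
    by (intro frechet_derivative_worksI Ck_differentiable[OF F]) auto
  have slice: "((\<lambda>w. F (p, w)) has_derivative (\<lambda>h. frechet_derivative F (at (p, w)) (0, h))) (at w)" for p w
    by (rule has_derivative_compose[where f="\<lambda>w. (p, w)" and g=F, OF _ Fd]) (auto intro!: derivative_eq_intros)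
  have "(\<lambda>h. frechet_derivative F (at (0, 0)) (0, h)) = G'"
    using slice[of 0 0] G has_derivative_unique unfolding F0 by blast
  from fun_cong[OF this, of c] have F'0: "frechet_derivative F (at 0) (0, c) = e c *\<^sub>R c"
    using G'[OF c] by (simp add: zero_prod_def[symmetric])
  have c': "(0, c) \<in> Basis" using c by (simp add: Basis_prod_def)
  \<comment> \<open>For fixed \<open>p\<close> the map is not homogeneous in \<open>w\<close>.
    Giving \<open>p\<close> weights of its own makes \<open>g\<close> jointly homogeneous, of degree
    \<open>\<omega> \<bullet> b\<close>, which is at most the weight of \<open>c\<close>.\<close>
  define g where "g z = F z \<bullet> b" for z
  have gd: "(g has_derivative (\<lambda>h. frechet_derivative F (at z) h \<bullet> b)) (at z)" for z
    unfolding g_def by (intro has_derivative_inner_left Fd)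
  have "pd (0, c) g z = (if \<omega> \<bullet> b = (\<omega>p, \<omega>) \<bullet> (0, c) then pd (0, c) g 0 else 0)" for z
  proof (rule pd_homogeneous)
    show "Ck 1 UNIV g" unfolding g_def by (intro Ck_inner F) auto
    show "g (dl (\<omega>p, \<omega>) r z) = r powr (\<omega> \<bullet> b) * g z" if "0 < r" for r z
      using that b hom by (cases z) (simp add: g_def dl_Pair dl_inner)
    show "0 < (\<omega>p, \<omega>) \<bullet> b'" if "b' \<in> Basis" for b' :: "'p \<times> 'a"
      using that \<omega>p \<omega> by (auto simp: Basis_prod_def)
  qed (use c' bc in auto)
  \<comment> \<open>If the weights agree, the constant value is read off at the origin, where the
    derivative of \<open>G\<close> is diagonal; if \<open>c\<close> has the larger weight then
    \<open>c\<close> differs from \<open>b\<close> and both sides are 0.\<close>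
  then have pd: "pd (0, c) g z = (if c = b then e b else 0)" for z
    using has_derivative_pd[OF gd, of "(0, c)" 0] F'0 b c \<omega> by (auto simp: inner_Basis)
  have "((\<lambda>s. F (p, w + s *\<^sub>R c) \<bullet> b - s * (if c = b then e b else 0)) has_real_derivative 0) (at s)" for s
  proof -
    have "((\<lambda>s. g (p, w + s *\<^sub>R c)) has_derivative (\<lambda>h. frechet_derivative F (at (p, w + s *\<^sub>R c)) (0, h *\<^sub>R c) \<bullet> b)) (at s)"
      by (rule has_derivative_compose[where f="\<lambda>s. (p, w + s *\<^sub>R c)" and g=g, OF _ gd]) (auto intro!: derivative_eq_intros)
    moreover have "frechet_derivative F (at (p, w + s *\<^sub>R c)) (0, h *\<^sub>R c) \<bullet> b = (if c = b then e b else 0) * h" for h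
    proof -
      have "(0, h *\<^sub>R c) = h *\<^sub>R (0::'p, c)" by simp
      then have "frechet_derivative F (at (p, w + s *\<^sub>R c)) (0, h *\<^sub>R c) \<bullet> b = h * pd (0, c) g (p, w + s *\<^sub>R c)"
        using linear_scale[OF has_derivative_linear[OF Fd]] has_derivative_pd[OF gd] by (metis inner_scaleR_left)
      then show ?thesis using pd by simp
    qed
    ultimately have "((\<lambda>s. F (p, w + s *\<^sub>R c) \<bullet> b) has_real_derivative (if c = b then e b else 0)) (at s)"
      by (simp add: has_field_derivative_def g_def)
    from DERIV_diff[OF this DERIV_cmult_right[OF DERIV_ident, of "if c = b then e b else 0"]]
    show ?thesis by simp
  qed
  from DERIV_isconst_all[OF allI[OF this], of s 0]
  show "F (p, w + s *\<^sub>R c) \<bullet> b = F (p, w) \<bullet> b + s * (if c = b then e b else 0)" by simp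
qed (use e in auto)

section \<open>Differentiation under the integral sign\<close>

lemma sum_Basis_inner:
  assumes "b \<in> Basis"
  shows "(\<Sum>c\<in>Basis. (b \<bullet> c) *\<^sub>R f c) = (f b :: 'b::real_vector)"
proof -
  have "(\<Sum>c\<in>Basis. (b \<bullet> c) *\<^sub>R f c) = (\<Sum>c\<in>Basis. if c = b then f c else 0)"
    using assms by (intro sum.cong) (auto simp: inner_Basis)
  then show ?thesis using assms by simp
qed

lemma isCont_integral:
  fixes F :: "'x::euclidean_space \<Rightarrow> 'g \<Rightarrow> real"
  assumes e: "0 < e" and meas: "\<And>y. y \<in> ball x e \<Longrightarrow> F y \<in> borel_measurable M"
    and B: "integrable M B" "\<And>y g. y \<in> ball x e \<Longrightarrow> g \<in> space M \<Longrightarrow> \<bar>F y g\<bar> \<le> B g"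
    and cont: "\<And>g. g \<in> space M \<Longrightarrow> isCont (\<lambda>x. F x g) x"
  shows "isCont (\<lambda>x. \<integral>g. F x g \<partial>M) x"
  unfolding continuous_at_sequentially o_def
proof (intro allI impI)
  fix X :: "nat \<Rightarrow> 'x" assume X: "X \<longlonglongrightarrow> x"
  \<comment> \<open>Some \<open>X n\<close> may lie outside the ball on which \<open>B\<close>
    dominates. Replacing them by \<open>x\<close> makes the bound hold for all \<open>n\<close> and
    changes no limit.\<close>
  define s where "s n g = (if X n \<in> ball x e then F (X n) g else F x g)" for n g
  have ev: "eventually (\<lambda>n. X n \<in> ball x e) sequentially"
    by (rule topological_tendstoD[OF X]) (use e in auto)
  have "(\<lambda>n. \<integral>g. s n g \<partial>M) \<longlonglongrightarrow> (\<integral>g. F x g \<partial>M)"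
  proof (rule integral_dominated_convergence[where w=B])
    show "F x \<in> borel_measurable M" using meas e by simp
    then show "s n \<in> borel_measurable M" for n
      using meas[of "X n"] by (cases "X n \<in> ball x e") (simp_all add: s_def[abs_def])
    show "AE g in M. (\<lambda>n. s n g) \<longlonglongrightarrow> F x g"
    proof (rule AE_I2)
      fix g assume "g \<in> space M"
      then have "(\<lambda>n. F (X n) g) \<longlonglongrightarrow> F x g"
        using cont X continuous_at_sequentially[of x "\<lambda>x. F x g"] by (auto simp: o_def)
      then show "(\<lambda>n. s n g) \<longlonglongrightarrow> F x g"
        by (rule Lim_transform_eventually) (use ev in \<open>eventually_elim, simp add: s_def\<close>)
    qed
    show "AE g in M. norm (s n g) \<le> B g" for n
      using B e by (intro AE_I2) (auto simp: s_def)
  qed (use B in auto)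
  then show "(\<lambda>n. \<integral>g. F (X n) g \<partial>M) \<longlonglongrightarrow> (\<integral>g. F x g \<partial>M)"
    by (rule Lim_transform_eventually) (use ev in \<open>eventually_elim, simp add: s_def\<close>)
qed

text \<open>A partial derivative is a pointwise limit of difference quotients, so measurability in
  the integration variable, for each fixed parameter, is enough.\<close>

lemma pd_measurable_param:
  fixes F :: "'x::euclidean_space \<Rightarrow> 'g \<Rightarrow> real"
  assumes "open S" "x \<in> S"
    and meas: "\<And>y. y \<in> S \<Longrightarrow> F y \<in> borel_measurable M"
    and diff: "\<And>g. g \<in> space M \<Longrightarrow> (\<lambda>x. F x g) differentiable (at x)"
  shows "(\<lambda>g. pd b (\<lambda>x. F x g) x) \<in> borel_measurable M"
proof -
  obtain e where e: "0 < e" "ball x e \<subseteq> S" using assms(1,2) by (meson open_contains_ball)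
  have lim: "(\<lambda>n. x + (1 / Suc n) *\<^sub>R b) \<longlonglongrightarrow> x + 0 *\<^sub>R b"
    by (intro tendsto_intros LIMSEQ_Suc lim_1_over_n)
  have "eventually (\<lambda>n. x + (1 / Suc n) *\<^sub>R b \<in> ball x e) sequentially"
    by (rule topological_tendstoD[OF lim]) (use e in auto)
  then obtain N where N: "\<And>n. N \<le> n \<Longrightarrow> x + (1 / Suc n) *\<^sub>R b \<in> S"
    using e unfolding eventually_sequentially by blast
  show ?thesis
  proof (rule borel_measurable_LIMSEQ_real)
    fix g assume "g \<in> space M"
    from differentiable_pd[OF diff[OF this]]
    have "((\<lambda>x. F x g) has_derivative frechet_derivative (\<lambda>x. F x g) (at x)) (at x)"
      using diff[OF \<open>g \<in> space M\<close>] by (intro frechet_derivative_worksI)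
    then have "((\<lambda>s. F (x + s *\<^sub>R b) g) has_derivative (\<lambda>h. frechet_derivative (\<lambda>x. F x g) (at x) (h *\<^sub>R b))) (at 0)"
      by (intro has_derivative_compose[where f="\<lambda>s. x + s *\<^sub>R b" and g="\<lambda>x. F x g"]) (auto intro!: derivative_eq_intros)
    moreover have "frechet_derivative (\<lambda>x. F x g) (at x) (h *\<^sub>R b) = pd b (\<lambda>x. F x g) x * h" for h
      using linear_scale[OF linear_frechet_derivative[OF diff[OF \<open>g \<in> space M\<close>]]] by (simp add: pd_def)
    ultimately have "((\<lambda>s. F (x + s *\<^sub>R b) g) has_real_derivative pd b (\<lambda>x. F x g) x) (at 0)"
      by (simp add: has_field_derivative_def)
    then have "((\<lambda>h. (F (x + h *\<^sub>R b) g - F x g) / h) \<longlongrightarrow> pd b (\<lambda>x. F x g) x) (at 0)"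
      by (simp add: DERIV_def)
    moreover have "filterlim (\<lambda>n. 1 / real (Suc (n + N))) (at 0) sequentially"
      using filterlim_compose[OF _ filterlim_add_const_nat_at_top[of N], of "\<lambda>n. 1 / real (Suc n)" "nhds 0"]
        LIMSEQ_Suc[OF lim_1_over_n] by (auto simp: filterlim_at)
    ultimately show "(\<lambda>n. (F (x + (1 / Suc (n + N)) *\<^sub>R b) g - F x g) / (1 / Suc (n + N))) \<longlonglongrightarrow> pd b (\<lambda>x. F x g) x"
      by (rule filterlim_compose)
  next
    fix n
    show "(\<lambda>g. (F (x + (1 / Suc (n + N)) *\<^sub>R b) g - F x g) / (1 / Suc (n + N))) \<in> borel_measurable M"
      using meas[OF N[of "n + N"]] meas[OF assms(2)] by simp
  qed
qed

text \<open>Dominated convergence is applied to the quotient of the Frechet remainder by the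
  increment. The mean value inequality bounds this quotient by \<open>2 * B0\<close>, so the total
  derivative is obtained in one stroke, before anything is known about continuity of the integrated
  partial derivatives.\<close>

lemma has_derivative_integral:
  fixes F :: "'x::euclidean_space \<Rightarrow> 'g \<Rightarrow> real"
  assumes "open S" "x \<in> S"
    and diff: "\<And>y g. y \<in> S \<Longrightarrow> g \<in> space M \<Longrightarrow> (\<lambda>x. F x g) differentiable (at y)"
    and meas: "\<And>y. y \<in> S \<Longrightarrow> F y \<in> borel_measurable M"
    and int: "integrable M (F x)"
    and bound: "\<And>b. b \<in> Basis \<Longrightarrow> \<exists>e>0. \<exists>B. integrable M B \<and>
      (\<forall>y\<in>ball x e. \<forall>g\<in>space M. \<bar>pd b (\<lambda>x. F x g) y\<bar> \<le> B g)"
  shows "((\<lambda>x. \<integral>g. F x g \<partial>M) has_derivative (\<lambda>h. \<Sum>b\<in>Basis. (h \<bullet> b) *\<^sub>R (\<integral>g. pd b (\<lambda>x. F x g) x \<partial>M))) (at x)"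
proof -
  obtain e1 B where e1: "\<And>b. b \<in> Basis \<Longrightarrow> 0 < e1 b" and B: "\<And>b. b \<in> Basis \<Longrightarrow> integrable M (B b)"
    and B_le: "\<And>b y g. b \<in> Basis \<Longrightarrow> y \<in> ball x (e1 b) \<Longrightarrow> g \<in> space M \<Longrightarrow> \<bar>pd b (\<lambda>x. F x g) y\<bar> \<le> B b g"
    using bound by metis
  obtain e0 where e0: "0 < e0" "ball x e0 \<subseteq> S" using assms(1,2) by (meson open_contains_ball)
  define e where "e = Min (insert e0 (e1 ` Basis))"
  have e: "0 < e" "e \<le> e0" "\<And>b. b \<in> Basis \<Longrightarrow> e \<le> e1 b"
    using e0 e1 unfolding e_def by (auto intro!: Min_le simp del: Min_insert) 
  define B0 where "B0 g = (\<Sum>b\<in>Basis. B b g)" for g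
  have B0: "integrable M B0" unfolding B0_def[abs_def] using B by auto
  define L where "L g h = (\<Sum>b\<in>Basis. (h \<bullet> b) *\<^sub>R pd b (\<lambda>x. F x g) x)" for g h
  have L_le: "\<bar>\<Sum>b\<in>Basis. (h \<bullet> b) *\<^sub>R pd b (\<lambda>x. F x g) y\<bar> \<le> B0 g * norm h"
    if "y \<in> ball x e" "g \<in> space M" for y g h
  proof -
    have "\<bar>\<Sum>b\<in>Basis. (h \<bullet> b) *\<^sub>R pd b (\<lambda>x. F x g) y\<bar> \<le> (\<Sum>b\<in>Basis. \<bar>(h \<bullet> b) *\<^sub>R pd b (\<lambda>x. F x g) y\<bar>)"
      by (rule sum_abs)
    also have "\<dots> \<le> (\<Sum>b\<in>Basis. norm h * B b g)"
    proof (rule sum_mono)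
      fix b :: 'x assume b: "b \<in> Basis"
      have "\<bar>pd b (\<lambda>x. F x g) y\<bar> \<le> B b g" using B_le[OF b] that e(3)[OF b] by auto
      then show "\<bar>(h \<bullet> b) *\<^sub>R pd b (\<lambda>x. F x g) y\<bar> \<le> norm h * B b g"
        using Basis_le_norm[OF b, of h] by (auto simp: abs_mult intro!: mult_mono)
    qed
    also have "\<dots> = B0 g * norm h"
      unfolding B0_def sum_distrib_right by (rule sum.cong) auto
    finally show ?thesis .
  qed
  have lip: "\<bar>F y g - F x g\<bar> \<le> B0 g * norm (y - x)" if "y \<in> ball x e" "g \<in> space M" for y g
  proof -
    let ?f' = "\<lambda>y h. \<Sum>b\<in>Basis. (h \<bullet> b) *\<^sub>R pd b (\<lambda>x. F x g) y"
    have 1: "((\<lambda>y. F y g) has_derivative ?f' z) (at z within ball x e)" if z: "z \<in> ball x e" for z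
    proof (rule has_derivative_at_withinI, rule differentiable_pd, rule diff)
      show "z \<in> S" using z e(2) e0(2) by auto
    qed fact
    have 2: "onorm (?f' z) \<le> B0 g" if z: "z \<in> ball x e" for z
      using L_le[OF z \<open>g \<in> space M\<close>] by (intro onorm_le) (simp only: real_norm_def)
    have 3: "x \<in> ball x e" using e(1) by simp
    have "norm (F y g - F x g) \<le> B0 g * norm (y - x)"
      by (rule differentiable_bound[OF convex_ball 1 2 that(1) 3])
    then show ?thesis by simp
  qed
  have pd_m: "(\<lambda>g. pd b (\<lambda>x. F x g) x) \<in> borel_measurable M" for b
    by (rule pd_measurable_param[OF assms(1,2)]) (use meas diff assms(2) in auto)
  have pd_int: "integrable M (\<lambda>g. pd b (\<lambda>x. F x g) x)" if b: "b \<in> Basis" for b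
    by (rule Bochner_Integration.integrable_bound[OF B[OF b] pd_m]) (use B_le[OF b, of x] e1[OF b] in \<open>auto intro!: AE_I2 order_trans[OF _ abs_ge_self]\<close>)
  have L_int: "integrable M (\<lambda>g. L g h)" for h
    unfolding L_def using pd_int by auto
  have L_eq: "(\<integral>g. L g h \<partial>M) = (\<Sum>b\<in>Basis. (h \<bullet> b) *\<^sub>R (\<integral>g. pd b (\<lambda>x. F x g) x \<partial>M))" for h
    unfolding L_def using pd_int by (subst Bochner_Integration.integral_sum) auto
  have F_int: "integrable M (F y)" if y: "y \<in> ball x e" for y
  proof (rule Bochner_Integration.integrable_bound)
    show "integrable M (\<lambda>g. \<bar>F x g\<bar> + B0 g * norm (y - x))" using int B0 by auto
    show "F y \<in> borel_measurable M" using y e e0 by (intro meas) auto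
    show "AE g in M. norm (F y g) \<le> norm (\<bar>F x g\<bar> + B0 g * norm (y - x))"
      using lip[OF y] by (intro AE_I2) (smt (verit) real_norm_def)
  qed
  show ?thesis
    unfolding has_derivative_iff_norm tendsto_at_iff_sequentially
  proof (intro conjI allI impI)
    show "bounded_linear (\<lambda>h. \<Sum>b\<in>Basis. (h \<bullet> b) *\<^sub>R (\<integral>g. pd b (\<lambda>x. F x g) x \<partial>M))"
      by (intro bounded_linear_sum bounded_linear_compose[OF bounded_linear_scaleR_left] bounded_linear_inner_left)
  next
    fix X :: "nat \<Rightarrow> 'x" assume X0: "\<forall>i. X i \<in> UNIV - {x}" and X: "X \<longlonglongrightarrow> x"
    define s where "s n g = (if X n \<in> ball x e then \<bar>F (X n) g - F x g - L g (X n - x)\<bar> / norm (X n - x) else 0)" for n g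
    have ev: "eventually (\<lambda>n. X n \<in> ball x e) sequentially"
      by (rule topological_tendstoD[OF X]) (use e in auto)
    have s_int: "integrable M (s n)" for n
      using F_int[of "X n"] L_int int by (cases "X n \<in> ball x e") (simp_all add: s_def[abs_def])
    have "(\<lambda>n. \<integral>g. s n g \<partial>M) \<longlonglongrightarrow> (\<integral>g. 0 \<partial>M)"
    proof (rule integral_dominated_convergence[where w="\<lambda>g. 2 * B0 g"])
      show "AE g in M. (\<lambda>n. s n g) \<longlonglongrightarrow> 0"
      proof (rule AE_I2)
        fix g assume "g \<in> space M"
        then have "((\<lambda>x. F x g) has_derivative L g) (at x)"
          unfolding L_def[abs_def] using diff assms(2) by (intro differentiable_pd) auto
        then have "((\<lambda>y. norm ((F y g - F x g) - L g (y - x)) / norm (y - x)) \<longlongrightarrow> 0) (at x)"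
          by (simp add: has_derivative_iff_norm)
        then have "(\<lambda>n. norm ((F (X n) g - F x g) - L g (X n - x)) / norm (X n - x)) \<longlonglongrightarrow> 0"
          using X X0 unfolding tendsto_at_iff_sequentially by (auto simp: o_def)
        then show "(\<lambda>n. s n g) \<longlonglongrightarrow> 0"
          by (rule Lim_transform_eventually) (use ev in \<open>eventually_elim, simp add: s_def\<close>)
      qed
      show "AE g in M. norm (s n g) \<le> 2 * B0 g" for n
      proof (rule AE_I2)
        fix g assume g: "g \<in> space M"
        have "0 \<le> B0 g" unfolding B0_def
          using B_le g e1 by (intro sum_nonneg) (meson abs_ge_zero centre_in_ball order_trans)
        moreover have "\<bar>F (X n) g - F x g - L g (X n - x)\<bar> \<le> 2 * B0 g * norm (X n - x)" if "X n \<in> ball x e"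
          using lip[OF that g] L_le[of x g "X n - x"] e(1) g unfolding L_def by auto
        ultimately show "norm (s n g) \<le> 2 * B0 g"
          using X0 by (auto simp: s_def divide_le_eq)
      qed
    qed (use B0 s_int in auto)
    then have lim: "(\<lambda>n. \<integral>g. s n g \<partial>M) \<longlonglongrightarrow> 0" by simp
    show "((\<lambda>y. norm ((\<integral>g. F y g \<partial>M) - (\<integral>g. F x g \<partial>M) -
        (\<Sum>b\<in>Basis. ((y - x) \<bullet> b) *\<^sub>R (\<integral>g. pd b (\<lambda>x. F x g) x \<partial>M))) / norm (y - x)) \<circ> X) \<longlonglongrightarrow> 0"
      unfolding o_def
    proof (rule Lim_null_comparison[OF _ lim])
      show "\<forall>\<^sub>F n in sequentially. norm (norm ((\<integral>g. F (X n) g \<partial>M) - (\<integral>g. F x g \<partial>M) -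
        (\<Sum>b\<in>Basis. ((X n - x) \<bullet> b) *\<^sub>R (\<integral>g. pd b (\<lambda>x. F x g) x \<partial>M))) / norm (X n - x)) \<le> (\<integral>g. s n g \<partial>M)"
        using ev
      proof eventually_elim
        case (elim n)
        have "(\<integral>g. F (X n) g \<partial>M) - (\<integral>g. F x g \<partial>M) -
          (\<Sum>b\<in>Basis. ((X n - x) \<bullet> b) *\<^sub>R (\<integral>g. pd b (\<lambda>x. F x g) x \<partial>M)) =
          (\<integral>g. F (X n) g - F x g - L g (X n - x) \<partial>M)"
          unfolding L_eq[symmetric] using F_int[OF elim] int L_int by simp
        moreover have "\<bar>\<integral>g. F (X n) g - F x g - L g (X n - x) \<partial>M\<bar> \<le> (\<integral>g. \<bar>F (X n) g - F x g - L g (X n - x)\<bar> \<partial>M)"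
          by (rule integral_abs_bound)
        moreover have "(\<integral>g. s n g \<partial>M) = (\<integral>g. \<bar>F (X n) g - F x g - L g (X n - x)\<bar> \<partial>M) / norm (X n - x)"
          using elim by (simp add: s_def[abs_def])
        ultimately show ?case by (simp add: divide_right_mono)
      qed
    qed
  qed
qed

text \<open>Regularity and the formula for the derivatives are proved in one induction, since the
  step applies the induction hypothesis to \<open>pd b\<close> of the integrand and needs both parts
  there. The dominating function may depend on the point and on the list of directions.\<close>

lemma Ck_integral:
  fixes F :: "'x::euclidean_space \<Rightarrow> 'g \<Rightarrow> real"
  assumes S: "open S"
    and F: "\<And>g. g \<in> space M \<Longrightarrow> Ck k S (\<lambda>x. F x g)"
    and meas: "\<And>y. y \<in> S \<Longrightarrow> F y \<in> borel_measurable M"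
    and bound: "\<And>bs x. set bs \<subseteq> Basis \<Longrightarrow> length bs \<le> k \<Longrightarrow> x \<in> S \<Longrightarrow> \<exists>e>0. \<exists>B. integrable M B \<and>
      (\<forall>y\<in>ball x e. \<forall>g\<in>space M. \<bar>dpart bs (\<lambda>x. F x g) y\<bar> \<le> B g)"
  shows "Ck k S (\<lambda>x. \<integral>g. F x g \<partial>M) \<and> (\<forall>bs x. set bs \<subseteq> Basis \<longrightarrow> length bs \<le> k \<longrightarrow> x \<in> S \<longrightarrow>
    integrable M (\<lambda>g. dpart bs (\<lambda>x. F x g) x) \<and>
    dpart bs (\<lambda>x. \<integral>g. F x g \<partial>M) x = (\<integral>g. dpart bs (\<lambda>x. F x g) x \<partial>M))"
  using F meas bound
proof (induction k arbitrary: F)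
  case (0 F)
  have int: "integrable M (F x)" if x: "x \<in> S" for x
  proof -
    obtain e B where "0 < e" "integrable M B" "\<forall>y\<in>ball x e. \<forall>g\<in>space M. \<bar>F y g\<bar> \<le> B g"
      using "0.prems"(3)[of "[]" x] x by auto
    then have "norm (F x g) \<le> norm (B g)" if "g \<in> space M" for g
      using that by (smt (verit) centre_in_ball real_norm_def)
    then show ?thesis using \<open>integrable M B\<close>
      by (intro Bochner_Integration.integrable_bound[of M B "F x"] "0.prems"(2) x AE_I2)
  qed
  have "isCont (\<lambda>x. \<integral>g. F x g \<partial>M) x" if x: "x \<in> S" for x
  proof -
    obtain e B where B: "0 < e" "integrable M B" "\<forall>y\<in>ball x e. \<forall>g\<in>space M. \<bar>F y g\<bar> \<le> B g"
      using "0.prems"(3)[of "[]" x] x by auto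
    obtain e' where e': "0 < e'" "ball x e' \<subseteq> S" using S x by (meson open_contains_ball)
    show ?thesis
    proof (rule isCont_integral[where e="min e e'" and B=B])
      show "isCont (\<lambda>x. F x g) x" if "g \<in> space M" for g
        using "0.prems"(1)[OF that] x S by (simp add: continuous_on_eq_continuous_at)
    qed (use B e' "0.prems"(2) in auto)
  qed
  then show ?case using int by (auto intro!: continuous_at_imp_continuous_on)
next
  case (Suc k F)
  have diff: "(\<lambda>x. F x g) differentiable (at y)" if "y \<in> S" "g \<in> space M" for y g
    using Suc.prems(1)[OF that(2)] that(1) by simp
  have int: "integrable M (F x)" if x: "x \<in> S" for x
  proof -
    obtain e B where "0 < e" "integrable M B" "\<forall>y\<in>ball x e. \<forall>g\<in>space M. \<bar>F y g\<bar> \<le> B g"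
      using Suc.prems(3)[of "[]" x] x by auto
    then have "norm (F x g) \<le> norm (B g)" if "g \<in> space M" for g
      using that by (smt (verit) centre_in_ball real_norm_def)
    then show ?thesis using \<open>integrable M B\<close>
      by (intro Bochner_Integration.integrable_bound[of M B "F x"] Suc.prems(2) x AE_I2)
  qed
  have D: "((\<lambda>x. \<integral>g. F x g \<partial>M) has_derivative (\<lambda>h. \<Sum>b\<in>Basis. (h \<bullet> b) *\<^sub>R (\<integral>g. pd b (\<lambda>x. F x g) x \<partial>M))) (at x)"
    if x: "x \<in> S" for x
  proof (rule has_derivative_integral[OF S x diff Suc.prems(2) int[OF x]])
    fix b :: 'x assume "b \<in> Basis"
    then show "\<exists>e>0. \<exists>B. integrable M B \<and> (\<forall>y\<in>ball x e. \<forall>g\<in>space M. \<bar>pd b (\<lambda>x. F x g) y\<bar> \<le> B g)"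
      using Suc.prems(3)[of "[b]" x] x by simp
  qed auto
  have pd: "pd b (\<lambda>x. \<integral>g. F x g \<partial>M) x = (\<integral>g. pd b (\<lambda>x. F x g) x \<partial>M)"
    if "x \<in> S" "b \<in> Basis" for x b
    using has_derivative_pd[OF D[OF that(1)], of b] unfolding sum_Basis_inner[OF that(2)] .
  have IH: "Ck k S (\<lambda>x. \<integral>g. pd b (\<lambda>x. F x g) x \<partial>M) \<and> (\<forall>bs x. set bs \<subseteq> Basis \<longrightarrow> length bs \<le> k \<longrightarrow> x \<in> S \<longrightarrow>
    integrable M (\<lambda>g. dpart bs (\<lambda>x. pd b (\<lambda>x. F x g) x) x) \<and>
    dpart bs (\<lambda>x. \<integral>g. pd b (\<lambda>x. F x g) x \<partial>M) x = (\<integral>g. dpart bs (\<lambda>x. pd b (\<lambda>x. F x g) x) x \<partial>M))"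
    if b: "b \<in> Basis" for b
  proof (rule Suc.IH)
    show "Ck k S (\<lambda>x. pd b (\<lambda>x. F x g) x)" if "g \<in> space M" for g
      using Suc.prems(1)[OF that] b by simp
    show "(\<lambda>g. pd b (\<lambda>x. F x g) y) \<in> borel_measurable M" if "y \<in> S" for y
      by (rule pd_measurable_param[OF S that Suc.prems(2)]) (use diff that in auto)
    show "\<exists>e>0. \<exists>B. integrable M B \<and> (\<forall>y\<in>ball x e. \<forall>g\<in>space M. \<bar>dpart bs (\<lambda>x. pd b (\<lambda>x. F x g) x) y\<bar> \<le> B g)"
      if "set bs \<subseteq> Basis" "length bs \<le> k" "x \<in> S" for bs x
      using Suc.prems(3)[of "bs @ [b]" x] that b by (simp add: dpart_append)
  qed
  have "Ck k S (pd b (\<lambda>x. \<integral>g. F x g \<partial>M))" if b: "b \<in> Basis" for b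
  proof -
    have "Ck k S (pd b (\<lambda>x. \<integral>g. F x g \<partial>M)) = Ck k S (\<lambda>x. \<integral>g. pd b (\<lambda>x. F x g) x \<partial>M)"
      by (rule Ck_cong[OF S]) (rule pd[OF _ b])
    then show ?thesis using IH[OF b] by blast
  qed
  then have "Ck (Suc k) S (\<lambda>x. \<integral>g. F x g \<partial>M)" using D differentiableI by fastforce
  moreover have "integrable M (\<lambda>g. dpart bs (\<lambda>x. F x g) x) \<and>
    dpart bs (\<lambda>x. \<integral>g. F x g \<partial>M) x = (\<integral>g. dpart bs (\<lambda>x. F x g) x \<partial>M)"
    if bs: "set bs \<subseteq> Basis" "length bs \<le> Suc k" "x \<in> S" for bs x
  proof (cases bs rule: rev_cases)
    case Nil
    then show ?thesis using int bs by simp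
  next
    case (snoc as b)
    then have b: "b \<in> Basis" "set as \<subseteq> Basis" "length as \<le> k" using bs by auto
    have "dpart as (pd b (\<lambda>x. \<integral>g. F x g \<partial>M)) x = dpart as (\<lambda>x. \<integral>g. pd b (\<lambda>x. F x g) x \<partial>M) x"
      by (rule dpart_cong_open[OF S bs(3) pd[OF _ b(1)]])
    then show ?thesis using IH[OF b(1)] b bs(3) snoc by (simp add: dpart_append)
  qed
  ultimately show ?case by blast
qed

section \<open>Integration by parts and testing against bump functions\<close>

lemma pd_eq_0_outside:
  assumes "compact K" "\<And>x. x \<notin> K \<Longrightarrow> f x = 0" "x \<notin> K"
  shows "pd b f x = 0"
proof -
  have "pd b f x = pd b (\<lambda>x. 0) x"
    by (rule pd_cong_open[of "- K"]) (use assms compact_imp_closed in auto)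
  then show ?thesis by (simp add: has_derivative_pd[OF has_derivative_const])
qed

lemma bounded_of_compact_support:
  fixes f :: "'a::topological_space \<Rightarrow> real"
  assumes "compact K" "\<And>x. x \<notin> K \<Longrightarrow> f x = 0" "continuous_on K f"
  obtains C where "0 \<le> C" "\<And>x. \<bar>f x\<bar> \<le> C"
proof -
  have "bounded (f ` K)" using assms compact_continuous_image compact_imp_bounded by blast
  then obtain C where "\<And>x. x \<in> K \<Longrightarrow> \<bar>f x\<bar> \<le> C" by (auto simp: bounded_iff)
  then have "\<bar>f x\<bar> \<le> \<bar>C\<bar>" for x using assms(2)[of x] by (cases "x \<in> K") force+
  then show ?thesis using that[of "\<bar>C\<bar>"] by simp
qed

lemma integrable_indicator_compact:
  "compact K \<Longrightarrow> integrable lborel (\<lambda>x::'a::euclidean_space. C * indicator K x :: real)"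
  by (intro integrable_mult_right integrable_real_indicator emeasure_compact_finite)
    (auto simp: borel_compact)

text \<open>Translating \<open>f\<close> along \<open>b\<close> leaves its integral unchanged.
  Differentiating this constant under the integral sign gives the integral of
  \<open>pd b f\<close>.\<close>

lemma integral_pd_eq_0:
  fixes f :: "'a::euclidean_space \<Rightarrow> real"
  assumes f: "Ck 1 UNIV f" and K: "compact K" "\<And>x. x \<notin> K \<Longrightarrow> f x = 0" and b: "b \<in> Basis"
  shows "integrable lborel (pd b f)" "(\<integral>x. pd b f x \<partial>lborel) = 0"
proof -
  let ?F = "\<lambda>(s::real) x. f (x + s *\<^sub>R b)"
  have f_m [measurable]: "f \<in> borel_measurable borel"
    by (rule borel_measurable_continuous_onI) (rule Ck_continuous[OF f])
  have fd: "f differentiable (at x)" for x using Ck_differentiable[OF f] by auto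
  have dF: "((\<lambda>s. ?F s x) has_derivative (\<lambda>h. h * pd b f (x + s *\<^sub>R b))) (at s)" for s x
  proof -
    have "((\<lambda>s. ?F s x) has_derivative (\<lambda>h. frechet_derivative f (at (x + s *\<^sub>R b)) (h *\<^sub>R b))) (at s)"
      by (rule has_derivative_compose[where f="\<lambda>s. x + s *\<^sub>R b" and g=f, OF _ frechet_derivative_worksI[OF fd]])
        (auto intro!: derivative_eq_intros)
    then show ?thesis
      by (simp add: linear_scale[OF linear_frechet_derivative[OF fd]] pd_def)
  qed
  have pdF: "pd 1 (\<lambda>s. ?F s x) s = pd b f (x + s *\<^sub>R b)" for s x
    using has_derivative_pd[OF dF, of 1] by simp
  have pdb: "Ck 0 UNIV (pd b f)" using f b by simp
  have "continuous_on K f" by (rule continuous_on_subset[OF Ck_continuous[OF f]]) simp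
  from bounded_of_compact_support[OF K this]
  obtain C1 where C1: "0 \<le> C1" "\<And>x. \<bar>f x\<bar> \<le> C1" by blast
  have "continuous_on K (pd b f)" by (rule continuous_on_subset[OF Ck_continuous[OF pdb]]) simp
  from bounded_of_compact_support[OF K(1) pd_eq_0_outside[OF K] this]
  obtain C2 where C2: "0 \<le> C2" "\<And>x. \<bar>pd b f x\<bar> \<le> C2" by blast
  \<comment> \<open>All points that some translation by \<open>s *\<^sub>R b\<close> with
    \<open>s\<close> between -1 and 1 moves into \<open>K\<close>; outside this compact set the
    whole family vanishes.\<close>
  define K' where "K' = (\<lambda>(x, s). x - s *\<^sub>R b) ` (K \<times> {-1..1})"
  have K': "compact K'" unfolding K'_def
    by (intro compact_continuous_image compact_Times K) (auto simp: case_prod_unfold intro!: continuous_intros)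
  have mem: "x \<in> K'" if "x + s *\<^sub>R b \<in> K" "s \<in> ball 0 1" for x s
    unfolding K'_def using that by (intro image_eqI[where x="(x + s *\<^sub>R b, s)"]) auto
  have *: "Ck 1 (ball 0 1) (\<lambda>s. \<integral>x. ?F s x \<partial>lborel) \<and> (\<forall>bs x. set bs \<subseteq> Basis \<longrightarrow> length bs \<le> 1 \<longrightarrow> x \<in> ball 0 1 \<longrightarrow>
    integrable lborel (\<lambda>g. dpart bs (\<lambda>x. ?F x g) x) \<and>
    dpart bs (\<lambda>x. \<integral>g. ?F x g \<partial>lborel) x = (\<integral>g. dpart bs (\<lambda>x. ?F x g) x \<partial>lborel))"
  proof (rule Ck_integral)
    show "Ck 1 (ball 0 1) (\<lambda>s. ?F s x)" for x
      by (intro Ck_compose_UNIV[OF _ _ f] Ck_add Ck_scaleR Ck_const Ck_ident open_ball)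
    show "?F s \<in> borel_measurable lborel" for s by measurable
    fix bs :: "real list" and s :: real
    assume bs: "set bs \<subseteq> Basis" "length bs \<le> 1" and s: "s \<in> ball 0 1"
    have le: "\<bar>dpart bs (\<lambda>s. ?F s x) t\<bar> \<le> (C1 + C2) * indicator K' x" if t: "t \<in> ball 0 1" for t x
    proof (cases "x \<in> K'")
      case True
      then show ?thesis using bs C1 C2 pdF[of x]
        by (cases bs) (auto simp: add_increasing add_increasing2)
    next
      case False
      then have "x + t *\<^sub>R b \<notin> K" using mem[of x t] t by blast
      then show ?thesis using bs False K(2) pd_eq_0_outside[OF K] pdF[of x]
        by (cases bs) auto
    qed
    obtain e where "0 < e" "ball s e \<subseteq> ball 0 1" using s by (meson open_ball open_contains_ball)
    then show "\<exists>e>0. \<exists>B. integrable lborel B \<and> (\<forall>t\<in>ball s e. \<forall>x\<in>space lborel. \<bar>dpart bs (\<lambda>s. ?F s x) t\<bar> \<le> B x)"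
      using le integrable_indicator_compact[OF K', of "C1 + C2"] by blast
  qed auto
  have const: "(\<integral>x. ?F s x \<partial>lborel) = (\<integral>x. f x \<partial>lborel)" for s
    by (subst lborel_distr_plus[of "s *\<^sub>R b", symmetric]) (simp add: integral_distr add.commute)
  have "pd 1 (\<lambda>s. \<integral>x. ?F s x \<partial>lborel) 0 = (\<integral>x. pd 1 (\<lambda>s. ?F s x) 0 \<partial>lborel)"
    "integrable lborel (\<lambda>x. pd 1 (\<lambda>s. ?F s x) 0)"
    using conjunct2[OF *, rule_format, of "[1]" 0] by auto
  then show "integrable lborel (pd b f)" "(\<integral>x. pd b f x \<partial>lborel) = 0"
    unfolding const pdF by (simp_all add: has_derivative_pd[OF has_derivative_const])
qed

lemma Ck_mult_compact_support:
  fixes u :: "'a::euclidean_space \<Rightarrow> real"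
  assumes S: "open S" and u: "Ck k S u" and f: "Ck k UNIV f"
    and K: "compact K" "K \<subseteq> S" "\<And>x. x \<notin> K \<Longrightarrow> f x = 0"
  shows "Ck k UNIV (\<lambda>x. u x * f x)"
proof (rule Ck_local)
  fix x :: 'a
  show "\<exists>T. open T \<and> x \<in> T \<and> Ck k T (\<lambda>x. u x * f x)"
  proof (cases "x \<in> K")
    case True
    then show ?thesis using S u K Ck_subset[OF f, of S] by (intro exI[of _ S] conjI Ck_mult) auto
  next
    case False
    have op: "open (- K)" using K(1) compact_imp_closed by auto
    have "Ck k (- K) (\<lambda>x. u x * f x) = Ck k (- K) (\<lambda>x. 0::real)"
      by (rule Ck_cong[OF op]) (use K(3) in auto)
    then show ?thesis using False op by (intro exI[of _ "- K"]) auto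
  qed
qed

lemma vf_adj_eq_0_outside:
  assumes "compact K" "\<And>x. x \<notin> K \<Longrightarrow> f x = 0" "x \<notin> K"
  shows "vf_adj V f x = 0"
proof -
  have "pd b (\<lambda>y. (V y \<bullet> b) * f y) x = 0" for b
    by (rule pd_eq_0_outside[of K]) (use assms in auto)
  then show ?thesis by (simp add: vf_adj_def)
qed

lemma Ck_vf_adj:
  assumes "open S" "Ck (Suc k) S V" "Ck (Suc k) S f"
  shows "Ck k S (vf_adj V f)"
proof -
  have "Ck (Suc k) S (\<lambda>y. (V y \<bullet> b) * f y)" for b
    using assms by (intro Ck_mult Ck_inner) auto
  then show ?thesis unfolding vf_adj_def[abs_def]
    using assms(1) by (intro Ck_uminus Ck_sum) auto
qed

lemma integrable_compact_support:
  fixes f :: "'a::euclidean_space \<Rightarrow> real"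
  assumes "compact K" "\<And>x. x \<notin> K \<Longrightarrow> f x = 0" "continuous_on K f"
  shows "integrable lborel f"
proof -
  have "(\<lambda>x. indicator K x *\<^sub>R f x) = f" using assms(2) by (auto simp: indicator_def fun_eq_iff)
  then show ?thesis using borel_integrable_compact[OF assms(1,3)] by simp
qed

text \<open>The two integrands differ by the divergence of the field \<open>u f V\<close>, which has
  compact support in \<open>S\<close> and therefore extends by 0 to a differentiable field on the
  whole space.\<close>

lemma integral_vf_adj:
  fixes u :: "'a::euclidean_space \<Rightarrow> real"
  assumes S: "open S" and u: "Ck 1 S u" and V: "Ck 1 UNIV V" and f: "Ck 1 UNIV f"
    and K: "compact K" "K \<subseteq> S" "\<And>x. x \<notin> K \<Longrightarrow> f x = 0"
  shows "(\<integral>x. u x * vf_adj V f x \<partial>lborel) = (\<integral>x. vf V u x * f x \<partial>lborel)"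
proof -
  let ?w = "\<lambda>b x. u x * ((V x \<bullet> b) * f x)"
  have f1: "Ck 1 UNIV (\<lambda>x. (V x \<bullet> b) * f x)" for b
    by (intro Ck_mult Ck_inner V f) auto
  have w: "Ck 1 UNIV (?w b)" for b
    by (rule Ck_mult_compact_support[OF S u f1 K(1,2)]) (use K in auto)
  have w0: "x \<notin> K \<Longrightarrow> ?w b x = 0" for b x using K by auto
  have pdw: "(\<Sum>b\<in>Basis. pd b (?w b) x) = vf V u x * f x - u x * vf_adj V f x" for x
  proof (cases "x \<in> S")
    case True
    have "pd b (?w b) x = pd b u x * ((V x \<bullet> b) * f x) + u x * pd b (\<lambda>x. (V x \<bullet> b) * f x) x" if "b \<in> Basis" for b
    proof -
      have "(u has_derivative frechet_derivative u (at x)) (at x)"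
        "((\<lambda>x. (V x \<bullet> b) * f x) has_derivative frechet_derivative (\<lambda>x. (V x \<bullet> b) * f x) (at x)) (at x)"
        using Ck_differentiable[OF u] Ck_differentiable[OF f1] True by (auto intro!: frechet_derivative_worksI)
      from has_derivative_pd[OF has_derivative_mult[OF this], of b] show ?thesis by (simp add: pd_def)
    qed
    then show ?thesis
      by (simp add: vf_def vf_adj_def sum.distrib sum_distrib_left sum_distrib_right algebra_simps)
  next
    case False
    then have x: "x \<notin> K" using K by auto
    then have "pd b (?w b) x = 0" for b by (intro pd_eq_0_outside[OF K(1) w0]) auto
    then show ?thesis using x K vf_adj_eq_0_outside[OF K(1,3)] by simp
  qed
  have "(\<integral>x. (\<Sum>b\<in>Basis. pd b (?w b) x) \<partial>lborel) = 0"
    using integral_pd_eq_0[OF w K(1) w0] by (subst Bochner_Integration.integral_sum) auto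
  then have "(\<integral>x. vf V u x * f x - u x * vf_adj V f x \<partial>lborel) = 0" unfolding pdw .
  moreover have "integrable lborel (\<lambda>x. vf V u x * f x)"
  proof (rule integrable_compact_support[OF K(1)])
    have "Ck 0 S (\<lambda>x. vf V u x * f x)"
      by (intro Ck_mult Ck_vf S Ck_mono[OF Ck_subset[OF V, of S]] Ck_mono[OF Ck_subset[OF f, of S]])
        (use u in auto)
    then show "continuous_on K (\<lambda>x. vf V u x * f x)" using K(2) continuous_on_subset by (metis Ck.simps(1))
  qed (use K in auto)
  moreover have "integrable lborel (\<lambda>x. u x * vf_adj V f x)"
  proof (rule integrable_compact_support[OF K(1)])
    have "Ck 0 UNIV (vf_adj V f)" using Ck_vf_adj[of UNIV 0 V f] V f by simp
    then have "Ck 0 S (vf_adj V f)" using Ck_subset by blast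
    then have "Ck 0 S (\<lambda>x. u x * vf_adj V f x)"
      by (intro Ck_mult S Ck_mono[OF u]) auto
    then show "continuous_on K (\<lambda>x. u x * vf_adj V f x)" using K(2) continuous_on_subset by (metis Ck.simps(1))
  qed (use K vf_adj_eq_0_outside[OF K(1,3)] in auto)
  ultimately show ?thesis by simp
qed

lemma not_AE_notin_ball:
  fixes x :: "'a::euclidean_space"
  assumes "0 < r"
  shows "\<not> (AE y in lborel. y \<notin> ball x r)"
proof
  assume "AE y in lborel. y \<notin> ball x r"
  moreover have "{y \<in> space lborel. \<not> y \<notin> ball x r} = ball x r" by auto
  ultimately have "emeasure lborel (ball x r) = 0"
    using AE_iff_measurable[of "ball x r" lborel "\<lambda>y. y \<notin> ball x r"] by simp
  moreover have "\<not> negligible (ball x r)"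
    using open_not_negligible[of "ball x r"] assms by auto
  ultimately show False
    by (simp add: negligible_iff_null_sets null_sets_completion_iff null_setsI)
qed

text \<open>By continuity a nonzero value keeps its sign on a small ball, and a bump supported there
  would have a nonzero integral against \<open>f\<close>. The argument for positive values is
  applied to \<open>f\<close> and to \<open>- f\<close>.\<close>

lemma eq_0_of_test_functions:
  fixes f :: "'a::euclidean_space \<Rightarrow> real"
  assumes S: "open S" and f: "continuous_on S f"
    and test: "\<And>\<phi> K. smooth \<phi> \<Longrightarrow> compact K \<Longrightarrow> K \<subseteq> S \<Longrightarrow> (\<And>x. x \<notin> K \<Longrightarrow> \<phi> x = 0) \<Longrightarrow>
      (\<integral>x. f x * \<phi> x \<partial>lborel) = 0"
    and x: "x \<in> S"
  shows "f x = 0"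
proof -
  have nonpos: "\<not> 0 < g x"
    if g: "continuous_on S g"
    and test: "\<And>\<phi> K. smooth \<phi> \<Longrightarrow> compact K \<Longrightarrow> K \<subseteq> S \<Longrightarrow> (\<And>x. x \<notin> K \<Longrightarrow> \<phi> x = 0) \<Longrightarrow>
      (\<integral>x. g x * \<phi> x \<partial>lborel) = 0" for g :: "'a \<Rightarrow> real"
  proof
    assume pos: "0 < g x"
    have "isCont g x" using g S x continuous_on_eq_continuous_at by blast
    then have "eventually (\<lambda>y. 0 < g y) (nhds x)"
      using pos by (simp add: order_tendstoD(1) isCont_def tendsto_at_iff_tendsto_nhds)
    moreover have "eventually (\<lambda>y. y \<in> S) (nhds x)" using S x by (simp add: eventually_nhds_in_open)
    ultimately have "eventually (\<lambda>y. 0 < g y \<and> y \<in> S) (nhds x)" by (rule eventually_conj)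
    then obtain d where d: "0 < d" "\<And>y. dist y x < d \<Longrightarrow> 0 < g y \<and> y \<in> S"
      unfolding eventually_nhds_metric by blast
    define r where "r = d / 2"
    have r: "0 < r" "\<And>y. y \<in> cball x r \<Longrightarrow> 0 < g y \<and> y \<in> S"
      using d by (auto simp: r_def dist_commute)
    let ?h = "\<lambda>y. g y * bump x r y"
    have b0: "y \<notin> cball x r \<Longrightarrow> bump x r y = 0" for y using bump_eq_0[OF r(1), of y x] by auto
    then have h0: "y \<notin> cball x r \<Longrightarrow> ?h y = 0" for y by simp
    have zero: "(\<integral>y. ?h y \<partial>lborel) = 0"
      by (rule test[OF smooth_bump, of "cball x r"]) (use r(2) b0 in auto)
    have "continuous_on (cball x r) ?h"
      using r(2) by (intro continuous_intros continuous_on_subset[OF g]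
          continuous_on_subset[OF Ck_continuous[OF Ck_bump]]) auto
    then have int: "integrable lborel ?h" by (intro integrable_compact_support[of "cball x r"] h0) auto
    have nn: "0 \<le> ?h y" for y using r(2)[of y] h0[of y] by (cases "y \<in> cball x r") (auto simp: less_imp_le)
    have "AE y in lborel. ?h y = 0"
      using integral_nonneg_eq_0_iff_AE[OF int] nn zero by simp
    then have "AE y in lborel. y \<notin> ball x r"
    proof (rule AE_mp, intro AE_I2 impI notI)
      fix y assume y: "?h y = 0" "y \<in> ball x r"
      then have "0 < bump x r y" "0 < g y" using bump_pos_iff[OF r(1), of x y] r(2)[of y] by auto
      then show False using y(1) by auto
    qed
    then show False using not_AE_notin_ball[OF r(1)] by blast
  qed
  have "\<not> 0 < f x" by (rule nonpos[OF f test]) auto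
  moreover have "\<not> 0 < - f x"
  proof (rule nonpos)
    show "continuous_on S (\<lambda>x. - f x)" using f by (rule continuous_on_minus)
    show "(\<integral>x. - f x * \<phi> x \<partial>lborel) = 0"
      if "smooth \<phi>" "compact K" "K \<subseteq> S" "\<And>x. x \<notin> K \<Longrightarrow> \<phi> x = 0" for \<phi> K
      using test[OF that] by simp
  qed
  ultimately show ?thesis by simp
qed

declare Ck.simps(2) [simp del]

lemma Ck_pd_less: "Ck l S f \<Longrightarrow> k < l \<Longrightarrow> b \<in> Basis \<Longrightarrow> Ck k S (pd b f)"
  by (rule Ck_pd) (auto intro: Ck_mono)

lemma Ck_vf_less: "open S \<Longrightarrow> Ck l S f \<Longrightarrow> k < l \<Longrightarrow> Ck k S V \<Longrightarrow> Ck k S (vf V f)"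
  by (rule Ck_vf) (auto intro: Ck_mono)

lemma Ck_vf_adj_less: "open S \<Longrightarrow> Ck l S f \<Longrightarrow> k < l \<Longrightarrow> Ck (Suc k) S V \<Longrightarrow> Ck k S (vf_adj V f)"
  by (rule Ck_vf_adj) (auto intro: Ck_mono)

section \<open>Heat operators and maximum principles\<close>

text \<open>The sum of squares is split off because, for homogeneous fields, the heat operator and
  its adjoint share it and differ only in the sign of the time derivative.\<close>

definition subl :: "nat \<Rightarrow> (nat \<Rightarrow> 'a::euclidean_space \<Rightarrow> 'a) \<Rightarrow> (real \<times> 'a \<Rightarrow> real) \<Rightarrow> real \<times> 'a \<Rightarrow> real" where
  "subl m V u z = (\<Sum>j<m. vf (liftx (V j)) (vf (liftx (V j)) u) z)"

lemma heat_op_subl: "heat_op m V u z = subl m V u z - pd (1, 0) u z"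
  by (simp add: heat_op_def subl_def)

lemma vf_cong_open:
  "open S \<Longrightarrow> x \<in> S \<Longrightarrow> (\<And>y. y \<in> S \<Longrightarrow> f y = g y) \<Longrightarrow> vf V f x = vf V g x"
  by (simp add: vf_def pd_cong_open[of S x f g])

lemma Ck_liftx: "Ck k UNIV V \<Longrightarrow> Ck k UNIV (liftx V)"
  unfolding liftx_def[abs_def]
  by (rule Ck_Pair[OF open_UNIV Ck_const], rule Ck_compose_UNIV[of UNIV k snd V])
    (auto intro: Ck_linear bounded_linear_snd)

lemma time_Basis: "(1, 0) \<in> (Basis :: (real \<times> 'a::euclidean_space) set)"
  by (simp add: Basis_prod_def)

lemma Ck_heat_op:
  assumes "open S" "Ck (Suc (Suc k)) S u" "\<And>j. j < m \<Longrightarrow> Ck (Suc k) UNIV (V j)"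
  shows "Ck k S (subl m V u)" "Ck k S (heat_op m V u)"
proof -
  have L: "Ck (Suc k) S (liftx (V j))" if "j < m" for j
    by (rule Ck_subset[OF Ck_liftx[OF assms(3)[OF that]]]) simp
  have "Ck k S (vf (liftx (V j)) (vf (liftx (V j)) u))" if "j < m" for j
    by (rule Ck_vf[OF assms(1) Ck_Suc[OF L[OF that]] Ck_vf[OF assms(1) L[OF that] assms(2)]])
  then show 1: "Ck k S (subl m V u)"
    unfolding subl_def[abs_def] by (intro Ck_sum assms(1)) auto
  have "Ck k S (pd (1, 0) u)" by (rule Ck_pd_less[OF assms(2) _ time_Basis]) simp
  then have "Ck k S (\<lambda>z. subl m V u z - pd (1, 0) u z)"
    by (rule Ck_diff[OF assms(1) 1])
  then show "Ck k S (heat_op m V u)" by (simp add: heat_op_subl[abs_def])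
qed

lemma vf_related:
  fixes h :: "'a::euclidean_space \<Rightarrow> 'b::euclidean_space" and f :: "'b \<Rightarrow> real"
  assumes "h differentiable (at x)" "f differentiable (at (h x))"
    and "frechet_derivative h (at x) (Y x) = c *\<^sub>R W (h x)"
  shows "vf Y (\<lambda>x. f (h x)) x = c * vf W f (h x)"
proof -
  have "((\<lambda>x. f (h x)) has_derivative (\<lambda>v. frechet_derivative f (at (h x)) (frechet_derivative h (at x) v))) (at x)"
    using diff_chain_at[OF frechet_derivative_worksI[OF assms(1)] frechet_derivative_worksI[OF assms(2)]]
    by (simp add: o_def)
  from has_derivative_vf[OF this, of Y] show ?thesis
    unfolding vf_eq_frechet[OF assms(2)] assms(3)
    by (simp add: linear_scale[OF linear_frechet_derivative[OF assms(2)]])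
qed

lemma vf_time:
  fixes u :: "real \<times> 'a::euclidean_space \<Rightarrow> 'b::real_normed_vector"
  shows "vf (\<lambda>_. (1, 0)) u z = pd (1, 0) u z"
  unfolding vf_def by (rule sum_Basis_inner[OF time_Basis])

text \<open>Two applications of the chain rule for \<open>h\<close>-related fields produce
  \<open>c\<^sup>2\<close>, matched by the same factor in time. Left translations and the projection
  to the base are the case \<open>c = 1\<close>; dilations have \<open>c = r\<close>.\<close>

lemma heat_related:
  fixes h :: "'a::euclidean_space \<Rightarrow> 'b::euclidean_space" and v :: "real \<times> 'b \<Rightarrow> real"
  assumes T: "open T" and v: "Ck 2 T v" and h: "\<And>x. h differentiable (at x)"
    and rel: "\<And>j x. j < m \<Longrightarrow> frechet_derivative h (at x) (Z j x) = c *\<^sub>R W j (h x)"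
    and W: "\<And>j. j < m \<Longrightarrow> Ck 1 UNIV (W j)"
    and z: "(c\<^sup>2 * t + s, h x) \<in> T"
  shows "subl m Z (\<lambda>(t, x). v (c\<^sup>2 * t + s, h x)) (t, x) = c\<^sup>2 * subl m W v (c\<^sup>2 * t + s, h x)"
    and "pd (1, 0) (\<lambda>(t, x). v (c\<^sup>2 * t + s, h x)) (t, x) = c\<^sup>2 * pd (1, 0) v (c\<^sup>2 * t + s, h x)"
proof -
  let ?H = "\<lambda>y. (c\<^sup>2 * fst y + s, h (snd y))"
  let ?H' = "\<lambda>y k. (c\<^sup>2 * fst k, frechet_derivative h (at (snd y)) (snd k))"
  have H: "(?H has_derivative ?H' y) (at y)" for y
  proof -
    have "((\<lambda>y. h (snd y)) has_derivative (\<lambda>k. frechet_derivative h (at (snd y)) (snd k))) (at y)"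
      by (rule has_derivative_compose[where f=snd and g=h, OF _ frechet_derivative_worksI[OF h]])
        (auto intro!: derivative_eq_intros)
    moreover have "((\<lambda>y. c\<^sup>2 * fst y + s) has_derivative (\<lambda>k. c\<^sup>2 * fst k)) (at y)"
      by (auto intro!: derivative_eq_intros)
    ultimately show ?thesis by (rule has_derivative_Pair[rotated])
  qed
  then have Hd: "?H differentiable (at y)" for y by (rule differentiableI)
  have Hf: "frechet_derivative ?H (at y) = ?H' y" for y
    using frechet_derivative_at[OF H] by metis
  define S where "S = ?H -` T"
  have S: "open S" unfolding S_def
    by (intro open_vimage T continuous_at_imp_continuous_on ballI differentiable_imp_continuous_within Hd)
  have rel': "frechet_derivative ?H (at y) (liftx (Z j) y) = c *\<^sub>R liftx (W j) (?H y)" if "j < m" for j y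
    using rel[OF that] unfolding Hf by (simp add: liftx_def)
  have uncurry: "(\<lambda>(t, x). v (c\<^sup>2 * t + s, h x)) = (\<lambda>y. v (?H y))" by (simp add: case_prod_unfold)
  have vd: "v differentiable (at y)" if "y \<in> T" for y using Ck_differentiable[OF v _ that] by simp
  have zS: "(t, x) \<in> S" using z by (simp add: S_def)
  have one: "vf (liftx (Z j)) (\<lambda>y. v (?H y)) y = c * vf (liftx (W j)) v (?H y)" if "y \<in> S" "j < m" for y j
    by (rule vf_related[where h="?H" and f=v and Y="liftx (Z j)" and W="liftx (W j)", OF Hd vd rel']) (use that in \<open>auto simp: S_def\<close>)
  have two: "vf (liftx (Z j)) (vf (liftx (Z j)) (\<lambda>y. v (?H y))) (t, x) = c\<^sup>2 * vf (liftx (W j)) (vf (liftx (W j)) v) (?H (t, x))"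
    if j: "j < m" for j
  proof -
    let ?g = "\<lambda>y. c * vf (liftx (W j)) v y"
    have "Ck 1 T (vf (liftx (W j)) v)"
      by (rule Ck_vf_less[OF T v _ Ck_subset[OF Ck_liftx[OF W[OF j]]]]) auto
    then have "Ck 1 T ?g" by (intro Ck_cmult T)
    then have gd: "?g differentiable (at y)" if "y \<in> T" for y by (rule Ck_differentiable[OF _ zero_less_one that])
    have fd: "vf (liftx (W j)) v differentiable (at y)" if "y \<in> T" for y
      using Ck_differentiable[OF \<open>Ck 1 T (vf (liftx (W j)) v)\<close> _ that] by auto
    have "vf (liftx (Z j)) (vf (liftx (Z j)) (\<lambda>y. v (?H y))) (t, x) = vf (liftx (Z j)) (\<lambda>y. ?g (?H y)) (t, x)"
      by (rule vf_cong_open[OF S zS]) (use one j in auto)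
    also have "\<dots> = c * vf (liftx (W j)) ?g (?H (t, x))"
      by (rule vf_related[where h="?H" and f="?g" and Y="liftx (Z j)" and W="liftx (W j)", OF Hd gd rel'[OF j]]) (use z in simp)
    also have "vf (liftx (W j)) ?g (?H (t, x)) = c * vf (liftx (W j)) (vf (liftx (W j)) v) (?H (t, x))"
      using has_derivative_vf[OF has_derivative_mult_right[OF frechet_derivative_worksI[OF fd]], of "?H (t, x)" "liftx (W j)" c] z
      by (simp add: vf_eq_frechet[OF fd])
    finally show ?thesis by (simp add: power2_eq_square)
  qed
  then show "subl m Z (\<lambda>(t, x). v (c\<^sup>2 * t + s, h x)) (t, x) = c\<^sup>2 * subl m W v (c\<^sup>2 * t + s, h x)"
    unfolding uncurry subl_def by (simp add: sum_distrib_left)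
  have "vf (\<lambda>_. (1, 0)) (\<lambda>y. v (?H y)) (t, x) = c\<^sup>2 * vf (\<lambda>_. (1, 0)) v (?H (t, x))"
  proof (rule vf_related[where h="?H" and f=v and Y="\<lambda>_. (1, 0)" and W="\<lambda>_. (1, 0)", OF Hd vd])
    show "frechet_derivative ?H (at (t, x)) (1, 0) = c\<^sup>2 *\<^sub>R (1, 0)"
      unfolding Hf by (simp add: linear_0[OF linear_frechet_derivative[OF h]])
  qed (use z in simp)
  then show "pd (1, 0) (\<lambda>(t, x). v (c\<^sup>2 * t + s, h x)) (t, x) = c\<^sup>2 * pd (1, 0) v (c\<^sup>2 * t + s, h x)"
    unfolding uncurry by (simp add: vf_time)
qed

lemma integral_heat_op_adj:
  fixes u :: "real \<times> 'a::euclidean_space \<Rightarrow> real"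
  assumes S: "open S" and u: "Ck 2 S u" and V: "\<And>j. j < m \<Longrightarrow> Ck 2 UNIV (V j)" and f: "Ck 2 UNIV f"
    and K: "compact K" "K \<subseteq> S" "\<And>x. x \<notin> K \<Longrightarrow> f x = 0"
  shows "(\<integral>z. u z * heat_op_adj m V f z \<partial>lborel) = (\<integral>z. heat_op m V u z * f z \<partial>lborel)"
proof -
  let ?L = "\<lambda>j. liftx (V j)"
  have L: "Ck 2 UNIV (?L j)" "Ck 1 UNIV (?L j)" "Ck 1 S (?L j)" if "j < m" for j
    using Ck_liftx[OF V[OF that]] Ck_mono[of 2 _ _ 1] Ck_subset[of 1 UNIV _ S] by auto
  have u1: "Ck 1 S u" and f1: "Ck 1 UNIV f" by (rule Ck_mono[OF u] Ck_mono[OF f]; simp)+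
  have vu: "Ck 1 S (vf (?L j) u)" if "j < m" for j
    by (rule Ck_vf_less[OF S u _ L(3)[OF that]]) simp
  have vvu: "Ck 0 S (vf (?L j) (vf (?L j) u))" if "j < m" for j
    by (rule Ck_vf_less[OF S vu[OF that] _ Ck_mono[OF L(3)[OF that]]]) auto
  have vaf: "Ck 1 UNIV (vf_adj (?L j) f)" if "j < m" for j
    using L(1)[OF that] by (intro Ck_vf_adj_less[OF open_UNIV f]) (auto simp: numeral_2_eq_2)
  have vvaf: "Ck 0 UNIV (vf_adj (?L j) (vf_adj (?L j) f))" if "j < m" for j
    using L(2)[OF that] by (intro Ck_vf_adj_less[OF open_UNIV vaf[OF that]]) auto
  note out = vf_adj_eq_0_outside[OF K(1)]
  have out1: "x \<notin> K \<Longrightarrow> vf_adj W f x = 0" for x and W :: "real \<times> 'a \<Rightarrow> real \<times> 'a" by (rule out) (use K in auto)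
  have out2: "x \<notin> K \<Longrightarrow> vf_adj W (vf_adj W f) x = 0" for x and W :: "real \<times> 'a \<Rightarrow> real \<times> 'a" by (rule out) (use out1 in auto)
  have out3: "x \<notin> K \<Longrightarrow> pd b f x = 0" for x b by (rule pd_eq_0_outside[OF K(1,3)]) auto
  have *: "(\<integral>z. u z * vf_adj (?L j) (vf_adj (?L j) f) z \<partial>lborel) = (\<integral>z. vf (?L j) (vf (?L j) u) z * f z \<partial>lborel)" if "j < m" for j
    using integral_vf_adj[OF S u1 L(2)[OF that] vaf[OF that] K(1,2) out1]
      integral_vf_adj[OF S vu[OF that] L(2)[OF that] f1 K] by simp
  have T: "vf_adj (\<lambda>_. (1, 0)) f z = - pd (1, 0) f z" for z
  proof -
    have fd: "f differentiable (at z)" using Ck_differentiable[OF f1] by auto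
    have "pd b (\<lambda>y. ((1, 0) \<bullet> b) * f y) z = ((1, 0) \<bullet> b) * pd b f z" for b
      using has_derivative_pd[OF has_derivative_mult_right[OF frechet_derivative_worksI[OF fd]]] by (simp add: pd_def)
    then show ?thesis using sum_Basis_inner[OF time_Basis, of "\<lambda>b. pd b f z"] by (simp add: vf_adj_def)
  qed
  have time: "(\<integral>z. u z * pd (1, 0) f z \<partial>lborel) = - (\<integral>z. pd (1, 0) u z * f z \<partial>lborel)"
    using integral_vf_adj[OF S u1 Ck_const f1 K, of "(1, 0)"] unfolding T vf_time by simp
  have int: "integrable lborel (\<lambda>z. g z * k z)" if "Ck 0 S g" "Ck 0 S k" "\<And>x. x \<notin> K \<Longrightarrow> k x = 0" for g k :: "real \<times> 'a \<Rightarrow> real"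
  proof (rule integrable_compact_support[OF K(1)])
    show "continuous_on K (\<lambda>z. g z * k z)"
      using that(1,2) by (intro continuous_on_mult) (auto intro: continuous_on_subset[OF _ K(2)])
  qed (use that in auto)
  have u0: "Ck 0 S u" and f0: "Ck 0 S f"
    using Ck_continuous[OF u1] Ck_continuous[OF Ck_subset[OF f1, of S]] by auto
  have pdu: "Ck 0 S (pd (1, 0) u)" by (rule Ck_pd_less[OF u1 _ time_Basis]) simp
  have "Ck 0 UNIV (pd (1, 0) f)" by (rule Ck_pd_less[OF f1 _ time_Basis]) simp
  then have pdf: "Ck 0 S (pd (1, 0) f)" by (rule Ck_subset) simp
  have "(\<integral>z. u z * heat_op_adj m V f z \<partial>lborel) =
    (\<integral>z. (\<Sum>j<m. u z * vf_adj (?L j) (vf_adj (?L j) f) z) + u z * pd (1, 0) f z \<partial>lborel)"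
    by (simp add: heat_op_adj_def distrib_left sum_distrib_left)
  also have "\<dots> = (\<Sum>j<m. \<integral>z. u z * vf_adj (?L j) (vf_adj (?L j) f) z \<partial>lborel) + (\<integral>z. u z * pd (1, 0) f z \<partial>lborel)"
    using int[OF u0 Ck_subset[OF vvaf] out2] int[OF u0 pdf out3]
    by (subst Bochner_Integration.integral_add) (auto simp: Bochner_Integration.integral_sum)
  also have "\<dots> = (\<Sum>j<m. \<integral>z. vf (?L j) (vf (?L j) u) z * f z \<partial>lborel) - (\<integral>z. pd (1, 0) u z * f z \<partial>lborel)"
    using * time by simp
  also have "\<dots> = (\<integral>z. (\<Sum>j<m. vf (?L j) (vf (?L j) u) z * f z) - pd (1, 0) u z * f z \<partial>lborel)"
    using int[OF vvu f0 K(3)] int[OF pdu f0 K(3)]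
    by (subst Bochner_Integration.integral_diff) (auto simp: Bochner_Integration.integral_sum)
  also have "\<dots> = (\<integral>z. heat_op m V u z * f z \<partial>lborel)"
    by (simp add: heat_op_def left_diff_distrib sum_distrib_right)
  finally show ?thesis .
qed

section \<open>Parabolic maximum principles\<close>

lemma second_derivative_nonneg_at_min:
  fixes h :: "real \<Rightarrow> real"
  assumes d: "0 < d" "\<And>s. \<bar>s\<bar> < d \<Longrightarrow> (h has_real_derivative h' s) (at s)"
    and "(h' has_real_derivative c) (at 0)" and "h' 0 = 0" and min: "\<And>s. \<bar>s\<bar> < d \<Longrightarrow> h 0 \<le> h s"
  shows "0 \<le> c"
proof (rule ccontr)
  assume "\<not> 0 \<le> c"
  then obtain e where e: "0 < e" "\<And>s. 0 < s \<Longrightarrow> s < e \<Longrightarrow> h' s < 0"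
    using DERIV_neg_dec_right[OF assms(3)] assms(4) by auto
  define s where "s = min d e / 2"
  have s: "0 < s" "s < d" "s < e" using d(1) e(1) by (auto simp: s_def)
  obtain x where "0 < x" "x < s" "h s - h 0 = (s - 0) * h' x"
    using MVT2[of 0 s h h'] s d(2) by force
  then have "h s < h 0" using e(2)[of x] s by (smt (verit) mult_pos_neg)
  then show False using min[of s] s by auto
qed

text \<open>The minimum is only over times up to \<open>t\<close>, so the time derivative is at most
  0 there, while the space derivatives vanish. First-order terms of the squared field therefore drop
  out, and what remains is the second derivative of \<open>v\<close> along the straight line in the
  direction of the field at the minimum; the flow of the field is not followed.\<close>

lemma heat_op_nonneg_at_min:
  fixes v :: "real \<times> 'a::euclidean_space \<Rightarrow> real"
  assumes S: "open S" and v: "Ck 2 S v" and V: "\<And>j. j < m \<Longrightarrow> Ck 1 UNIV (V j)"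
    and z: "(t, x) \<in> S" and e: "0 < e"
    and min: "\<And>s y. t - e < s \<Longrightarrow> s \<le> t \<Longrightarrow> dist x y < e \<Longrightarrow> v (t, x) \<le> v (s, y)"
  shows "0 \<le> heat_op m V v (t, x)"
proof -
  let ?z = "(t, x)"
  have vd: "v differentiable (at y)" if "y \<in> S" for y using Ck_differentiable[OF v _ that] by simp
  have pdd: "pd b v differentiable (at y)" if "y \<in> S" "b \<in> Basis" for y b
    using Ck_differentiable[OF Ck_pd_less[OF v, of 1] _ that(1)] that(2) by simp
  obtain r where r: "0 < r" "ball ?z r \<subseteq> S" using S z by (meson open_contains_ball)
  let ?D = "frechet_derivative v (at ?z)"
  have D: "(v has_derivative ?D) (at ?z)" by (rule frechet_derivative_worksI[OF vd[OF z]])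
  have "((\<lambda>y. v (t, y)) has_derivative (\<lambda>k. ?D (0, k))) (at x)"
    by (rule has_derivative_compose[where f="\<lambda>y. (t, y)" and g=v, OF _ D]) (auto intro!: derivative_eq_intros)
  then have "(\<lambda>k. ?D (0, k)) = (\<lambda>k. 0)"
    by (rule differential_zero_maxmin[where S="ball x e", rotated 2]) (use e min in auto)
  then have Dx: "?D (0, k) = 0" for k by (rule fun_cong)
  have "0 \<le> vf (liftx (V j)) (vf (liftx (V j)) v) ?z" if j: "j < m" for j
  proof -
    let ?W = "liftx (V j)"
    define \<nu> where "\<nu> = ?W ?z"
    have \<nu>: "\<nu> = (0, V j x)" by (simp add: \<nu>_def liftx_def)
    have Wd: "?W differentiable (at y)" for y using Ck_differentiable[OF Ck_liftx[OF V[OF j]]] by auto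
    let ?W' = "frechet_derivative ?W (at ?z)"
    have W': "(?W has_derivative ?W') (at ?z)" by (rule frechet_derivative_worksI[OF Wd])
    \<comment> \<open>The derivative of \<open>?W\<close> also has no time component. This matters
      because the time derivative of \<open>v\<close> need not vanish at the minimum.\<close>
    have "((\<lambda>y. fst (?W y)) has_derivative (\<lambda>k. fst (?W' k))) (at ?z)"
      by (intro has_derivative_fst W')
    moreover have "(\<lambda>y. fst (?W y)) = (\<lambda>_. 0)" by (simp add: liftx_def)
    ultimately have "((\<lambda>y::real \<times> 'a. 0::real) has_derivative (\<lambda>k. fst (?W' k))) (at ?z)" by simp
    from fun_cong[OF has_derivative_unique[OF this has_derivative_const]]
    have fstW: "fst (?W' k) = 0" for k .
    let ?g = "\<lambda>y. \<Sum>b\<in>Basis. (?W y \<bullet> b) * pd b v y"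
    have "(?g has_derivative (\<lambda>k. \<Sum>b\<in>Basis. (?W ?z \<bullet> b) * frechet_derivative (pd b v) (at ?z) k + (?W' k \<bullet> b) * pd b v ?z)) (at ?z)"
      by (intro has_derivative_sum has_derivative_mult has_derivative_inner_left W' frechet_derivative_worksI pdd z)
    from has_derivative_vf[OF this, of ?W] have "vf ?W ?g ?z = (\<Sum>b\<in>Basis. (\<nu> \<bullet> b) * frechet_derivative (pd b v) (at ?z) \<nu>) + (\<Sum>b\<in>Basis. (?W' \<nu> \<bullet> b) * pd b v ?z)"
      by (simp only: \<nu>_def sum.distrib)
    moreover have "(\<Sum>b\<in>Basis. (?W' \<nu> \<bullet> b) * pd b v ?z) = ?D (?W' \<nu>)"
      using frechet_derivative_pd[OF vd[OF z]] by simp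
    moreover have "?D (?W' \<nu>) = 0" using Dx[of "snd (?W' \<nu>)"] fstW by (metis prod.collapse)
    moreover have "vf ?W (vf ?W v) ?z = vf ?W ?g ?z"
      by (rule vf_cong_open[OF S z]) (simp add: vf_def)
    ultimately have eq: "vf ?W (vf ?W v) ?z = (\<Sum>b\<in>Basis. (\<nu> \<bullet> b) * frechet_derivative (pd b v) (at ?z) \<nu>)" by simp
    show ?thesis
    proof (rule second_derivative_nonneg_at_min[where h="\<lambda>s. v (?z + s *\<^sub>R \<nu>)"
          and h'="\<lambda>s. \<Sum>b\<in>Basis. (\<nu> \<bullet> b) * pd b v (?z + s *\<^sub>R \<nu>)" and d="min e r / (1 + norm \<nu>)"])
      have small: "norm (s *\<^sub>R \<nu>) < min e r" if "\<bar>s\<bar> < min e r / (1 + norm \<nu>)" for s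
      proof -
        have "\<bar>s\<bar> * (1 + norm \<nu>) < min e r" using that by (simp add: pos_less_divide_eq add_pos_nonneg)
        moreover have "\<bar>s\<bar> * norm \<nu> \<le> \<bar>s\<bar> * (1 + norm \<nu>)" by (intro mult_left_mono) auto
        ultimately show ?thesis by simp
      qed
      have inS: "?z + s *\<^sub>R \<nu> \<in> S" if "\<bar>s\<bar> < min e r / (1 + norm \<nu>)" for s
        using small[OF that] r(2) by (auto simp: dist_norm subset_eq simp del: scaleR_Pair)
      show "0 < min e r / (1 + norm \<nu>)" using e r(1) by (simp add: add_pos_nonneg)
      have line: "((\<lambda>s. ?z + s *\<^sub>R \<nu>) has_derivative (\<lambda>s. s *\<^sub>R \<nu>)) (at s)" for s
        by (auto intro!: derivative_eq_intros)
      show "((\<lambda>s. v (?z + s *\<^sub>R \<nu>)) has_real_derivative (\<Sum>b\<in>Basis. (\<nu> \<bullet> b) * pd b v (?z + s *\<^sub>R \<nu>))) (at s)"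
        if "\<bar>s\<bar> < min e r / (1 + norm \<nu>)" for s
      proof -
        note vs = vd[OF inS[OF that]]
        have "((\<lambda>s. v (?z + s *\<^sub>R \<nu>)) has_derivative (\<lambda>k. frechet_derivative v (at (?z + s *\<^sub>R \<nu>)) (k *\<^sub>R \<nu>))) (at s)"
          by (rule has_derivative_compose[OF line frechet_derivative_worksI[OF vs]])
        moreover have "frechet_derivative v (at (?z + s *\<^sub>R \<nu>)) (k *\<^sub>R \<nu>) =
            (\<Sum>b\<in>Basis. (\<nu> \<bullet> b) * pd b v (?z + s *\<^sub>R \<nu>)) * k" for k
          unfolding frechet_derivative_pd[OF vs] sum_distrib_right by (rule sum.cong) auto
        ultimately show ?thesis by (simp only: has_field_derivative_def)
      qed
      show "((\<lambda>s. \<Sum>b\<in>Basis. (\<nu> \<bullet> b) * pd b v (?z + s *\<^sub>R \<nu>)) has_real_derivative vf ?W (vf ?W v) ?z) (at 0)"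
        unfolding eq
      proof (rule DERIV_sum, rule DERIV_cmult)
        fix b :: "real \<times> 'a" assume b: "b \<in> Basis"
        note pz = pdd[OF z b]
        have "((\<lambda>s. pd b v (?z + s *\<^sub>R \<nu>)) has_derivative (\<lambda>k. frechet_derivative (pd b v) (at ?z) (k *\<^sub>R \<nu>))) (at 0)"
          by (rule has_derivative_compose[where g="pd b v", OF line]) (use frechet_derivative_worksI[OF pz] in simp)
        moreover have "frechet_derivative (pd b v) (at ?z) (k *\<^sub>R \<nu>) = frechet_derivative (pd b v) (at ?z) \<nu> * k" for k
          by (simp add: linear_scale[OF linear_frechet_derivative[OF pz]])
        ultimately show "((\<lambda>s. pd b v (?z + s *\<^sub>R \<nu>)) has_real_derivative frechet_derivative (pd b v) (at ?z) \<nu>) (at 0)"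
          by (simp only: has_field_derivative_def)
      qed
      show "(\<Sum>b\<in>Basis. (\<nu> \<bullet> b) * pd b v (?z + 0 *\<^sub>R \<nu>)) = 0"
        using frechet_derivative_pd[OF vd[OF z], of \<nu>] Dx[of "V j x"] \<nu> by simp
      show "v (?z + 0 *\<^sub>R \<nu>) \<le> v (?z + s *\<^sub>R \<nu>)" if "\<bar>s\<bar> < min e r / (1 + norm \<nu>)" for s
        using min[of t "x + s *\<^sub>R V j x"] small[OF that] e by (simp add: \<nu> dist_norm)
    qed
  qed
  then have 1: "0 \<le> subl m V v ?z" unfolding subl_def by (intro sum_nonneg) auto
  have "((\<lambda>s. v (s, x)) has_derivative (\<lambda>k. ?D (k, 0))) (at t)"
    by (rule has_derivative_compose[where f="\<lambda>s. (s, x)" and g=v, OF _ D]) (auto intro!: derivative_eq_intros)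
  moreover have "?D (k, 0) = pd (1, 0) v ?z * k" for k
    using linear_scale[OF linear_frechet_derivative[OF vd[OF z]], of k "(1, 0)"] by (simp add: pd_def)
  ultimately have dt: "((\<lambda>s. v (s, x)) has_real_derivative pd (1, 0) v ?z) (at t)"
    by (simp add: has_field_derivative_def)
  have 2: "pd (1, 0) v ?z \<le> 0"
  proof (rule ccontr)
    assume "\<not> pd (1, 0) v ?z \<le> 0"
    then obtain d where d: "0 < d" "\<And>h. 0 < h \<Longrightarrow> h < d \<Longrightarrow> v (t - h, x) < v (t, x)"
      using DERIV_pos_inc_left[OF dt] by auto
    have "v (t - Min {d, e} / 2, x) < v (t, x)" by (rule d) (use d e in auto)
    moreover have "v (t, x) \<le> v (t - Min {d, e} / 2, x)" by (rule min) (use d e in auto)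
    ultimately show False by simp
  qed
  show ?thesis using 1 2 by (simp add: heat_op_subl)
qed

lemma heat_op_add_time:
  fixes v :: "real \<times> 'a::euclidean_space \<Rightarrow> real"
  assumes S: "open S" and v: "Ck 2 S v" and z: "z \<in> S"
    and g: "\<And>t. (g has_real_derivative g' t) (at t)"
  shows "heat_op m V (\<lambda>z. v z + g (fst z)) z = heat_op m V v z - g' (fst z)"
proof -
  have vd: "v differentiable (at y)" if "y \<in> S" for y using Ck_differentiable[OF v _ that] by simp
  have D: "((\<lambda>z. v z + g (fst z)) has_derivative (\<lambda>k. frechet_derivative v (at y) k + g' (fst y) * fst k)) (at y)"
    if "y \<in> S" for y
  proof (rule has_derivative_add[OF frechet_derivative_worksI[OF vd[OF that]]])
    show "((\<lambda>z. g (fst z)) has_derivative (\<lambda>k. g' (fst y) * fst k)) (at y)"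
      by (rule has_derivative_compose[where f=fst and g=g]) (use g in \<open>auto simp: has_field_derivative_def intro!: derivative_eq_intros\<close>)
  qed
  have "vf (liftx W) (\<lambda>z. v z + g (fst z)) y = vf (liftx W) v y" if "y \<in> S" for y W
    using has_derivative_vf[OF D[OF that], of "liftx W"] vf_eq_frechet[OF vd[OF that], of "liftx W"]
    by (simp add: liftx_def)
  then have "subl m V (\<lambda>z. v z + g (fst z)) z = subl m V v z"
    unfolding subl_def by (intro sum.cong vf_cong_open[OF S z]) auto
  moreover have "pd (1, 0) (\<lambda>z. v z + g (fst z)) z = pd (1, 0) v z + g' (fst z)"
    using has_derivative_pd[OF D[OF z]] by (simp add: pd_def)
  ultimately show ?thesis by (simp add: heat_op_subl)
qed

text \<open>Adding a small increasing function of time turns \<open>v\<close> into a strict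
  supersolution, which cannot have a minimum over the past. The exponential is chosen because it is
  positive: a linear term would tend to minus infinity in the remote past and could push the minimum
  away to infinity.\<close>

lemma heat_max_principle_at_infinity:
  fixes v :: "real \<times> 'a::euclidean_space \<Rightarrow> real"
  assumes S: "open S" "{z. fst z \<le> T} \<subseteq> S" and v: "Ck 2 S v"
    and V: "\<And>j. j < m \<Longrightarrow> Ck 1 UNIV (V j)"
    and super: "\<And>z. fst z \<le> T \<Longrightarrow> heat_op m V v z \<le> 0"
    and lim: "(v \<longlongrightarrow> 0) at_infinity" and z: "fst z \<le> T"
  shows "0 \<le> v z"
proof (rule ccontr)
  assume "\<not> 0 \<le> v z"
  define t where "t = fst z"
  \<comment> \<open>With this choice \<open>?w z\<close> is exactly \<open>- \<delta>\<close>, while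
    \<open>?w\<close> exceeds \<open>- \<delta>\<close> far away, where \<open>v\<close> itself
    does. The minimum over a large ball is thus a minimum over all earlier times.\<close>
  define \<delta> where "\<delta> = - v z / 2"
  have \<delta>: "0 < \<delta>" "v z = - 2 * \<delta>" using \<open>\<not> 0 \<le> v z\<close> by (auto simp: \<delta>_def)
  let ?g = "\<lambda>s. \<delta> * exp (s - t)"
  let ?w = "\<lambda>z. v z + ?g (fst z)"
  have "\<forall>\<^sub>F y in at_infinity. \<bar>v y\<bar> < \<delta>"
    using tendstoD[OF lim \<delta>(1)] by (simp add: dist_norm)
  then obtain R where R: "\<And>y. R \<le> norm y \<Longrightarrow> \<bar>v y\<bar> < \<delta>"
    unfolding eventually_at_infinity by blast
  have far: "- \<delta> < ?w y" if "R \<le> norm y" for y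
    using R[OF that] \<delta>(1) mult_pos_pos[OF \<delta>(1) exp_gt_zero[of "fst y - t"]] by linarith
  let ?C = "cball 0 R \<inter> {y :: real \<times> 'a. fst y \<le> t}"
  have wz: "?w z = - \<delta>" using \<delta> by (simp add: t_def)
  have zC: "z \<in> ?C" using far[of z] wz by (cases "R \<le> norm z") (auto simp: t_def)
  have "closed {y :: real \<times> 'a. fst y \<le> t}"
    by (intro closed_Collect_le continuous_intros)
  then have C: "compact ?C" using compact_Int_closed[OF compact_cball] by blast
  have "continuous_on ?C v"
    by (rule continuous_on_subset[OF Ck_continuous[OF v]]) (use S(2) z in \<open>auto simp: t_def\<close>)
  then have "continuous_on ?C ?w" by (intro continuous_intros)
  obtain y where y: "y \<in> ?C" "\<And>x. x \<in> ?C \<Longrightarrow> ?w y \<le> ?w x"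
    using continuous_attains_inf[OF C _ \<open>continuous_on ?C ?w\<close>] zC by (metis empty_iff)
  have min: "?w y \<le> ?w x" if "fst x \<le> t" for x
  proof (cases "x \<in> ?C")
    case False
    then have "- \<delta> < ?w x" using that by (intro far) auto
    then show ?thesis using y(2)[OF zC] wz by simp
  qed (use y in blast)
  have yS: "y \<in> S" using y S(2) z by (auto simp: t_def)
  have g: "(?g has_real_derivative ?g s) (at s)" for s by (auto intro!: derivative_eq_intros)
  have g_Ck: "Ck k UNIV ?g" for k
  proof (induction k)
    case 0
    show ?case by (auto intro!: continuous_intros)
  next
    case (Suc k)
    show ?case
    proof (rule Ck_SucI)
      show "(?g has_derivative (\<lambda>h. ?g s * h)) (at s)" for s using g by (simp add: has_field_derivative_def)
      show "Ck k UNIV (\<lambda>s. ?g s * b)" for b by (intro Ck_mult Suc) auto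
    qed auto
  qed
  have "Ck 2 S ?w"
    by (rule Ck_add[OF S(1) v], rule Ck_compose_UNIV[OF S(1) _ g_Ck], rule Ck_linear[OF bounded_linear_fst S(1)])
  then have "0 \<le> heat_op m V ?w (fst y, snd y)"
    by (rule heat_op_nonneg_at_min[OF S(1) _ V, where e=1]) (use yS min y(1) in auto)
  moreover have "heat_op m V ?w y = heat_op m V v y - ?g (fst y)"
    by (rule heat_op_add_time[OF S(1) v yS g])
  moreover have "heat_op m V v y \<le> 0" using super y(1) z by (auto simp: t_def)
  ultimately show False using mult_pos_pos[OF \<delta>(1) exp_gt_zero[of "fst y - t"]] by simp
qed

section \<open>Homogeneous groups\<close>

lemma integral_lborel_preserving:
  fixes f :: "'b::euclidean_space \<Rightarrow> real" and T :: "'a::euclidean_space \<Rightarrow> 'b"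
  assumes T: "T \<in> borel_measurable borel" "distr lborel borel T = lborel" and f: "f \<in> borel_measurable borel"
  shows "(\<integral>x. f (T x) \<partial>lborel) = (\<integral>x. f x \<partial>lborel)"
    and "integrable lborel (\<lambda>x. f (T x)) \<longleftrightarrow> integrable lborel f"
proof -
  have T': "T \<in> lborel \<rightarrow>\<^sub>M borel" using T(1) by simp
  show "(\<integral>x. f (T x) \<partial>lborel) = (\<integral>x. f x \<partial>lborel)"
    using integral_distr[OF T' f] T(2) by simp
  show "integrable lborel (\<lambda>x. f (T x)) \<longleftrightarrow> integrable lborel f"
    using integrable_distr_eq[OF T' f] T(2) by simp
qed

text \<open>Formulated over an arbitrary Euclidean space so that the spatial group and its product
  with the time line are both instances; mollification takes place on the latter.\<close>

locale hom_group =
  fixes \<omega> :: "'a::euclidean_space" and gm :: "'a \<Rightarrow> 'a \<Rightarrow> 'a" and gi :: "'a \<Rightarrow> 'a"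
  assumes weight_ge_1: "b \<in> Basis \<Longrightarrow> 1 \<le> \<omega> \<bullet> b"
    and assoc: "gm (gm a b) c = gm a (gm b c)"
    and left_zero [simp]: "gm 0 a = a" and right_zero [simp]: "gm a 0 = a"
    and right_inv [simp]: "gm a (gi a) = 0" and left_inv [simp]: "gm (gi a) a = 0"
    and smooth_gm: "Ck k UNIV (\<lambda>w. gm (fst w) (snd w))" and smooth_gi: "Ck k UNIV gi"
    and dl_gm: "0 < r \<Longrightarrow> dl \<omega> r (gm a b) = gm (dl \<omega> r a) (dl \<omega> r b)"
begin

lemma weight_pos: "b \<in> Basis \<Longrightarrow> 0 < \<omega> \<bullet> b"
  using weight_ge_1 by fastforce

lemma Ck_gm: "open S \<Longrightarrow> Ck k S f \<Longrightarrow> Ck k S g \<Longrightarrow> Ck k S (\<lambda>x. gm (f x) (g x))"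
  using Ck_compose_UNIV[OF _ Ck_Pair smooth_gm, of S k f g] by simp

lemma Ck_gi: "open S \<Longrightarrow> Ck k S f \<Longrightarrow> Ck k S (\<lambda>x. gi (f x))"
  by (rule Ck_compose_UNIV[OF _ _ smooth_gi])

lemma continuous_gm: "continuous_on S f \<Longrightarrow> continuous_on S g \<Longrightarrow> continuous_on S (\<lambda>x. gm (f x) (g x))"
  using continuous_on_compose2[OF Ck_continuous[OF smooth_gm] continuous_on_Pair, of S f g] by simp

lemma continuous_gi: "continuous_on S f \<Longrightarrow> continuous_on S (\<lambda>x. gi (f x))"
  by (rule continuous_on_compose2[OF Ck_continuous[OF smooth_gi]]) auto

lemma measurable_gm [measurable (raw)]:
  "f \<in> borel_measurable M \<Longrightarrow> g \<in> borel_measurable M \<Longrightarrow> (\<lambda>x. gm (f x) (g x)) \<in> borel_measurable M"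
  by (rule borel_measurable_continuous_Pair) (auto intro: Ck_continuous[OF smooth_gm])

lemma measurable_gi [measurable]: "gi \<in> borel_measurable borel"
  by (rule borel_measurable_continuous_onI) (rule Ck_continuous[OF smooth_gi])

lemma gi_gm_cancel [simp]: "gm (gi a) (gm a b) = b" and gm_gi_cancel [simp]: "gm a (gm (gi a) b) = b"
  by (simp_all flip: assoc)

lemma gi_unique: "gm a b = 0 \<Longrightarrow> b = gi a"
  by (metis gi_gm_cancel right_zero)

lemma gi_zero [simp]: "gi 0 = 0"
  by (metis gi_unique left_zero)

lemma gi_gi [simp]: "gi (gi a) = a"
  by (metis gi_unique left_inv)

lemma gi_gm: "gi (gm a b) = gm (gi b) (gi a)"
proof (rule sym, rule gi_unique)
  have "gm (gm a b) (gm (gi b) (gi a)) = gm a (gm b (gm (gi b) (gi a)))" by (rule assoc)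
  then show "gm (gm a b) (gm (gi b) (gi a)) = 0" by simp
qed

lemma dl_gi: "0 < r \<Longrightarrow> dl \<omega> r (gi a) = gi (dl \<omega> r a)"
  by (rule gi_unique) (simp flip: dl_gm)

lemma gm_differentiable: "gm a differentiable (at z)"
proof -
  have "Ck 1 UNIV (gm a)" using Ck_gm[of UNIV 1 "\<lambda>_. a" "\<lambda>x. x"] by simp
  then show ?thesis by (rule Ck_differentiable) auto
qed

lemma gm_has_derivative_0: "((\<lambda>w. gm (fst w) (snd w)) has_derivative (\<lambda>w. fst w + snd w)) (at 0)"
proof -
  let ?g = "\<lambda>w. gm (fst w) (snd w)" and ?D = "frechet_derivative (\<lambda>w. gm (fst w) (snd w)) (at 0)"
  have "?g differentiable (at 0)" by (rule Ck_differentiable[OF smooth_gm[of 1]]) auto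
  then have D: "(?g has_derivative ?D) (at 0)" by (rule frechet_derivative_worksI)
  have "((\<lambda>x. ?g (x, 0)) has_derivative (\<lambda>h. ?D (h, 0))) (at 0)"
    by (rule has_derivative_compose[where f="\<lambda>x. (x, 0)" and g="?g"])
      (use D in \<open>auto intro!: derivative_eq_intros simp: zero_prod_def[symmetric]\<close>)
  then have 1: "?D (h, 0) = h" for h
    using fun_cong[OF has_derivative_unique[OF _ has_derivative_ident], of "\<lambda>h. ?D (h, 0)" 0 h] by simp
  have "((\<lambda>x. ?g (0, x)) has_derivative (\<lambda>h. ?D (0, h))) (at 0)"
    by (rule has_derivative_compose[where f="\<lambda>x. (0, x)" and g="?g"])
      (use D in \<open>auto intro!: derivative_eq_intros simp: zero_prod_def[symmetric]\<close>)
  then have 2: "?D (0, h) = h" for h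
    using fun_cong[OF has_derivative_unique[OF _ has_derivative_ident], of "\<lambda>h. ?D (0, h)" 0 h] by simp
  have "?D w = fst w + snd w" for w
    using linear_add[OF has_derivative_linear[OF D], of "(fst w, 0)" "(0, snd w)"] 1 2 by simp
  then have "?D = (\<lambda>w. fst w + snd w)" by blast
  then show ?thesis using D by simp
qed

lemma gi_has_derivative_0: "(gi has_derivative uminus) (at 0)"
proof -
  let ?D = "frechet_derivative gi (at 0)"
  have "gi differentiable (at 0)" by (rule Ck_differentiable[OF smooth_gi[of 1]]) auto
  then have D: "(gi has_derivative ?D) (at 0)" by (rule frechet_derivative_worksI)
  have "((\<lambda>x. gm (fst (x, gi x)) (snd (x, gi x))) has_derivative (\<lambda>h. fst (h, ?D h) + snd (h, ?D h))) (at 0)"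
  proof (rule has_derivative_compose[where f="\<lambda>x. (x, gi x)"])
    show "((\<lambda>x. (x, gi x)) has_derivative (\<lambda>h. (h, ?D h))) (at 0)"
      by (intro has_derivative_Pair has_derivative_ident D)
    show "((\<lambda>w. gm (fst w) (snd w)) has_derivative (\<lambda>w. fst w + snd w)) (at (0, gi 0))"
      using gm_has_derivative_0 by (simp add: zero_prod_def)
  qed
  then have "((\<lambda>x::'a. 0::'a) has_derivative (\<lambda>h. h + ?D h)) (at 0)" by simp
  from fun_cong[OF has_derivative_unique[OF this has_derivative_const]]
  have "?D h = - h" for h by (simp add: eq_neg_iff_add_eq_0 add.commute)
  then have "?D = uminus" by blast
  then show ?thesis using D by simp
qed

lemma lborel_left: "distr lborel borel (gm a) = lborel"
proof -
  have "distr lborel borel (\<lambda>w. (\<lambda>z. gm (fst z) (snd z)) (a, w)) = lborel"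
    by (rule homogeneous_lborel[where \<omega>p=\<omega> and \<omega>=\<omega> and e="\<lambda>_. 1" and G="\<lambda>w. w"])
      (use smooth_gm weight_pos in \<open>auto simp: dl_gm\<close>)
  then show ?thesis by simp
qed

text \<open>Inversion commutes with the dilations and its derivative at 0 is minus the identity, so
  it is triangular with all signs -1. The first component of the pair is a dummy parameter.\<close>

lemma lborel_gi: "distr lborel borel gi = lborel"
proof -
  have "distr lborel borel (\<lambda>w. (\<lambda>z::'a \<times> 'a. gi (snd z)) (0, w)) = lborel"
  proof (rule homogeneous_lborel[where \<omega>p=\<omega> and \<omega>=\<omega> and e="\<lambda>_. - 1" and G=gi and G'=uminus])
    show "Ck 1 UNIV (\<lambda>z::'a \<times> 'a. gi (snd z))"
      by (intro Ck_gi Ck_linear bounded_linear_snd) auto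
  qed (use weight_pos gi_has_derivative_0 in \<open>auto simp: dl_gi\<close>)
  then show ?thesis by simp
qed

lemma integral_left:
  fixes f :: "'a \<Rightarrow> real"
  assumes "f \<in> borel_measurable borel"
  shows "(\<integral>x. f (gm a x) \<partial>lborel) = (\<integral>x. f x \<partial>lborel)"
    and "integrable lborel (\<lambda>x. f (gm a x)) \<longleftrightarrow> integrable lborel f"
  by (rule integral_lborel_preserving[OF _ lborel_left assms]; measurable)+

lemma integral_gi:
  fixes f :: "'a \<Rightarrow> real"
  assumes "f \<in> borel_measurable borel"
  shows "(\<integral>x. f (gi x) \<partial>lborel) = (\<integral>x. f x \<partial>lborel)"
    and "integrable lborel (\<lambda>x. f (gi x)) \<longleftrightarrow> integrable lborel f"
  by (rule integral_lborel_preserving[OF _ lborel_gi assms]; measurable)+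

end

section \<open>Space-time as a homogeneous group, and left-invariant heat operators\<close>

definition tgm :: "('a::euclidean_space \<Rightarrow> 'a \<Rightarrow> 'a) \<Rightarrow> real \<times> 'a \<Rightarrow> real \<times> 'a \<Rightarrow> real \<times> 'a" where
  "tgm gm z w = (fst z + fst w, gm (snd z) (snd w))"

definition tgi :: "('a::euclidean_space \<Rightarrow> 'a) \<Rightarrow> real \<times> 'a \<Rightarrow> real \<times> 'a" where
  "tgi gi z = (- fst z, gi (snd z))"

text \<open>Time gets weight 2, the weight that makes the time derivative homogeneous of the same
  degree as the squares of the fields.\<close>

lemma hom_group_time:
  assumes "hom_group \<omega> gm gi"
  shows "hom_group (2, \<omega>) (tgm gm) (tgi gi)"
proof -
  interpret hom_group \<omega> gm gi by fact
  show ?thesis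
  proof
    show "1 \<le> (2::real, \<omega>) \<bullet> b" if "b \<in> Basis" for b
      using that weight_ge_1 by (auto simp: Basis_prod_def)
    show "Ck k UNIV (\<lambda>w. tgm gm (fst w) (snd w))" for k
      unfolding tgm_def
      by (intro Ck_Pair Ck_add Ck_gm Ck_fst Ck_snd Ck_ident open_UNIV)
    show "Ck k UNIV (tgi gi)" for k
      unfolding tgi_def[abs_def]
      by (intro Ck_Pair Ck_uminus Ck_gi Ck_fst Ck_snd Ck_ident open_UNIV)
    show "dl (2, \<omega>) r (tgm gm a b) = tgm gm (dl (2, \<omega>) r a) (dl (2, \<omega>) r b)" if "0 < r" for r a b
      using dl_gm[OF that] linear_add[OF bounded_linear.linear[OF bounded_linear_dl[of "2::real" r]]]
      by (cases a; cases b) (simp add: tgm_def dl_Pair)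
  qed (auto simp: tgm_def tgi_def assoc zero_prod_def)
qed

text \<open>The component in direction \<open>b\<close> of a field of degree 1 is homogeneous of
  degree \<open>\<omega> \<bullet> b - 1\<close>, below the weight of \<open>b\<close>, so by
  \<open>pd_homogeneous\<close> its derivative along \<open>b\<close> is 0. The field is
  divergence-free, and its adjoint is its negative.\<close>

lemma hom_field_adj:
  fixes V :: "'a::euclidean_space \<Rightarrow> 'a"
  assumes V: "Ck 1 UNIV V" and hom: "\<And>r z. 0 < r \<Longrightarrow> dl \<omega> r (V z) = r *\<^sub>R V (dl \<omega> r z)"
    and \<omega>: "\<And>b. b \<in> Basis \<Longrightarrow> 0 < \<omega> \<bullet> b" and f: "f differentiable (at z)"
  shows "vf_adj V f z = - vf V f z"
proof -
  have "pd b (\<lambda>y. (V y \<bullet> b) * f y) z = (V z \<bullet> b) * pd b f z" if b: "b \<in> Basis" for b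
  proof -
    let ?g = "\<lambda>y. V y \<bullet> b"
    have g: "Ck 1 UNIV ?g" by (intro Ck_inner V) auto
    have "pd b ?g z = (if \<omega> \<bullet> b - 1 = \<omega> \<bullet> b then pd b ?g 0 else 0)"
    proof (rule pd_homogeneous[OF g _ \<omega> b])
      fix r :: real and y assume r: "0 < r"
      have "r * ?g (dl \<omega> r y) = r powr (\<omega> \<bullet> b) * ?g y"
        using arg_cong[OF hom[OF r, of y], of "\<lambda>v. v \<bullet> b"] b by (simp add: dl_inner)
      then show "?g (dl \<omega> r y) = r powr (\<omega> \<bullet> b - 1) * ?g y"
        using r by (simp add: powr_diff field_simps)
    qed auto
    then have 0: "pd b ?g z = 0" by simp
    have "?g differentiable (at z)" by (rule Ck_differentiable[OF g]) auto
    from has_derivative_pd[OF has_derivative_mult[OF frechet_derivative_worksI[OF this] frechet_derivative_worksI[OF f]], of b]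
    show ?thesis using 0 by (simp add: pd_def)
  qed
  then show ?thesis by (simp add: vf_adj_def vf_def)
qed

locale heat_group = hom_group \<omega> gm gi
  for \<omega> :: "'a::euclidean_space" and gm gi +
  fixes m :: nat and Z :: "nat \<Rightarrow> 'a \<Rightarrow> 'a"
  assumes smooth_Z: "j < m \<Longrightarrow> Ck k UNIV (Z j)"
    and left_Z: "j < m \<Longrightarrow> frechet_derivative (gm a) (at z) (Z j z) = Z j (gm a z)"
    and dl_Z: "j < m \<Longrightarrow> 0 < r \<Longrightarrow> dl \<omega> r (Z j z) = r *\<^sub>R Z j (dl \<omega> r z)"
begin

abbreviation "tm \<equiv> tgm gm"
abbreviation "ti \<equiv> tgi gi"
abbreviation "D \<equiv> dl (2::real, \<omega>)"

sublocale tg: hom_group "(2, \<omega>)" tm ti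
  by (rule hom_group_time) (rule hom_group_axioms)

lemma D_pair: "0 < r \<Longrightarrow> D r (t, x) = (r\<^sup>2 * t, dl \<omega> r x)"
  by (simp add: dl_Pair dl_def[of "2::real"] powr_numeral)

lemma vf_adj_Z:
  assumes "j < m" "f differentiable (at z)"
  shows "vf_adj (liftx (Z j)) f z = - vf (liftx (Z j)) f z"
proof (rule hom_field_adj[where \<omega>="(2, \<omega>)"])
  show "D r (liftx (Z j) z) = r *\<^sub>R liftx (Z j) (D r z)" if "0 < r" for r z
    using dl_Z[OF assms(1) that] by (cases z) (simp add: liftx_def dl_Pair)
qed (use assms smooth_Z Ck_liftx tg.weight_pos in auto)

lemma heat_op_adj_eq:
  assumes f: "Ck 2 UNIV f"
  shows "heat_op_adj m Z f z = subl m Z f z + pd (1, 0) f z"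
proof -
  have "vf_adj (liftx (Z j)) (vf_adj (liftx (Z j)) f) z = vf (liftx (Z j)) (vf (liftx (Z j)) f) z" if j: "j < m" for j
  proof -
    have "f differentiable (at y)" for y by (rule Ck_differentiable[OF f]) auto
    then have "vf_adj (liftx (Z j)) f = (\<lambda>y. - vf (liftx (Z j)) f y)"
      using vf_adj_Z[OF j] by blast
    moreover have "Ck 1 UNIV (vf (liftx (Z j)) f)"
      by (rule Ck_vf_less[OF _ f]) (use Ck_liftx[OF smooth_Z[OF j]] in auto)
    then have d: "vf (liftx (Z j)) f differentiable (at z)" by (rule Ck_differentiable) auto
    then have "vf_adj (liftx (Z j)) (\<lambda>y. - vf (liftx (Z j)) f y) z = - vf (liftx (Z j)) (\<lambda>y. - vf (liftx (Z j)) f y) z"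
      by (intro vf_adj_Z[OF j] differentiable_minus)
    moreover have "vf (liftx (Z j)) (\<lambda>y. - vf (liftx (Z j)) f y) z = - vf (liftx (Z j)) (vf (liftx (Z j)) f) z"
      using has_derivative_vf[OF has_derivative_minus[OF frechet_derivative_worksI[OF d]]] vf_eq_frechet[OF d] by simp
    ultimately show ?thesis by simp
  qed
  then show ?thesis by (simp add: heat_op_adj_def subl_def)
qed

lemma heat_op_adj_left:
  assumes f: "Ck 2 UNIV f"
  shows "heat_op_adj m Z (\<lambda>z. f (tm a z)) z = heat_op_adj m Z f (tm a z)"
proof -
  have eq: "(\<lambda>z. f (tm a z)) = (\<lambda>(t, x). f (1\<^sup>2 * t + fst a, gm (snd a) x))"
    by (auto simp: tgm_def add.commute)
  have rel: "frechet_derivative (gm (snd a)) (at x) (Z j x) = 1 *\<^sub>R Z j (gm (snd a) x)" if "j < m" for j x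
    using left_Z[OF that] by simp
  note r = heat_related[where t="fst z" and s="fst a" and x="snd z", OF open_UNIV f gm_differentiable rel smooth_Z UNIV_I]
  have "Ck 2 UNIV (\<lambda>z. f (tm a z))"
    by (intro Ck_compose_UNIV[OF _ _ f] tg.Ck_gm) auto
  then have "heat_op_adj m Z (\<lambda>z. f (tm a z)) z = subl m Z (\<lambda>z. f (tm a z)) z + pd (1, 0) (\<lambda>z. f (tm a z)) z"
    by (rule heat_op_adj_eq)
  also have "\<dots> = subl m Z f (tm a z) + pd (1, 0) f (tm a z)"
    using r unfolding eq by (simp add: tgm_def add.commute)
  finally show ?thesis by (simp add: heat_op_adj_eq[OF f])
qed

lemma heat_op_adj_dl:
  assumes f: "Ck 2 UNIV f" and r: "0 < r"
  shows "heat_op_adj m Z (\<lambda>z. f (D r z)) z = r\<^sup>2 * heat_op_adj m Z f (D r z)"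
proof -
  have eq: "(\<lambda>z. f (D r z)) = (\<lambda>(t, x). f (r\<^sup>2 * t + 0, dl \<omega> r x))"
    using r by (auto simp: D_pair)
  have d: "dl \<omega> r differentiable (at x)" for x
    by (rule differentiableI[OF bounded_linear_imp_has_derivative[OF bounded_linear_dl]])
  have rel: "frechet_derivative (dl \<omega> r) (at x) (Z j x) = r *\<^sub>R Z j (dl \<omega> r x)" if "j < m" for j x
    using dl_Z[OF that r] frechet_derivative_at[OF bounded_linear_imp_has_derivative[OF bounded_linear_dl], of \<omega> r x]
    by metis
  note rr = heat_related[where t="fst z" and s=0 and x="snd z", OF open_UNIV f d rel smooth_Z UNIV_I]
  have "Ck 2 UNIV (\<lambda>z. f (D r z))"
    by (intro Ck_compose_UNIV[OF _ _ f] Ck_linear bounded_linear_dl) auto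
  then have "heat_op_adj m Z (\<lambda>z. f (D r z)) z = subl m Z (\<lambda>z. f (D r z)) z + pd (1, 0) (\<lambda>z. f (D r z)) z"
    by (rule heat_op_adj_eq)
  also have "\<dots> = r\<^sup>2 * subl m Z f (D r z) + r\<^sup>2 * pd (1, 0) f (D r z)"
    using rr r unfolding eq by (cases z) (simp add: D_pair)
  finally show ?thesis by (simp add: heat_op_adj_eq[OF f] distrib_left)
qed

lemma Ck_heat_op_adj:
  assumes "Ck (Suc (Suc k)) UNIV f"
  shows "Ck k UNIV (heat_op_adj m Z f)"
proof -
  have "Ck 2 UNIV f" by (rule Ck_mono[OF assms]) simp
  then have "heat_op_adj m Z f = (\<lambda>z. subl m Z f z + pd (1, 0) f z)"
    by (intro ext heat_op_adj_eq)
  moreover have "Ck k UNIV (subl m Z f)" by (rule Ck_heat_op(1)[OF _ assms]) (auto intro: smooth_Z)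
  moreover have "Ck k UNIV (pd (1, 0) f)" by (rule Ck_pd_less[OF assms _ time_Basis]) simp
  ultimately show ?thesis by (simp add: Ck_add)
qed

lemma heat_op_adj_eq_0_outside:
  assumes "compact K" "\<And>x. x \<notin> K \<Longrightarrow> f x = 0" "x \<notin> K"
  shows "heat_op_adj m Z f x = 0"
proof -
  have "x \<notin> K \<Longrightarrow> vf_adj W f x = 0" for x W by (rule vf_adj_eq_0_outside[OF assms(1,2)]) auto
  then have "x \<notin> K \<Longrightarrow> vf_adj W (vf_adj W f) x = 0" for x W by (rule vf_adj_eq_0_outside[OF assms(1)]) auto
  then show ?thesis using assms pd_eq_0_outside[OF assms] by (simp add: heat_op_adj_def)
qed

text \<open>\<open>fund_sol_0\<close> with a source of strength \<open>c\<close>. The family is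
  closed under linear combinations: the difference of two fundamental solutions has strength 0, and
  the negative of one has strength -1.\<close>

definition weak_kernel :: "real \<Rightarrow> (real \<times> 'a \<Rightarrow> real) \<Rightarrow> bool" where
  "weak_kernel c v \<longleftrightarrow>
     (\<forall>K. compact K \<longrightarrow> set_integrable lborel K v) \<and>
     smooth_on (UNIV - {0}) v \<and>
     (v \<longlongrightarrow> 0) at_infinity \<and>
     (\<forall>\<phi>. smooth \<phi> \<and> bounded {z. \<phi> z \<noteq> 0} \<longrightarrow>
        integrable lborel (\<lambda>z. v z * heat_op_adj m Z \<phi> z) \<and>
        (LINT z|lborel. v z * heat_op_adj m Z \<phi> z) = - (c * \<phi> 0))"

lemma fund_sol_0_weak_kernel: "fund_sol_0 m Z v \<longleftrightarrow> weak_kernel 1 v"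
  by (simp add: fund_sol_0_def weak_kernel_def)

lemma weak_kernel_measurable: "weak_kernel c v \<Longrightarrow> v \<in> borel_measurable borel"
  by (rule borel_measurable_continuous_countable_exceptions[of "{0}"])
    (auto simp: weak_kernel_def Compl_eq_Diff_UNIV intro: Ck_continuous[OF smooth_on_Ck])

lemma weak_kernel_Ck: "weak_kernel c v \<Longrightarrow> Ck k (- {0}) v"
  by (auto simp: weak_kernel_def Compl_eq_Diff_UNIV intro: smooth_on_Ck)

lemma weak_kernel_lim: "weak_kernel c v \<Longrightarrow> (v \<longlongrightarrow> 0) at_infinity"
  by (simp add: weak_kernel_def)

lemma weak_kernel_test:
  assumes "weak_kernel c v" "smooth f" "compact K" "\<And>x. x \<notin> K \<Longrightarrow> f x = 0"
  shows "integrable lborel (\<lambda>z. v z * heat_op_adj m Z f z)"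
    and "(\<integral>z. v z * heat_op_adj m Z f z \<partial>lborel) = - (c * f 0)"
proof -
  have "bounded {z. f z \<noteq> 0}"
    by (rule bounded_subset[OF compact_imp_bounded[OF assms(3)]]) (use assms(4) in auto)
  then show "integrable lborel (\<lambda>z. v z * heat_op_adj m Z f z)"
    and "(\<integral>z. v z * heat_op_adj m Z f z \<partial>lborel) = - (c * f 0)"
    using assms(1,2) by (auto simp: weak_kernel_def)
qed

lemma weak_kernel_linear:
  assumes v: "weak_kernel c v" and w: "weak_kernel d w"
  shows "weak_kernel (a * c + b * d) (\<lambda>z. a * v z + b * w z)"
  unfolding weak_kernel_def
proof (intro conjI allI impI; (elim conjE)?)
  fix K :: "(real \<times> 'a) set" assume "compact K"
  then show "set_integrable lborel K (\<lambda>z. a * v z + b * w z)"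
    using v w by (intro set_integral_add set_integrable_mult_right) (auto simp: weak_kernel_def)
next
  show "smooth_on (UNIV - {0}) (\<lambda>z. a * v z + b * w z)"
    unfolding smooth_on_iff_Ck Compl_eq_Diff_UNIV[symmetric]
    by (intro allI Ck_add Ck_cmult weak_kernel_Ck[OF v] weak_kernel_Ck[OF w]) auto
  show "((\<lambda>z. a * v z + b * w z) \<longlongrightarrow> 0) at_infinity"
    using tendsto_add[OF tendsto_mult_left[OF weak_kernel_lim[OF v], of a] tendsto_mult_left[OF weak_kernel_lim[OF w], of b]]
    by simp
next
  fix \<phi> :: "real \<times> 'a \<Rightarrow> real" assume \<phi>: "smooth \<phi>" "bounded {z. \<phi> z \<noteq> 0}"
  have 1: "integrable lborel (\<lambda>z. v z * heat_op_adj m Z \<phi> z)" "(LINT z|lborel. v z * heat_op_adj m Z \<phi> z) = - (c * \<phi> 0)"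
    "integrable lborel (\<lambda>z. w z * heat_op_adj m Z \<phi> z)" "(LINT z|lborel. w z * heat_op_adj m Z \<phi> z) = - (d * \<phi> 0)"
    using v w \<phi> by (auto simp: weak_kernel_def)
  have 2: "(a * v z + b * w z) * heat_op_adj m Z \<phi> z = a * (v z * heat_op_adj m Z \<phi> z) + b * (w z * heat_op_adj m Z \<phi> z)" for z
    by (simp add: algebra_simps)
  show "integrable lborel (\<lambda>z. (a * v z + b * w z) * heat_op_adj m Z \<phi> z)"
    unfolding 2 using 1 by auto
  show "(LINT z|lborel. (a * v z + b * w z) * heat_op_adj m Z \<phi> z) = - ((a * c + b * d) * \<phi> 0)"
    unfolding 2 using 1 by (simp add: algebra_simps)
qed

lemma weak_kernel_heat_eq:
  assumes v: "weak_kernel c v" and z: "z \<noteq> 0"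
  shows "heat_op m Z v z = 0"
proof (rule eq_0_of_test_functions[where S="- {0}" and f="heat_op m Z v" and x=z])
  have v2: "Ck 2 (- {0}) v" by (rule weak_kernel_Ck[OF v])
  show "continuous_on (- {0}) (heat_op m Z v)"
    by (rule Ck_continuous[where k=0], rule Ck_heat_op(2)) (use smooth_Z weak_kernel_Ck[OF v] in auto)
  fix f :: "real \<times> 'a \<Rightarrow> real" and K :: "(real \<times> 'a) set"
  assume f: "smooth f" and K: "compact K" "K \<subseteq> - {0}" "\<And>x. x \<notin> K \<Longrightarrow> f x = 0"
  have "(\<integral>z. heat_op m Z v z * f z \<partial>lborel) = (\<integral>z. v z * heat_op_adj m Z f z \<partial>lborel)"
    by (rule integral_heat_op_adj[symmetric, OF _ v2 smooth_Z smooth_on_Ck[OF f] K]) auto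
  also have "\<dots> = - (c * f 0)" by (rule weak_kernel_test(2)[OF v f K(1,3)])
  also have "\<dots> = 0" using K by auto
  finally show "(\<integral>z. heat_op m Z v z * f z \<partial>lborel) = 0" .
qed (use z in auto)

end

section \<open>Comparison for weak kernels\<close>

lemma integrable_bump: "0 < r \<Longrightarrow> integrable lborel (bump c r)"
  by (rule integrable_compact_support[of "cball c r"])
    (auto intro: bump_eq_0 continuous_on_subset[OF Ck_continuous[OF Ck_bump]])

lemma dpart_mult_const:
  fixes f :: "'a::euclidean_space \<Rightarrow> real"
  assumes "open S" "Ck (length bs) S f" "set bs \<subseteq> Basis" "x \<in> S"
  shows "dpart bs (\<lambda>x. f x * c) x = dpart bs f x * c"
  using assms(2-)
proof (induction bs arbitrary: x)
  case (Cons b bs)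
  have "dpart bs f differentiable (at x)"
    by (rule Ck_differentiable[where k=1, OF Ck_dpart[OF Cons.prems(1)]]) (use Cons.prems in auto)
  then have "pd b (\<lambda>x. dpart bs f x * c) x = pd b (dpart bs f) x * c"
    using has_derivative_pd[OF has_derivative_mult_left[OF frechet_derivative_worksI]] by (simp add: pd_def)
  moreover have "pd b (dpart bs (\<lambda>x. f x * c)) x = pd b (\<lambda>x. dpart bs f x * c) x"
    using Cons.prems Ck_mono[OF Cons.prems(1), of "length bs"]
    by (intro pd_cong_open[OF assms(1)]) (auto intro!: Cons.IH)
  ultimately show ?case by simp
qed simp

lemma dpart_zero: "dpart bs (\<lambda>x::'a::euclidean_space. 0::'b::real_normed_vector) x = 0"
proof (induction bs arbitrary: x)
  case (Cons b bs)
  have "dpart bs (\<lambda>x::'a. 0::'b) = (\<lambda>x. 0)" using Cons.IH by blast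
  then show ?case by (simp add: has_derivative_pd[OF has_derivative_const])
qed simp

context heat_group
begin

lemma weak_kernel_integrable_on:
  assumes "weak_kernel c v" "compact K"
  shows "integrable lborel (\<lambda>z. C * (indicator K z *\<^sub>R \<bar>v z\<bar>))"
proof -
  have "set_integrable lborel K v" using assms by (simp add: weak_kernel_def)
  then have "set_integrable lborel K (\<lambda>z. \<bar>v z\<bar>)" by (rule set_integrable_abs)
  then show ?thesis unfolding set_integrable_def by (intro integrable_mult_right)
qed

text \<open>If \<open>v\<close> were negative at \<open>z0\<close>, it would be negative at
  \<open>a\<inverse> z0\<close> for all \<open>a\<close> in the support of a small bump
  \<open>\<rho>\<close>. The average \<open>w\<close> of the left translates of \<open>v\<close>
  against \<open>\<rho>\<close> solves the equation with right side \<open>- c * \<rho>\<close> and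
  tends to 0 at infinity, so the maximum principle gives \<open>0 \<le> w z0\<close>; but
  \<open>w z0\<close> is an integral of negative values.\<close>

lemma weak_kernel_nonneg:
  assumes v: "weak_kernel c v" and c: "0 \<le> c" and z0: "z0 \<noteq> 0"
  shows "0 \<le> v z0"
proof (rule ccontr)
  assume neg: "\<not> 0 \<le> v z0"
  have v_m [measurable]: "v \<in> borel_measurable borel" by (rule weak_kernel_measurable[OF v])
  have "isCont v z0"
    using Ck_continuous[OF weak_kernel_Ck[OF v, of 0]] z0
      continuous_on_eq_continuous_at[of "- {0}" v] open_Compl[OF closed_singleton] by blast
  moreover have "continuous_on UNIV (\<lambda>a. tm (ti a) z0)"
    by (intro tg.continuous_gm tg.continuous_gi continuous_on_id continuous_on_const)
  then have "isCont (\<lambda>a. tm (ti a) z0) 0"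
    using continuous_on_eq_continuous_at[OF open_UNIV] by blast
  ultimately have "isCont (\<lambda>a. v (tm (ti a) z0)) 0"
    using isCont_o2[of 0 "\<lambda>a. tm (ti a) z0" v] by simp
  then have "((\<lambda>a. v (tm (ti a) z0)) \<longlongrightarrow> v (tm (ti 0) z0)) (nhds 0)"
    unfolding isCont_def by (rule iffD1[OF tendsto_at_iff_tendsto_nhds])
  then have "((\<lambda>a. v (tm (ti a) z0)) \<longlongrightarrow> v z0) (nhds 0)" by simp
  then have "\<forall>\<^sub>F a in nhds 0. v (tm (ti a) z0) < 0"
    using neg by (intro order_tendstoD(2)) auto
  then obtain r where r: "0 < r" "\<And>a. a \<in> ball 0 r \<Longrightarrow> v (tm (ti a) z0) < 0"
    unfolding eventually_nhds_metric by (auto simp: dist_commute)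
  define \<rho> :: "real \<times> 'a \<Rightarrow> real" where "\<rho> = bump 0 r"
  have \<rho>_Ck: "Ck k UNIV \<rho>" for k unfolding \<rho>_def by (rule Ck_bump)
  have \<rho>_m [measurable]: "\<rho> \<in> borel_measurable borel"
    by (rule borel_measurable_continuous_onI) (rule Ck_continuous[OF \<rho>_Ck])
  have \<rho>: "0 \<le> \<rho> a" "a \<in> ball 0 r \<Longrightarrow> 0 < \<rho> a" "a \<notin> cball 0 r \<Longrightarrow> \<rho> a = 0" for a
    using bump_pos_iff[OF r(1), of 0 a] bump_eq_0[OF r(1), of a 0] by (auto simp: \<rho>_def)
  have \<rho>_int: "integrable lborel \<rho>" unfolding \<rho>_def by (rule integrable_bump[OF r(1)])
  \<comment> \<open>This is the average after the substitution that makes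
    \<open>b = a\<inverse> z\<close> the variable. Here \<open>z\<close> enters only through the
    smooth factor, so differentiation never touches the singularity of \<open>v\<close>.\<close>
  define w where "w z = (\<integral>b. \<rho> (tm z (ti b)) * v b \<partial>lborel)" for z
  have cancel: "tm (ti (tm z (ti b))) z = b" for z b by (simp add: tg.gi_gm tg.assoc)
  have DUI: "Ck 2 UNIV (\<lambda>z. \<integral>b. \<rho> (tm z (ti b)) * v b \<partial>lborel) \<and> (\<forall>bs x. set bs \<subseteq> Basis \<longrightarrow> length bs \<le> 2 \<longrightarrow> x \<in> UNIV \<longrightarrow>
    integrable lborel (\<lambda>b. dpart bs (\<lambda>z. \<rho> (tm z (ti b)) * v b) x) \<and>
    dpart bs (\<lambda>z. \<integral>b. \<rho> (tm z (ti b)) * v b \<partial>lborel) x = (\<integral>b. dpart bs (\<lambda>z. \<rho> (tm z (ti b)) * v b) x \<partial>lborel))"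
  proof (rule Ck_integral)
    have Ck1: "Ck k UNIV (\<lambda>z. \<rho> (tm z (ti b)))" for k b
      by (intro Ck_compose_UNIV[OF _ _ \<rho>_Ck] tg.Ck_gm) auto
    show "Ck 2 UNIV (\<lambda>z. \<rho> (tm z (ti b)) * v b)" for b by (intro Ck_mult Ck1) auto
    show "(\<lambda>b. \<rho> (tm y (ti b)) * v b) \<in> borel_measurable lborel" for y by measurable
    fix bs :: "(real \<times> 'a) list" and x assume bs: "set bs \<subseteq> Basis"
    define J where "J p = \<rho> (tm (fst p) (ti (snd p)))" for p
    have J: "Ck k UNIV J" for k
      unfolding J_def[abs_def]
      by (intro Ck_compose_UNIV[OF _ _ \<rho>_Ck] tg.Ck_gm tg.Ck_gi Ck_fst Ck_snd Ck_ident open_UNIV)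
    let ?G = "dpart (map (\<lambda>b. (b, 0)) bs) J"
    \<comment> \<open>For \<open>z\<close> near \<open>x\<close> the integrand vanishes unless
      \<open>b\<close> has the form \<open>a\<inverse> z\<close> with \<open>a\<close> in the
      support of \<open>\<rho>\<close>; \<open>K\<close> collects all these points.\<close>
    define K where "K = (\<lambda>(a, y). tm (ti a) y) ` (cball 0 r \<times> cball x 1)"
    have "continuous_on (cball 0 r \<times> cball x 1) (\<lambda>p. tm (ti (fst p)) (snd p))"
      by (intro tg.continuous_gm tg.continuous_gi continuous_on_fst continuous_on_snd continuous_on_id)
    then have K: "compact K" unfolding K_def case_prod_unfold
      by (intro compact_continuous_image compact_Times) auto
    have "Ck 0 UNIV ?G" by (rule Ck_dpart[OF J]) (use bs in \<open>auto simp: Basis_prod_def\<close>)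
    then have "continuous_on (cball x 1 \<times> K) ?G" using continuous_on_subset[of UNIV ?G] by simp
    then have "bounded (?G ` (cball x 1 \<times> K))"
      by (intro compact_imp_bounded compact_continuous_image compact_Times K) auto
    then obtain C where "\<forall>p\<in>?G ` (cball x 1 \<times> K). norm p \<le> C" by (auto simp only: bounded_iff)
    then have C: "\<bar>?G (y, b)\<bar> \<le> C" if "y \<in> cball x 1" "b \<in> K" for y b using that by force
    have le: "\<bar>dpart bs (\<lambda>z. \<rho> (tm z (ti b)) * v b) y\<bar> \<le> C * (indicator K b *\<^sub>R \<bar>v b\<bar>)"
      if y: "y \<in> ball x 1" for y b
    proof -
      have eq: "dpart bs (\<lambda>z. \<rho> (tm z (ti b)) * v b) y = dpart bs (\<lambda>z. \<rho> (tm z (ti b))) y * v b"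
        by (rule dpart_mult_const[OF open_UNIV Ck1 bs UNIV_I])
      show ?thesis
      proof (cases "b \<in> K")
        case True
        have "dpart bs (\<lambda>z. \<rho> (tm z (ti b))) y = ?G (y, b)"
          using dpart_slice[OF open_UNIV J bs UNIV_I] by (simp add: J_def)
        then show ?thesis unfolding eq using C[of y b] y True by (simp add: abs_mult mult_right_mono)
      next
        case False
        have "tm z (ti b) \<notin> cball 0 r" if "z \<in> ball x 1" for z
        proof
          assume "tm z (ti b) \<in> cball 0 r"
          then have "(\<lambda>(a, y). tm (ti a) y) (tm z (ti b), z) \<in> K"
            unfolding K_def by (rule_tac imageI) (use that in auto)
          then show False using False cancel[of z b] by simp
        qed
        then have "dpart bs (\<lambda>z. \<rho> (tm z (ti b))) y = dpart bs (\<lambda>z. 0) y"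
          using \<rho>(3) by (intro dpart_cong_open[OF open_ball y]) auto
        then show ?thesis unfolding eq dpart_zero using False by simp
      qed
    qed
    have "integrable lborel (\<lambda>b. C * (indicator K b *\<^sub>R \<bar>v b\<bar>))"
      by (rule weak_kernel_integrable_on[OF v K])
    then show "\<exists>e>0. \<exists>B. integrable lborel B \<and> (\<forall>y\<in>ball x e. \<forall>b\<in>space lborel. \<bar>dpart bs (\<lambda>z. \<rho> (tm z (ti b)) * v b) y\<bar> \<le> B b)"
      using le by (intro exI[of _ 1] conjI exI[of _ "\<lambda>b. C * (indicator K b *\<^sub>R \<bar>v b\<bar>)"]) auto
  qed auto
  have w_Ck: "Ck 2 UNIV w" using DUI by (simp add: w_def[abs_def])
  have w_eq: "w z = (\<integral>a. \<rho> a * v (tm (ti a) z) \<partial>lborel)"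
    and w_int: "integrable lborel (\<lambda>a. \<rho> a * v (tm (ti a) z))" for z
  proof -
    let ?f = "\<lambda>a. \<rho> a * v (tm (ti a) z)"
    have f: "?f \<in> borel_measurable borel" by measurable
    then have g: "(\<lambda>x. ?f (tm z x)) \<in> borel_measurable borel" by measurable
    have eq: "?f (tm z (ti b)) = \<rho> (tm z (ti b)) * v b" for b unfolding cancel ..
    show "w z = (\<integral>a. ?f a \<partial>lborel)"
      using tg.integral_left(1)[OF f, of z] tg.integral_gi(1)[OF g] unfolding eq w_def by simp
    have "integrable lborel (\<lambda>b. \<rho> (tm z (ti b)) * v b)"
      using conjunct2[OF DUI, rule_format, of "[]" z] by simp
    then show "integrable lborel ?f"
      using tg.integral_left(2)[OF f, of z] tg.integral_gi(2)[OF g] unfolding eq by simp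
  qed
  have w_lim: "(w \<longlongrightarrow> 0) at_infinity"
  proof (rule tendstoI)
    fix \<epsilon> :: real assume \<epsilon>: "0 < \<epsilon>"
    define I where "I = (\<integral>a. \<rho> a \<partial>lborel)"
    have I: "0 \<le> I" unfolding I_def using \<rho>(1) by simp
    define \<delta> where "\<delta> = \<epsilon> / (1 + I)"
    have \<delta>: "0 < \<delta>" "I * \<delta> < \<epsilon>" using \<epsilon> I by (auto simp: \<delta>_def field_simps add_pos_nonneg)
    have "\<forall>\<^sub>F y in at_infinity. \<bar>v y\<bar> < \<delta>"
      using tendstoD[OF weak_kernel_lim[OF v] \<delta>(1)] by (simp add: dist_norm)
    then obtain R where R: "\<And>y. R \<le> norm y \<Longrightarrow> \<bar>v y\<bar> < \<delta>"
      unfolding eventually_at_infinity by blast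
    have "continuous_on (cball 0 r \<times> cball 0 R) (\<lambda>p. tm (fst p) (snd p))"
      by (intro tg.continuous_gm continuous_on_fst continuous_on_snd continuous_on_id)
    then have "bounded ((\<lambda>p. tm (fst p) (snd p)) ` (cball 0 r \<times> cball 0 R))"
      by (intro compact_imp_bounded compact_continuous_image compact_Times) auto
    \<comment> \<open>\<open>R'\<close> bounds every product of a point of the support of
      \<open>\<rho>\<close> with a point of norm at most \<open>R\<close>. A point \<open>z\<close>
      of larger norm therefore has all its translates \<open>a\<inverse> z\<close> outside the ball
      of radius \<open>R\<close>, where \<open>v\<close> is small.\<close>
    then obtain R' where R': "\<forall>p\<in>(\<lambda>p. tm (fst p) (snd p)) ` (cball 0 r \<times> cball 0 R). norm p \<le> R'"
      by (auto simp only: bounded_iff)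
    have "\<bar>w z\<bar> < \<epsilon>" if z: "R' + 1 \<le> norm z" for z
    proof -
      have le: "\<bar>\<rho> a * v (tm (ti a) z)\<bar> \<le> \<rho> a * \<delta>" for a
      proof (cases "a \<in> cball 0 r")
        case True
        have "R \<le> norm (tm (ti a) z)"
        proof (rule ccontr)
          assume "\<not> R \<le> norm (tm (ti a) z)"
          then have "(\<lambda>p. tm (fst p) (snd p)) (a, tm (ti a) z) \<in> (\<lambda>p. tm (fst p) (snd p)) ` (cball 0 r \<times> cball 0 R)"
            using True by (intro imageI) auto
          then have "norm z \<le> R'" using R' by fastforce
          then show False using z by simp
        qed
        then have "\<bar>v (tm (ti a) z)\<bar> \<le> \<delta>" using R less_imp_le by blast
        then show ?thesis using \<rho>(1)[of a] by (simp add: abs_mult mult_left_mono)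
      next
        case False
        then show ?thesis using \<rho>(3)[of a] by simp
      qed
      have "\<bar>w z\<bar> \<le> (\<integral>a. \<bar>\<rho> a * v (tm (ti a) z)\<bar> \<partial>lborel)" unfolding w_eq by (rule integral_abs_bound)
      also have "\<dots> \<le> (\<integral>a. \<rho> a * \<delta> \<partial>lborel)"
        by (rule integral_mono'[OF _ le]) (use \<rho>_int \<rho>(1) \<delta>(1) in auto)
      also have "\<dots> = I * \<delta>" by (simp add: I_def)
      finally show ?thesis using \<delta>(2) by simp
    qed
    then show "\<forall>\<^sub>F z in at_infinity. dist (w z) 0 < \<epsilon>"
      unfolding eventually_at_infinity by (auto simp: dist_norm)
  qed
  \<comment> \<open>By Fubini the test of \<open>w\<close> is an average over \<open>a\<close> of
    tests of left translates of \<open>v\<close>. Invariance of the measure and of the operator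
    moves the translation onto \<open>f\<close>, and each test then evaluates \<open>f\<close> at
    \<open>a\<close>.\<close>
  have w_weak: "(\<integral>z. w z * heat_op_adj m Z f z \<partial>lborel) = - c * (\<integral>a. \<rho> a * f a \<partial>lborel)"
    if f: "smooth f" and K: "compact K" "\<And>x. x \<notin> K \<Longrightarrow> f x = 0" for f K
  proof -
    define \<psi> where "\<psi> = heat_op_adj m Z f"
    have f_Ck: "Ck k UNIV f" for k using f by (rule smooth_on_Ck)
    have \<psi>_Ck: "Ck 0 UNIV \<psi>" unfolding \<psi>_def by (rule Ck_heat_op_adj[OF f_Ck])
    have \<psi>_m [measurable]: "\<psi> \<in> borel_measurable borel"
      by (rule borel_measurable_continuous_onI) (rule Ck_continuous[OF \<psi>_Ck])
    have \<psi>0: "x \<notin> K \<Longrightarrow> \<psi> x = 0" for x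
      unfolding \<psi>_def by (rule heat_op_adj_eq_0_outside[OF K]) auto
    obtain C where C: "0 \<le> C" "\<And>x. \<bar>\<psi> x\<bar> \<le> C"
      using bounded_of_compact_support[OF K(1) \<psi>0 continuous_on_subset[OF Ck_continuous[OF \<psi>_Ck]]] by auto
    define g where "g a z = \<rho> a * v (tm (ti a) z) * \<psi> z" for a z
    have fa: "integrable lborel (\<lambda>z. v z * \<psi> (tm a z))" "(\<integral>z. v z * \<psi> (tm a z) \<partial>lborel) = - (c * f a)" for a
    proof -
      have 1: "smooth (\<lambda>z. f (tm a z))"
        unfolding smooth_on_iff_Ck by (intro allI Ck_compose_UNIV[OF _ _ f_Ck] tg.Ck_gm) auto
      have 2: "compact (tm (ti a) ` K)"
        by (intro compact_continuous_image tg.continuous_gm continuous_on_const continuous_on_id K)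
      have 3: "f (tm a x) = 0" if "x \<notin> tm (ti a) ` K" for x
      proof (rule K(2))
        show "tm a x \<notin> K"
        proof
          assume "tm a x \<in> K"
          then have "tm (ti a) (tm a x) \<in> tm (ti a) ` K" by (rule imageI)
          then show False using that by simp
        qed
      qed
      have "\<psi> (tm a z) = heat_op_adj m Z (\<lambda>z. f (tm a z)) z" for z
        unfolding \<psi>_def by (rule heat_op_adj_left[symmetric, OF f_Ck])
      then show "integrable lborel (\<lambda>z. v z * \<psi> (tm a z))" "(\<integral>z. v z * \<psi> (tm a z) \<partial>lborel) = - (c * f a)"
        using weak_kernel_test[OF v 1 2 3] by simp_all
    qed
    have ga: "integrable lborel (\<lambda>z. v (tm (ti a) z) * \<psi> z)"
      "(\<integral>z. v (tm (ti a) z) * \<psi> z \<partial>lborel) = - (c * f a)"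
      "(\<integral>z. \<bar>v (tm (ti a) z) * \<psi> z\<bar> \<partial>lborel) = (\<integral>z. \<bar>v z * \<psi> (tm a z)\<bar> \<partial>lborel)" for a
    proof -
      have m: "(\<lambda>z. v (tm (ti a) z) * \<psi> z) \<in> borel_measurable borel"
        "(\<lambda>z. \<bar>v (tm (ti a) z) * \<psi> z\<bar>) \<in> borel_measurable borel" by measurable
      show "integrable lborel (\<lambda>z. v (tm (ti a) z) * \<psi> z)"
        "(\<integral>z. v (tm (ti a) z) * \<psi> z \<partial>lborel) = - (c * f a)"
        "(\<integral>z. \<bar>v (tm (ti a) z) * \<psi> z\<bar> \<partial>lborel) = (\<integral>z. \<bar>v z * \<psi> (tm a z)\<bar> \<partial>lborel)"
        using tg.integral_left[OF m(1), of a] tg.integral_left[OF m(2), of a] fa[of a] by simp_all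
    qed
    \<comment> \<open>Near the pole \<open>v\<close> is only locally integrable. One compact set
      containing all translates \<open>a\<inverse> K\<close> gives an \<open>L1\<close> bound
      uniform in \<open>a\<close>, which justifies Fubini.\<close>
    define K3 where "K3 = (\<lambda>(a, z). tm (ti a) z) ` (cball 0 r \<times> K)"
    have "continuous_on (cball 0 r \<times> K) (\<lambda>p. tm (ti (fst p)) (snd p))"
      by (intro tg.continuous_gm tg.continuous_gi continuous_on_fst continuous_on_snd continuous_on_id)
    then have K3: "compact K3" unfolding K3_def case_prod_unfold
      by (intro compact_continuous_image compact_Times K) auto
    have K3_int: "integrable lborel (\<lambda>z. C * (indicator K3 z *\<^sub>R \<bar>v z\<bar>))"
      by (rule weak_kernel_integrable_on[OF v K3])
    define I where "I = (\<integral>z. C * (indicator K3 z *\<^sub>R \<bar>v z\<bar>) \<partial>lborel)"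
    have g_bound: "(\<integral>z. \<bar>g a z\<bar> \<partial>lborel) \<le> I * \<rho> a" for a
    proof (cases "a \<in> cball 0 r")
      case True
      have 1: "(\<integral>z. \<bar>g a z\<bar> \<partial>lborel) = \<rho> a * (\<integral>z. \<bar>v z * \<psi> (tm a z)\<bar> \<partial>lborel)"
        using ga(3)[of a] \<rho>(1)[of a] by (simp add: g_def abs_mult mult.assoc)
      have 2: "(\<integral>z. \<bar>v z * \<psi> (tm a z)\<bar> \<partial>lborel) \<le> I"
        unfolding I_def
      proof (rule integral_mono'[OF K3_int])
        fix z
        show "0 \<le> C * (indicator K3 z *\<^sub>R \<bar>v z\<bar>)" using C(1) by simp
        show "\<bar>v z * \<psi> (tm a z)\<bar> \<le> C * (indicator K3 z *\<^sub>R \<bar>v z\<bar>)"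
        proof (cases "tm a z \<in> K")
          case inK: True
          then have "(\<lambda>(a, z). tm (ti a) z) (a, tm a z) \<in> K3"
            unfolding K3_def using True by (intro imageI) auto
          then have "z \<in> K3" by simp
          then show ?thesis using mult_right_mono[OF C(2)[of "tm a z"], of "\<bar>v z\<bar>"]
            by (simp add: abs_mult mult.commute)
        next
          case False
          then show ?thesis using \<psi>0 C(1) by simp
        qed
      qed
      show ?thesis using mult_left_mono[OF 2 \<rho>(1)[of a]] 1 by (simp add: mult.commute)
    next
      case False
      then show ?thesis using \<rho>(3)[of a] by (simp add: g_def)
    qed
    have g_m [measurable]: "case_prod g \<in> borel_measurable (lborel \<Otimes>\<^sub>M lborel)"
    proof -
      have "(\<lambda>p. g (fst p) (snd p)) \<in> borel_measurable (borel \<Otimes>\<^sub>M borel)"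
        unfolding g_def by measurable
      then show ?thesis by (simp add: case_prod_unfold cong: measurable_cong_sets)
    qed
    have g_int: "integrable (lborel \<Otimes>\<^sub>M lborel) (case_prod g)"
    proof (rule lborel_pair.Fubini_integrable[OF g_m])
      show "integrable lborel (\<lambda>a. \<integral>z. norm (case_prod g (a, z)) \<partial>lborel)"
      proof (rule Bochner_Integration.integrable_bound[where f="\<lambda>a. I * \<rho> a"])
        show "(\<lambda>a. \<integral>z. norm (case_prod g (a, z)) \<partial>lborel) \<in> borel_measurable lborel" by measurable
        show "AE a in lborel. norm (\<integral>z. norm (case_prod g (a, z)) \<partial>lborel) \<le> norm (I * \<rho> a)"
          using g_bound by (intro AE_I2) (simp add: order_trans[OF _ abs_ge_self])
      qed (use \<rho>_int in auto)
      show "AE a in lborel. integrable lborel (\<lambda>z. case_prod g (a, z))"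
        using ga(1) by (intro AE_I2) (simp add: g_def mult.assoc)
    qed
    have "(\<integral>z. w z * \<psi> z \<partial>lborel) = (\<integral>z. (\<integral>a. g a z \<partial>lborel) \<partial>lborel)"
      unfolding w_eq g_def by simp
    also have "\<dots> = (\<integral>a. (\<integral>z. g a z \<partial>lborel) \<partial>lborel)"
      by (rule lborel_pair.Fubini_integral[OF g_int])
    also have "\<dots> = (\<integral>a. - c * (\<rho> a * f a) \<partial>lborel)"
      using ga(2) by (simp add: g_def mult.assoc mult.left_commute)
    finally show ?thesis by (simp add: \<psi>_def)
  qed
  \<comment> \<open>Since \<open>w\<close> is of class C2, integration by parts returns the operator
    to \<open>w\<close>, and continuity makes the weak identity pointwise, including at the
    pole.\<close>
  have H: "heat_op m Z w z + c * \<rho> z = 0" for z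
  proof (rule eq_0_of_test_functions[where S=UNIV and f="\<lambda>z. heat_op m Z w z + c * \<rho> z" and x=z])
    have Hw: "Ck 0 UNIV (heat_op m Z w)"
      by (rule Ck_heat_op(2)) (use w_Ck smooth_Z in \<open>auto simp: numeral_2_eq_2\<close>)
    then show "continuous_on UNIV (\<lambda>z. heat_op m Z w z + c * \<rho> z)"
      using Ck_continuous[OF \<rho>_Ck] by (intro continuous_intros) auto
    fix f :: "real \<times> 'a \<Rightarrow> real" and K :: "(real \<times> 'a) set"
    assume f: "smooth f" and K: "compact K" "\<And>x. x \<notin> K \<Longrightarrow> f x = 0"
    have fc: "continuous_on K f" by (rule continuous_on_subset[OF Ck_continuous[OF smooth_on_Ck[OF f, of 0]]]) simp
    have i1: "integrable lborel (\<lambda>z. heat_op m Z w z * f z)"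
      by (rule integrable_compact_support[OF K(1)])
        (use K Hw fc in \<open>auto intro!: continuous_on_mult intro: continuous_on_subset\<close>)
    have i2: "integrable lborel (\<lambda>z. \<rho> z * f z)"
      by (rule integrable_compact_support[OF K(1)])
        (use K fc continuous_on_subset[OF Ck_continuous[OF \<rho>_Ck[of 0]], of K] in \<open>auto intro!: continuous_on_mult\<close>)
    have "(\<integral>z. heat_op m Z w z * f z \<partial>lborel) = (\<integral>z. w z * heat_op_adj m Z f z \<partial>lborel)"
      by (rule integral_heat_op_adj[symmetric, OF open_UNIV w_Ck smooth_Z smooth_on_Ck[OF f] K(1) subset_UNIV K(2)])
    also have "\<dots> = - c * (\<integral>a. \<rho> a * f a \<partial>lborel)" by (rule w_weak[OF f K])
    finally show "(\<integral>z. (heat_op m Z w z + c * \<rho> z) * f z \<partial>lborel) = 0"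
      using i1 i2 by (simp add: distrib_right mult.assoc)
  qed auto
  have "0 \<le> w z0"
  proof (rule heat_max_principle_at_infinity[OF open_UNIV subset_UNIV w_Ck smooth_Z _ w_lim order_refl])
    show "heat_op m Z w z \<le> 0" for z using H[of z] c \<rho>(1)[of z] by (smt (verit) mult_nonneg_nonneg)
  qed
  let ?f = "\<lambda>a. - (\<rho> a * v (tm (ti a) z0))"
  have f_nn: "0 \<le> ?f a" for a
  proof (cases "a \<in> ball 0 r")
    case True
    then show ?thesis using r(2)[OF True] \<rho>(1)[of a] by (simp add: mult_nonneg_nonpos)
  next
    case False
    then show ?thesis using bump_eq_0[OF r(1) False] by (simp add: \<rho>_def)
  qed
  \<comment> \<open>The integral of the nonnegative \<open>?f\<close> is \<open>- w z0\<close>,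
    hence at most 0. So \<open>?f\<close> vanishes almost everywhere, although it is positive on a
    ball.\<close>
  have "(\<integral>a. ?f a \<partial>lborel) = 0"
    using \<open>0 \<le> w z0\<close> Bochner_Integration.integral_nonneg[of lborel ?f] f_nn by (simp add: w_eq)
  then have "AE a in lborel. ?f a = 0"
    using integral_nonneg_eq_0_iff_AE[of lborel ?f] w_int f_nn by simp
  then have "AE a in lborel. a \<notin> ball (0::real \<times> 'a) r"
  proof eventually_elim
    case (elim a)
    then show ?case using r(2)[of a] \<rho>(2)[of a] by (cases "a \<in> ball 0 r") auto
  qed
  then show False using not_AE_notin_ball[OF r(1)] by blast
qed

end

section \<open>Homogeneity and decay of the heat kernel\<close>

lemma hdim_Pair: "hdim (\<omega>, \<omega>') = hdim \<omega> + hdim \<omega>'"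
proof -
  have "(\<Sum>b\<in>(\<lambda>u. (u, 0)) ` Basis. (\<omega>, \<omega>') \<bullet> b) = hdim \<omega>"
    by (subst sum.reindex) (auto simp: hdim_def inj_on_def)
  moreover have "(\<Sum>b\<in>(\<lambda>v. (0, v)) ` Basis. (\<omega>, \<omega>') \<bullet> b) = hdim \<omega>'"
    by (subst sum.reindex) (auto simp: hdim_def inj_on_def)
  ultimately show ?thesis
    unfolding hdim_def[of "(\<omega>, \<omega>')"] Basis_prod_def
    by (subst sum.union_disjoint) (auto simp: finite_imageI)
qed

lemma hdim_real: "hdim (x::real) = x"
  by (simp add: hdim_def)

lemma filterlim_dl_at_infinity:
  fixes \<omega> :: "'a::euclidean_space"
  assumes "0 < r"
  shows "filterlim (dl \<omega> r) at_infinity at_infinity"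
proof -
  obtain K where K: "0 < K" "\<And>y. norm (dl \<omega> (1 / r) y) \<le> norm y * K"
    using bounded_linear.pos_bounded[OF bounded_linear_dl[of \<omega> "1 / r"]] by blast
  have le: "norm x \<le> norm (dl \<omega> r x) * K" for x
    using K(2)[of "dl \<omega> r x"] assms by (simp add: dl_inverse)
  show ?thesis
    unfolding filterlim_at_infinity[OF order_refl] eventually_at_infinity
  proof (intro allI impI)
    fix R :: real assume "0 < R"
    have "R \<le> norm (dl \<omega> r x)" if "R * K \<le> norm x" for x
      using order_trans[OF that le] K(1) by simp
    then show "\<exists>b. \<forall>x. b \<le> norm x \<longrightarrow> R \<le> norm (dl \<omega> r x)" by blast
  qed
qed

lemma dpart_homogeneous:
  fixes f :: "'a::euclidean_space \<Rightarrow> real"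
  assumes S: "open S" "\<And>p. p \<in> S \<Longrightarrow> dl \<Omega> r p \<in> S" and r: "0 < r"
    and f: "\<And>k. Ck k S f" and hom: "\<And>p. p \<in> S \<Longrightarrow> f (dl \<Omega> r p) = r powr d * f p"
    and bs: "set bs \<subseteq> Basis" and p: "p \<in> S"
  shows "dpart bs f (dl \<Omega> r p) = r powr (d - (\<Sum>b\<leftarrow>bs. \<Omega> \<bullet> b)) * dpart bs f p"
  using bs p
proof (induction bs arbitrary: p)
  case Nil
  then show ?case using hom by simp
next
  case (Cons b bs)
  let ?g = "dpart bs f" and ?d = "d - (\<Sum>b\<leftarrow>bs. \<Omega> \<bullet> b)"
  have gd: "?g differentiable (at q)" if "q \<in> S" for q
    by (rule Ck_differentiable[where k=1, OF Ck_dpart[OF f]]) (use Cons.prems that in auto)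
  have "((\<lambda>q. ?g (dl \<Omega> r q)) has_derivative (\<lambda>h. frechet_derivative ?g (at (dl \<Omega> r p)) (dl \<Omega> r h))) (at p)"
    using diff_chain_at[OF bounded_linear_imp_has_derivative[OF bounded_linear_dl] frechet_derivative_worksI[OF gd[OF S(2)[OF Cons.prems(2)]]]]
    by (simp add: o_def)
  from has_derivative_pd[OF this, of b]
  have "pd b (\<lambda>q. ?g (dl \<Omega> r q)) p = r powr (\<Omega> \<bullet> b) * pd b ?g (dl \<Omega> r p)"
    using Cons.prems linear_scale[OF linear_frechet_derivative[OF gd[OF S(2)[OF Cons.prems(2)]]]]
    by (simp add: dl_Basis pd_def)
  moreover have "pd b (\<lambda>q. ?g (dl \<Omega> r q)) p = pd b (\<lambda>q. r powr ?d * ?g q) p"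
    using Cons by (intro pd_cong_open[OF S(1)]) auto
  moreover have "pd b (\<lambda>q. r powr ?d * ?g q) p = r powr ?d * pd b ?g p"
    using has_derivative_pd[OF has_derivative_mult_right[OF frechet_derivative_worksI[OF gd[OF Cons.prems(2)]]]]
    by (simp add: pd_def)
  ultimately have "r powr (\<Omega> \<bullet> b) * pd b ?g (dl \<Omega> r p) = r powr ?d * pd b ?g p" by simp
  then have "pd b ?g (dl \<Omega> r p) = r powr ?d / r powr (\<Omega> \<bullet> b) * pd b ?g p"
    using r by (simp add: nonzero_eq_divide_eq mult.commute)
  moreover have "r powr (d - (\<Sum>b\<leftarrow>b # bs. \<Omega> \<bullet> b)) = r powr ?d / r powr (\<Omega> \<bullet> b)"
    by (simp add: powr_diff[symmetric] algebra_simps)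
  ultimately show ?case by simp
qed

locale heat_kernel = heat_group \<omega> gm gi m Z
  for \<omega> :: "'a::euclidean_space" and gm gi m Z +
  fixes \<gamma> :: "real \<times> 'a \<Rightarrow> real"
  assumes kernel: "weak_kernel 1 \<gamma>"
begin

abbreviation "Q \<equiv> hdim \<omega>"

lemma hdim_time: "hdim (2::real, \<omega>) = Q + 2"
  by (simp add: hdim_Pair hdim_real)

lemma Q_nonneg: "0 \<le> Q"
  unfolding hdim_def using weight_ge_1 by (intro sum_nonneg) (use less_eq_real_def weight_pos in auto)

lemma kernel_measurable [measurable]: "\<gamma> \<in> borel_measurable borel"
  by (rule weak_kernel_measurable[OF kernel])

lemma kernel_nonneg: "z \<noteq> 0 \<Longrightarrow> 0 \<le> \<gamma> z"
  by (rule weak_kernel_nonneg[OF kernel]) auto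

text \<open>Rescaling space-time contributes \<open>r powr (Q + 2)\<close> and the operator
  contributes \<open>r\<^sup>2\<close>, so the factor \<open>r powr Q\<close> keeps the strength
  \<open>c\<close> unchanged.\<close>

lemma weak_kernel_dl:
  assumes v: "weak_kernel c v" and r: "0 < r"
  shows "weak_kernel c (\<lambda>z. r powr Q * v (D r z))"
  unfolding weak_kernel_def
proof (intro conjI allI impI; (elim conjE)?)
  have v_m [measurable]: "v \<in> borel_measurable borel" by (rule weak_kernel_measurable[OF v])
  fix K :: "(real \<times> 'a) set" assume K: "compact K"
  let ?f = "\<lambda>y. indicator (D r ` K) y *\<^sub>R v y"
  have K': "compact (D r ` K)"
    by (intro compact_continuous_image linear_continuous_on bounded_linear_dl K)
  then have K'_m [measurable]: "D r ` K \<in> sets borel" by (rule borel_compact)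
  have "integrable lborel ?f" using v K' by (simp add: weak_kernel_def set_integrable_def)
  moreover have "?f \<in> borel_measurable borel" by measurable
  ultimately have "integrable lborel (\<lambda>z. ?f (D r z))"
    using integrable_dl_iff[of ?f r "(2, \<omega>)"] r by blast
  moreover have "indicator (D r ` K) (D r z) = (indicator K z :: real)" for z
  proof -
    have "inj (D r)" using dl_inverse(2)[OF r] by (metis injI)
    then show ?thesis using inj_image_mem_iff[of "D r" z K] by (simp add: indicator_def)
  qed
  ultimately have "integrable lborel (\<lambda>z. r powr Q * (indicator K z *\<^sub>R v (D r z)))" by simp
  then show "set_integrable lborel K (\<lambda>z. r powr Q * v (D r z))"
    by (simp add: set_integrable_def mult.left_commute)
next
  show "smooth_on (UNIV - {0}) (\<lambda>z. r powr Q * v (D r z))"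
    unfolding smooth_on_iff_Ck Compl_eq_Diff_UNIV[symmetric]
  proof (intro allI Ck_cmult)
    show "Ck k (- {0}) (\<lambda>z. v (D r z))" for k
      by (rule Ck_compose[of _ "- {0}", OF _ _ _ _ weak_kernel_Ck[OF v]])
        (use r in \<open>auto intro!: Ck_linear bounded_linear_dl simp: dl_eq_0_iff\<close>)
  qed auto
  have "((\<lambda>z. v (D r z)) \<longlongrightarrow> 0) at_infinity"
    by (rule filterlim_compose[OF weak_kernel_lim[OF v] filterlim_dl_at_infinity[OF r]])
  from tendsto_mult_left[OF this, of "r powr Q"]
  show "((\<lambda>z. r powr Q * v (D r z)) \<longlongrightarrow> 0) at_infinity" by simp
next
  fix \<phi> :: "real \<times> 'a \<Rightarrow> real" assume \<phi>: "smooth \<phi>" "bounded {z. \<phi> z \<noteq> 0}"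
  have v_m [measurable]: "v \<in> borel_measurable borel" by (rule weak_kernel_measurable[OF v])
  have \<phi>_Ck: "Ck k UNIV \<phi>" for k by (rule smooth_on_Ck[OF \<phi>(1)])
  have [measurable]: "heat_op_adj m Z \<phi> \<in> borel_measurable borel"
    by (rule borel_measurable_continuous_onI) (rule Ck_continuous[OF Ck_heat_op_adj[OF \<phi>_Ck, of 0]])
  let ?f = "\<lambda>y. v y * heat_op_adj m Z \<phi> (D (1 / r) y)"
  have f_m: "?f \<in> borel_measurable borel" by measurable
  let ?\<phi> = "\<lambda>y. \<phi> (D (1 / r) y)"
  have eq: "heat_op_adj m Z \<phi> (D (1 / r) y) = r\<^sup>2 * heat_op_adj m Z ?\<phi> y" for y
    using heat_op_adj_dl[OF \<phi>_Ck, of "1 / r" y] r by (simp add: field_simps)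
  have "smooth ?\<phi>"
    unfolding smooth_on_iff_Ck by (intro allI Ck_compose_UNIV[OF _ _ \<phi>_Ck] Ck_linear bounded_linear_dl) auto
  moreover have "bounded {z. ?\<phi> z \<noteq> 0}"
  proof (rule bounded_subset)
    show "bounded (D r ` {z. \<phi> z \<noteq> 0})"
      by (rule bounded_linear_image[OF \<phi>(2) bounded_linear_dl])
    show "{z. ?\<phi> z \<noteq> 0} \<subseteq> D r ` {z. \<phi> z \<noteq> 0}"
    proof
      fix z assume "z \<in> {z. ?\<phi> z \<noteq> 0}"
      then show "z \<in> D r ` {z. \<phi> z \<noteq> 0}"
        using dl_inverse(1)[OF r, of "(2, \<omega>)" z] by (intro image_eqI[of _ _ "D (1 / r) z"]) auto
    qed
  qed
  ultimately have "integrable lborel (\<lambda>z. v z * heat_op_adj m Z ?\<phi> z)"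
    "(LINT z|lborel. v z * heat_op_adj m Z ?\<phi> z) = - (c * \<phi> 0)"
    using v by (auto simp: weak_kernel_def)
  then have f: "integrable lborel ?f" "(\<integral>y. ?f y \<partial>lborel) = - (r\<^sup>2 * (c * \<phi> 0))"
    unfolding eq by (simp_all add: mult.left_commute[of _ "r\<^sup>2"])
  have fD: "?f (D r z) = v (D r z) * heat_op_adj m Z \<phi> z" for z using r by (simp add: dl_inverse)
  have 1: "integrable lborel (\<lambda>z. v (D r z) * heat_op_adj m Z \<phi> z)"
    using integrable_dl_iff[OF f_m r, of "(2, \<omega>)"] f(1) unfolding fD by blast
  have "- (r\<^sup>2 * (c * \<phi> 0)) = r powr (Q + 2) * (\<integral>z. v (D r z) * heat_op_adj m Z \<phi> z \<partial>lborel)"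
    using integral_dl[OF f_m r, of "(2, \<omega>)"] f(2) unfolding fD hdim_time by simp
  also have "\<dots> = r\<^sup>2 * (r powr Q * (\<integral>z. v (D r z) * heat_op_adj m Z \<phi> z \<partial>lborel))"
    using r by (simp add: powr_add powr_numeral)
  finally have "r\<^sup>2 * - (c * \<phi> 0) = r\<^sup>2 * (r powr Q * (\<integral>z. v (D r z) * heat_op_adj m Z \<phi> z \<partial>lborel))" by simp
  then have 2: "r powr Q * (\<integral>z. v (D r z) * heat_op_adj m Z \<phi> z \<partial>lborel) = - (c * \<phi> 0)"
    unfolding mult_cancel_left using r by auto
  show "integrable lborel (\<lambda>z. r powr Q * v (D r z) * heat_op_adj m Z \<phi> z)"
    using integrable_mult_right[of "r powr Q", OF 1] by (simp add: mult.assoc)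
  show "(LINT z|lborel. r powr Q * v (D r z) * heat_op_adj m Z \<phi> z) = - (c * \<phi> 0)"
    using 2 by (simp add: mult.assoc)
qed

text \<open>The rescaled kernel has the same strength as \<open>\<gamma>\<close>. Their difference
  and its negative both have strength 0, so both are nonnegative, and the two kernels agree off the
  pole.\<close>

lemma kernel_dl:
  assumes r: "0 < r" and z: "z \<noteq> 0"
  shows "\<gamma> (D r z) = r powr (- Q) * \<gamma> z"
proof -
  note k' = weak_kernel_dl[OF kernel r]
  have "weak_kernel 0 (\<lambda>z. 1 * (r powr Q * \<gamma> (D r z)) + (- 1) * \<gamma> z)"
    using weak_kernel_linear[OF k' kernel, of 1 "- 1"] by simp
  from weak_kernel_nonneg[OF this _ z] have 1: "\<gamma> z \<le> r powr Q * \<gamma> (D r z)" by simp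
  have "weak_kernel 0 (\<lambda>z. (- 1) * (r powr Q * \<gamma> (D r z)) + 1 * \<gamma> z)"
    using weak_kernel_linear[OF k' kernel, of "- 1" 1] by simp
  from weak_kernel_nonneg[OF this _ z] have "r powr Q * \<gamma> (D r z) \<le> \<gamma> z" by simp
  with 1 have "r powr Q * \<gamma> (D r z) = \<gamma> z" by simp
  then show ?thesis using r by (simp add: powr_minus field_simps)
qed

text \<open>The half-space of times up to \<open>fst z\<close> misses the pole, so there both
  \<open>\<gamma>\<close> and \<open>- \<gamma>\<close> are solutions that vanish at infinity. The
  maximum principle for \<open>- \<gamma>\<close> complements the positivity of
  \<open>\<gamma>\<close>. The term \<open>0 * \<gamma> z\<close> only fits the shape of
  \<open>weak_kernel_linear\<close>.\<close>

lemma kernel_neg_time: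
  assumes "fst z < 0"
  shows "\<gamma> z = 0"
proof -
  let ?v = "\<lambda>z. (- 1) * \<gamma> z + 0 * \<gamma> z"
  have v: "weak_kernel (- 1) ?v"
    using weak_kernel_linear[OF kernel kernel, of "- 1" 0] by simp
  have S: "open {z :: real \<times> 'a. fst z < 0}" by (intro open_Collect_less continuous_intros)
  have "0 \<le> ?v z"
  proof (rule heat_max_principle_at_infinity[OF S _ _ smooth_Z _ weak_kernel_lim[OF v] order_refl])
    show "Ck 2 {z. fst z < 0} ?v" by (rule Ck_subset[OF weak_kernel_Ck[OF v]]) auto
    show "heat_op m Z ?v y \<le> 0" if "fst y \<le> fst z" for y
    proof -
      have "y \<noteq> 0" using that assms by auto
      then show ?thesis using weak_kernel_heat_eq[OF v] by simp
    qed
  qed (use assms in auto)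
  moreover have "0 \<le> \<gamma> z" using assms by (intro kernel_nonneg) auto
  ultimately show ?thesis by simp
qed

text \<open>The kernel at time \<open>t\<close> and point \<open>g\<inverse> w\<close>, as a
  function of everything jointly. The pole \<open>g\<close> is kept as a variable because
  derivatives in \<open>(t, w)\<close> must be estimated uniformly over all
  \<open>g\<close>.\<close>

definition cvk :: "(real \<times> 'a) \<times> 'a \<Rightarrow> real" where
  "cvk p = \<gamma> (fst (fst p), gm (gi (snd p)) (snd (fst p)))"

definition cvk_dom :: "((real \<times> 'a) \<times> 'a) set" where
  "cvk_dom = {p. fst (fst p) \<noteq> 0 \<or> snd (fst p) \<noteq> snd p}"

lemma gi_gm_eq_0_iff: "gm (gi g) w = 0 \<longleftrightarrow> w = g"
  by (metis gm_gi_cancel left_inv right_zero)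

lemma open_cvk_dom: "open cvk_dom"
proof -
  have "open ({p :: (real \<times> 'a) \<times> 'a. fst (fst p) \<noteq> 0} \<union> {p. snd (fst p) \<noteq> snd p})"
    by (intro open_Un open_Collect_neq continuous_intros)
  then show ?thesis unfolding cvk_dom_def Collect_disj_eq .
qed

lemma Ck_cvk: "Ck k cvk_dom cvk"
  unfolding cvk_def[abs_def]
proof (rule Ck_compose[of _ "- {0}", OF open_cvk_dom _ _ _ weak_kernel_Ck[OF kernel]])
  show "Ck k cvk_dom (\<lambda>p. (fst (fst p), gm (gi (snd p)) (snd (fst p))))"
    by (intro Ck_Pair Ck_gm Ck_gi Ck_fst Ck_snd Ck_ident open_cvk_dom)
qed (auto simp: cvk_dom_def zero_prod_def gi_gm_eq_0_iff)

abbreviation "\<Omega> \<equiv> ((2::real, \<omega>), \<omega>)"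

lemma dl_\<Omega>: "0 < r \<Longrightarrow> dl \<Omega> r ((t, w), g) = ((r\<^sup>2 * t, dl \<omega> r w), dl \<omega> r g)"
  by (simp add: dl_Pair[of "(2, \<omega>)"] D_pair)

lemma cvk_dom_dl: "0 < r \<Longrightarrow> p \<in> cvk_dom \<Longrightarrow> dl \<Omega> r p \<in> cvk_dom"
  by (cases p; cases "fst p") (auto simp: dl_\<Omega> cvk_dom_def, metis dl_inverse(2))

lemma cvk_dl: "0 < r \<Longrightarrow> p \<in> cvk_dom \<Longrightarrow> cvk (dl \<Omega> r p) = r powr (- Q) * cvk p"
  using kernel_dl[of r "(fst (fst p), gm (gi (snd p)) (snd (fst p)))"]
  by (cases p; cases "fst p")
    (auto simp: dl_\<Omega> cvk_def cvk_dom_def D_pair dl_gm dl_gi zero_prod_def gi_gm_eq_0_iff)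

lemma dpart_cvk_dl:
  assumes "0 < r" "set bs \<subseteq> Basis" "p \<in> cvk_dom"
  shows "dpart bs cvk (dl \<Omega> r p) = r powr (- Q - (\<Sum>b\<leftarrow>bs. \<Omega> \<bullet> b)) * dpart bs cvk p"
  by (rule dpart_homogeneous[OF open_cvk_dom cvk_dom_dl _ Ck_cvk cvk_dl]) (use assms in auto)

lemma dpart_cvk_neg:
  assumes "fst (fst p) < 0"
  shows "dpart bs cvk p = 0"
proof -
  have "open {p :: (real \<times> 'a) \<times> 'a. fst (fst p) < 0}" by (intro open_Collect_less continuous_intros)
  then have "dpart bs cvk p = dpart bs (\<lambda>_. 0) p"
    by (rule dpart_cong_open) (use assms kernel_neg_time in \<open>auto simp: cvk_def\<close>)
  then show ?thesis by (simp add: dpart_zero)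
qed

text \<open>Every derivative of \<open>cvk\<close> vanishes at negative times and hence, by
  continuity, at time 0, since \<open>norm w \<le> 1 / 2\<close> and \<open>1 \<le> norm g\<close>
  keep the point away from the pole. The mean value theorem in time then gives the factor
  \<open>t\<close>; the constant is uniform because the region is compact.\<close>

lemma dpart_cvk_linear_in_time:
  assumes bs: "set bs \<subseteq> Basis"
  shows "\<exists>C\<ge>0. \<forall>t w g. 0 \<le> t \<longrightarrow> t \<le> 1 \<longrightarrow> norm w \<le> 1 / 2 \<longrightarrow> 1 \<le> norm g \<longrightarrow> norm g \<le> L \<longrightarrow>
    \<bar>dpart bs cvk ((t, w), g)\<bar> \<le> C * t"
proof -
  let ?e = "((1, 0), 0) :: (real \<times> 'a) \<times> 'a"
  let ?G = "dpart bs cvk"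
  have G: "Ck 1 cvk_dom ?G" by (rule Ck_dpart[OF Ck_cvk bs]) auto
  have e: "?e \<in> Basis" by (simp add: Basis_prod_def)
  have G': "Ck 0 cvk_dom (pd ?e ?G)" by (rule Ck_pd_less[OF G _ e]) simp
  let ?K = "({0..1::real} \<times> cball (0::'a) (1/2)) \<times> (cball (0::'a) L - ball 0 1)"
  have K: "compact ?K" by (intro compact_Times compact_diff) auto
  have K_dom: "?K \<subseteq> cvk_dom" by (auto simp: cvk_dom_def)
  have "bounded (pd ?e ?G ` ?K)"
    using G' K K_dom by (intro compact_imp_bounded compact_continuous_image) (auto intro: continuous_on_subset)
  then obtain C where "\<forall>p\<in>pd ?e ?G ` ?K. norm p \<le> C" by (auto simp only: bounded_iff)
  then have C: "\<bar>pd ?e ?G p\<bar> \<le> C" if "p \<in> ?K" for p using that by force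
  show ?thesis
  proof (intro exI[of _ "\<bar>C\<bar>"] conjI allI impI)
    fix t :: real and w g :: 'a
    assume tw: "0 \<le> t" "t \<le> 1" "norm w \<le> 1 / 2" "1 \<le> norm g" "norm g \<le> L"
    have dom: "((s, w), g) \<in> cvk_dom" for s using tw by (auto simp: cvk_dom_def)
    have der: "((\<lambda>s. ?G ((s, w), g)) has_real_derivative pd ?e ?G ((s, w), g)) (at s)" for s
    proof -
      note Gd = Ck_differentiable[OF G zero_less_one dom[of s]]
      have "((\<lambda>s. ?G ((s, w), g)) has_derivative (\<lambda>h. frechet_derivative ?G (at ((s, w), g)) ((h, 0), 0))) (at s)"
        by (rule has_derivative_compose[where f="\<lambda>s. ((s, w), g)" and g="?G", OF _ frechet_derivative_worksI[OF Gd]])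
          (auto intro!: derivative_eq_intros)
      moreover have "frechet_derivative ?G (at ((s, w), g)) ((h, 0), 0) = pd ?e ?G ((s, w), g) * h" for h
        using linear_scale[OF linear_frechet_derivative[OF Gd], of h ?e] by (simp add: pd_def)
      ultimately show ?thesis by (simp only: has_field_derivative_def)
    qed
    have "isCont (\<lambda>s. ?G ((s, w), g)) 0" by (rule DERIV_isCont[OF der])
    then have "((\<lambda>s. ?G ((s, w), g)) \<longlongrightarrow> ?G ((0, w), g)) (at_left 0)"
      unfolding isCont_def by (rule filterlim_mono) (auto simp: at_le)
    moreover have "((\<lambda>s. ?G ((s, w), g)) \<longlongrightarrow> 0) (at_left 0)"
      by (rule tendsto_eventually) (auto simp: eventually_at_left[of "-1" 0] dpart_cvk_neg intro!: exI[of _ "-1"])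
    ultimately have 0: "?G ((0, w), g) = 0" using tendsto_unique[OF trivial_limit_at_left_real] by blast
    show "\<bar>?G ((t, w), g)\<bar> \<le> \<bar>C\<bar> * t"
    proof (cases "t = 0")
      case False
      then obtain s where s: "0 < s" "s < t" "?G ((t, w), g) - ?G ((0, w), g) = (t - 0) * pd ?e ?G ((s, w), g)"
        using MVT2[of 0 t "\<lambda>s. ?G ((s, w), g)" "\<lambda>s. pd ?e ?G ((s, w), g)"] der tw(1) by auto
      then have "((s, w), g) \<in> ?K" using tw by auto
      then show ?thesis using C[of "((s, w), g)"] s(3) 0 tw(1)
          mult_left_mono[of "\<bar>pd ?e ?G ((s, w), g)\<bar>" "\<bar>C\<bar>" t]
        by (simp add: abs_mult mult.commute)
    qed (use 0 in simp)
  qed simp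
qed

text \<open>Comparable to the minimum of 1 and the power -(Q + 1) of a homogeneous norm, but written as a
  dyadic sum so that its integrability needs only the scaling of Lebesgue measure.\<close>

definition majorant :: "'a \<Rightarrow> real" where
  "majorant g = (\<Sum>k. (2 powr - (Q + 1)) ^ k * indicator (dl \<omega> (1 / 2 ^ Suc k) -` ball 0 1) g)"

lemma power_powr_2: "(2 ^ k) powr a = (2 powr a) ^ k" for a :: real
  by (induction k) (simp_all add: powr_mult)

lemma half_lt: "2 powr - (Q + 1) \<le> 1 / 2" "0 < 2 powr - (Q + 1)"
proof -
  have "2 powr - (Q + 1) \<le> 2 powr - 1" using Q_nonneg by (intro powr_mono) auto
  then show "2 powr - (Q + 1) \<le> 1 / 2" by (simp add: powr_minus)
qed simp

lemma majorant_summable: "summable (\<lambda>k. (2 powr - (Q + 1)) ^ k * indicator (dl \<omega> (1 / 2 ^ Suc k) -` ball 0 1) (g::'a))"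
proof (rule summable_comparison_test')
  show "summable (\<lambda>k. (2 powr - (Q + 1)) ^ k)" using half_lt by (intro summable_geometric) auto
qed (auto simp: indicator_def)

lemma majorant_ge:
  assumes "dl \<omega> (1 / 2 ^ Suc k) g \<in> ball 0 1"
  shows "(2 powr - (Q + 1)) ^ k \<le> majorant g"
proof -
  define f where "f j = (2 powr - (Q + 1)) ^ j * indicator (dl \<omega> (1 / 2 ^ Suc j) -` ball 0 1) g" for j
  have "sum f {k} \<le> suminf f"
    using majorant_summable by (intro sum_le_suminf) (auto simp: f_def[abs_def])
  then have "f k \<le> suminf f" by simp
  moreover have "f k = (2 powr - (Q + 1)) ^ k" using assms by (simp add: f_def)
  moreover have "suminf f = majorant g" by (simp only: majorant_def f_def[abs_def])
  ultimately show ?thesis by simp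
qed

text \<open>The k-th dilated ball has measure proportional to \<open>(2 powr Q) ^ k\<close> and
  carries the weight \<open>(2 powr - (Q + 1)) ^ k\<close>, so the integrals form a geometric series
  of ratio 1/2.\<close>

lemma majorant_integrable: "integrable lborel majorant"
  unfolding majorant_def[abs_def]
proof (rule integrable_suminf)
  let ?B = "\<lambda>k. dl \<omega> (1 / 2 ^ Suc k) -` ball (0::'a) 1"
  have B_m [measurable]: "?B k \<in> sets borel" for k
    using measurable_sets_borel[OF dl_measurable, of "ball 0 1"] by simp
  have B: "integrable lborel (indicator (?B k) :: 'a \<Rightarrow> real)"
    "(\<integral>g. indicator (?B k) g \<partial>lborel) = (2 ^ Suc k) powr Q * measure lborel (ball (0::'a) 1)" for k
  proof -
    let ?i = "indicator (ball (0::'a) 1) :: 'a \<Rightarrow> real"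
    have i: "?i \<in> borel_measurable borel" by (rule borel_measurable_indicator) simp
    have eq: "?i (dl \<omega> (1 / 2 ^ Suc k) g) = indicator (?B k) g" for g by (simp add: indicator_def)
    have "integrable lborel ?i" by (intro integrable_real_indicator emeasure_lborel_ball_finite) auto
    then show "integrable lborel (indicator (?B k) :: 'a \<Rightarrow> real)"
      using integrable_dl_iff[OF i, of "1 / 2 ^ Suc k" \<omega>] unfolding eq by simp
    have "measure lborel (ball (0::'a) 1) = (1 / 2 ^ Suc k) powr Q * (\<integral>g. indicator (?B k) g \<partial>lborel)"
      using integral_dl[OF i, of "1 / 2 ^ Suc k" \<omega>] unfolding eq by simp
    moreover have "(1 / 2 ^ Suc k) powr Q = 1 / (2 ^ Suc k) powr Q" by (simp add: powr_divide)
    ultimately show "(\<integral>g. indicator (?B k) g \<partial>lborel) = (2 ^ Suc k) powr Q * measure lborel (ball (0::'a) 1)"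
      by (simp add: field_simps)
  qed
  show "integrable lborel (\<lambda>g. (2 powr - (Q + 1)) ^ k * indicator (?B k) g)" for k
    by (intro integrable_mult_right B)
  show "AE g in lborel. summable (\<lambda>k. norm ((2 powr - (Q + 1)) ^ k * indicator (?B k) g :: real))"
    using majorant_summable by (intro AE_I2) (simp add: abs_mult)
  have "(\<integral>g. norm ((2 powr - (Q + 1)) ^ k * indicator (?B k) g :: real) \<partial>lborel) =
      (1 / 2) ^ k * (2 powr Q * measure lborel (ball (0::'a) 1))" for k
  proof -
    have p: "(2 ^ Suc k :: real) powr Q = 2 powr Q * (2 powr Q) ^ k"
      by (simp add: powr_mult power_powr_2)
    have "2 powr - (Q + 1) * 2 powr Q = (2 powr - 1 :: real)" by (simp add: powr_add[symmetric])
    then have h: "2 powr - (Q + 1) * 2 powr Q = (1 / 2 :: real)" by (simp add: powr_minus)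
    have "(\<integral>g. norm ((2 powr - (Q + 1)) ^ k * indicator (?B k) g :: real) \<partial>lborel) =
      (2 powr - (Q + 1)) ^ k * ((2 ^ Suc k) powr Q * measure lborel (ball (0::'a) 1))"
      unfolding B(2)[symmetric] by (simp add: abs_mult)
    also have "\<dots> = (2 powr - (Q + 1) * 2 powr Q) ^ k * (2 powr Q * measure lborel (ball (0::'a) 1))"
      unfolding p by (simp add: power_mult_distrib)
    finally show ?thesis unfolding h .
  qed
  then show "summable (\<lambda>k. \<integral>g. norm ((2 powr - (Q + 1)) ^ k * indicator (?B k) g :: real) \<partial>lborel)"
    by (simp add: summable_mult2 summable_geometric)
qed

text \<open>All weights are at least 1, so repeated halving brings \<open>g\<close> into the unit
  ball; \<open>k\<close> is one less than the first exponent that does so.\<close>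

lemma dyadic_shell:
  assumes "1 \<le> norm (g::'a)"
  obtains k where "1 \<le> norm (dl \<omega> (1 / 2 ^ k) g)" "dl \<omega> (1 / 2 ^ Suc k) g \<in> ball 0 1"
proof -
  have "\<exists>k. norm (dl \<omega> (1 / 2 ^ k) g) < 1"
  proof -
    obtain k where "norm g < 2 ^ k" using real_arch_pow[of 2 "norm g"] by auto
    then have "1 / 2 ^ k * norm g < 1" by (simp add: field_simps)
    moreover have "norm (dl \<omega> (1 / 2 ^ k) g) \<le> 1 / 2 ^ k * norm g"
      by (rule norm_dl_le) (auto intro: weight_ge_1)
    ultimately show ?thesis by (intro exI[of _ k]) linarith
  qed
  then obtain n where n: "norm (dl \<omega> (1 / 2 ^ n) g) < 1" "\<And>k. k < n \<Longrightarrow> \<not> norm (dl \<omega> (1 / 2 ^ k) g) < 1"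
    using exists_least_iff[of "\<lambda>k. norm (dl \<omega> (1 / 2 ^ k) g) < 1"] by blast
  have "n \<noteq> 0" using n(1) assms by (cases n) auto
  then obtain k where "n = Suc k" by (cases n) auto
  then show ?thesis using that[of k] n by force
qed

text \<open>For dyadic index at most \<open>k0\<close>, \<open>g\<close> stays in a compact set and
  time stays away from 0, so plain continuity suffices. For a larger index, rescaling by
  \<open>r = 2 ^ k\<close> moves the point into the region of
  \<open>dpart_cvk_linear_in_time\<close>: homogeneity gives \<open>r powr (- Q)\<close>, the
  rescaled time a further \<open>r\<^sup>2\<close> in the denominator, and each derivative only
  improves the power.\<close>

lemma kernel_bound:
  assumes bs: "set bs \<subseteq> Basis" and t: "0 < t"
  shows "\<exists>e>0. \<exists>C. \<forall>y\<in>ball (t, w) e. \<forall>g. \<bar>dpart bs (\<lambda>y. cvk (y, g)) y\<bar> \<le> C * majorant g"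
proof -
  define cs where "cs = map (\<lambda>b. (b, 0::'a)) bs"
  have cs: "set cs \<subseteq> Basis" using bs by (auto simp: cs_def Basis_prod_def)
  let ?G = "dpart cs cvk"
  obtain L where L: "0 < L" "\<And>x. norm (dl \<omega> 2 x) \<le> norm x * L"
    using bounded_linear.pos_bounded[OF bounded_linear_dl[of \<omega> 2]] by blast
  obtain C1 where C1: "0 \<le> C1" "\<And>t w g. 0 \<le> t \<Longrightarrow> t \<le> 1 \<Longrightarrow> norm w \<le> 1 / 2 \<Longrightarrow> 1 \<le> norm g \<Longrightarrow>
      norm g \<le> L \<Longrightarrow> \<bar>?G ((t, w), g)\<bar> \<le> C1 * t"
    using dpart_cvk_linear_in_time[OF cs, of L] by blast
  define e where "e = t / 2"
  have e: "0 < e" using t by (simp add: e_def)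
  define R where "R = norm w + t"
  have near: "t / 2 \<le> s \<and> s \<le> 2 * t \<and> norm x \<le> R" if "(s, x) \<in> ball (t, w) e" for s x
  proof -
    have "dist (t, w) (s, x) < t / 2" using that by (simp add: e_def)
    then have "dist t s < t / 2" "dist w x < t / 2"
      using dist_fst_le[of "(t, w)" "(s, x)"] dist_snd_le[of "(t, w)" "(s, x)"] by auto
    moreover have "norm x \<le> norm w + dist w x" by (metis add.commute dist_norm norm_minus_commute norm_triangle_sub)
    ultimately show ?thesis using t by (auto simp: R_def dist_real_def abs_if split: if_splits)
  qed
  \<comment> \<open>Chosen so that for \<open>k > k0\<close> the rescaled \<open>x\<close> has norm
    at most 1/2 and the rescaled time is at most 1, as \<open>dpart_cvk_linear_in_time\<close>
    demands.\<close>
  obtain k0 where k0: "2 * t + 2 * R < 2 ^ k0" using real_arch_pow[of 2 "2 * t + 2 * R"] by auto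
  \<comment> \<open>\<open>L'\<close> bounds the norm of every \<open>g\<close> that dilation by
    \<open>1 / 2 ^ Suc k0\<close> sends into the unit ball.\<close>
  obtain L' where L': "0 < L'" "\<And>x. norm (dl \<omega> (2 ^ Suc k0) x) \<le> norm x * L'"
    using bounded_linear.pos_bounded[OF bounded_linear_dl[of \<omega> "2 ^ Suc k0"]] by blast
  let ?K = "({t / 2..2 * t} \<times> cball (0::'a) R) \<times> cball (0::'a) L'"
  have "?K \<subseteq> cvk_dom" using t by (auto simp: cvk_dom_def)
  moreover have "Ck 0 cvk_dom ?G" by (rule Ck_dpart[OF Ck_cvk cs]) auto
  ultimately have "bounded (?G ` ?K)"
    by (intro compact_imp_bounded compact_continuous_image compact_Times) (auto intro: continuous_on_subset)
  then obtain C2 where "\<forall>p\<in>?G ` ?K. norm p \<le> C2" by (auto simp only: bounded_iff)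
  then have C2: "\<bar>?G p\<bar> \<le> \<bar>C2\<bar>" if "p \<in> ?K" for p using that by force
  let ?h = "2 powr - (Q + 1)"
  have h_mono: "?h ^ k0 \<le> ?h ^ k" if "k \<le> k0" for k
    using that half_lt by (intro power_decreasing) auto
  \<comment> \<open>The first summand serves the large indices. The second serves the small ones,
    where \<open>majorant g\<close> is at least \<open>?h ^ k0\<close>.\<close>
  define C where "C = C1 * (2 * t) + \<bar>C2\<bar> / ?h ^ k0"
  have h0: "0 < ?h ^ k0" by simp
  have C_ge: "C1 * (2 * t) \<le> C" "\<bar>C2\<bar> / ?h ^ k0 \<le> C" "0 \<le> C" using C1(1) t h0 by (auto simp: C_def)
  have main: "\<bar>?G ((s, x), g)\<bar> \<le> C * majorant g" if near': "t / 2 \<le> s" "s \<le> 2 * t" "norm x \<le> R" for s x g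
  proof -
    have small: "\<bar>?G ((s, x), g)\<bar> \<le> C * majorant g"
      if "k \<le> k0" "dl \<omega> (1 / 2 ^ Suc k) g \<in> ball 0 1" for k
    proof -
      have lt1: "norm (dl \<omega> (1 / 2 ^ Suc k0) g) < 1"
      proof -
        have "dl \<omega> (1 / 2 ^ Suc k0) g = dl \<omega> (1 / 2 ^ (k0 - k)) (dl \<omega> (1 / 2 ^ Suc k) g)"
        proof -
          have "(2::real) ^ k0 = 2 ^ (k0 - k) * 2 ^ k" using that(1) by (simp flip: power_add)
          then show ?thesis by (simp add: dl_dl mult_ac)
        qed
        also have "norm \<dots> \<le> 1 / 2 ^ (k0 - k) * norm (dl \<omega> (1 / 2 ^ Suc k) g)"
          by (rule norm_dl_le) (auto intro: weight_ge_1)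
        also have "\<dots> \<le> 1 * norm (dl \<omega> (1 / 2 ^ Suc k) g)" by (intro mult_right_mono) auto
        finally show ?thesis using that(2) by simp
      qed
      have "norm g \<le> norm (dl \<omega> (1 / 2 ^ Suc k0) g) * L'"
        using L'(2)[of "dl \<omega> (1 / 2 ^ Suc k0) g"] by (simp add: dl_dl)
      also have "\<dots> \<le> 1 * L'"
        using lt1 L'(1) by (intro mult_right_mono) (simp_all add: less_imp_le)
      finally have "norm g \<le> 1 * L'" .
      then have "\<bar>?G ((s, x), g)\<bar> \<le> \<bar>C2\<bar>" using near' by (intro C2) auto
      also have "\<dots> = \<bar>C2\<bar> / ?h ^ k0 * ?h ^ k0" using h0 by simp
      also have "\<dots> \<le> C * majorant g"
        using majorant_ge[OF that(2)] h_mono[OF that(1)] C_ge h0 by (intro mult_mono) auto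
      finally show ?thesis .
    qed
    show ?thesis
    proof (cases "1 \<le> norm g")
      case False
      have "norm (dl \<omega> (1 / 2 ^ Suc 0) g) \<le> 1 / 2 ^ Suc 0 * norm g"
        by (rule norm_dl_le) (auto intro: weight_ge_1)
      also have "\<dots> < 1" using False by simp
      finally show ?thesis using small[of 0] by simp
    next
      case True
      then obtain k where k: "1 \<le> norm (dl \<omega> (1 / 2 ^ k) g)" "dl \<omega> (1 / 2 ^ Suc k) g \<in> ball 0 1"
        by (rule dyadic_shell)
      show ?thesis
      proof (cases "k \<le> k0")
        case True
        then show ?thesis using small k by blast
      next
        case False
        define r where "r = (2::real) ^ k"
        have r: "0 < r" "1 \<le> r" "2 * t + 2 * R < r"
        proof -
          have "(2::real) ^ k0 \<le> 2 ^ k" using False by (intro power_increasing) auto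
          then show "2 * t + 2 * R < r" unfolding r_def using k0 by linarith
        qed (auto simp: r_def)
        define g' where "g' = dl \<omega> (1 / r) g"
        define p where "p = ((s / r\<^sup>2, dl \<omega> (1 / r) x), g')"
        have R0: "0 \<le> R" using t by (simp add: R_def)
        have "dl \<omega> 2 (dl \<omega> (1 / 2 ^ Suc k) g) = g'" by (simp add: dl_dl g'_def r_def)
        then have "norm g' \<le> norm (dl \<omega> (1 / 2 ^ Suc k) g) * L" using L(2)[of "dl \<omega> (1 / 2 ^ Suc k) g"] by simp
        also have "\<dots> \<le> 1 * L" using k(2) L(1) by (intro mult_right_mono) auto
        finally have g': "1 \<le> norm g'" "norm g' \<le> L" using k(1) by (auto simp: g'_def r_def)
        have "norm (dl \<omega> (1 / r) x) \<le> 1 / r * norm x" by (rule norm_dl_le) (use r in \<open>auto intro: weight_ge_1\<close>)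
        also have "\<dots> \<le> 1 / r * R" using r near' by (intro mult_left_mono) auto
        also have "\<dots> \<le> 1 / 2" using r t by (simp add: field_simps)
        finally have x: "norm (dl \<omega> (1 / r) x) \<le> 1 / 2" .
        have "s \<le> r" using near' r R0 by linarith
        also have "r \<le> r\<^sup>2" using r by (simp add: power2_eq_square)
        finally have s: "0 \<le> s / r\<^sup>2" "s / r\<^sup>2 \<le> 1" using near' t r by (auto simp: field_simps)
        have p: "p \<in> cvk_dom" using g' x by (auto simp: p_def cvk_dom_def)
        have "((s, x), g) = dl \<Omega> r p" using r by (simp add: p_def dl_\<Omega> dl_inverse g'_def)
        then have "?G ((s, x), g) = r powr (- Q - (\<Sum>b\<leftarrow>cs. \<Omega> \<bullet> b)) * ?G p"
          using dpart_cvk_dl[OF r(1) cs p] by simp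
        also have "\<bar>\<dots>\<bar> \<le> r powr (- Q) * (C1 * (s / r\<^sup>2))"
          unfolding abs_mult
        proof (intro mult_mono)
          have "0 \<le> (\<Sum>b\<leftarrow>cs. \<Omega> \<bullet> b)"
          proof (rule sum_list_nonneg)
            fix y assume "y \<in> set (map (\<lambda>b. \<Omega> \<bullet> b) cs)"
            then obtain b where "b \<in> set bs" "y = (2, \<omega>) \<bullet> b" by (auto simp: cs_def)
            then show "0 \<le> y" using tg.weight_pos[of b] bs by auto
          qed
          then show "\<bar>r powr (- Q - (\<Sum>b\<leftarrow>cs. \<Omega> \<bullet> b))\<bar> \<le> r powr (- Q)"
            using r by (simp add: powr_mono)
          show "\<bar>?G p\<bar> \<le> C1 * (s / r\<^sup>2)" unfolding p_def by (rule C1(2)[OF s x g'])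
        qed auto
        also have "\<dots> = C1 * s * r powr (- (Q + 2))"
          using r by (simp add: powr_diff powr_numeral powr_minus field_simps)
        \<comment> \<open>One of the two powers gained from time is given away, because
          \<open>Q + 1\<close> is the exponent of the majorant and already integrable.\<close>
        also have "\<dots> \<le> C1 * (2 * t) * r powr (- (Q + 1))"
          using near' C1(1) r t by (intro mult_mono powr_mono) auto
        also have "r powr (- (Q + 1)) = ?h ^ k"
          unfolding r_def by (rule power_powr_2)
        also have "C1 * (2 * t) * ?h ^ k \<le> C * majorant g"
          using majorant_ge[OF k(2)] C_ge C1(1) t by (intro mult_mono) auto
        finally show ?thesis .
      qed
    qed
  qed
  show ?thesis
  proof (rule exI[of _ e], rule conjI[OF e], rule exI[of _ C], intro ballI allI)
    fix y g assume y: "y \<in> ball (t, w) e"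
    obtain s x where sx: "y = (s, x)" by (cases y)
    have n: "t / 2 \<le> s" "s \<le> 2 * t" "norm x \<le> R" using near y sx by auto
    have "(y, g) \<in> cvk_dom" using n t sx by (simp add: cvk_dom_def)
    then have "dpart bs (\<lambda>y. cvk (y, g)) y = ?G (y, g)"
      unfolding cs_def by (rule dpart_slice[OF open_cvk_dom Ck_cvk bs])
    then show "\<bar>dpart bs (\<lambda>y. cvk (y, g)) y\<bar> \<le> C * majorant g" using main[OF n] sx by simp
  qed
qed

end

section \<open>Mass of the kernel and the Cauchy problem on the group\<close>

lemma heat_op_expand:
  fixes f :: "real \<times> 'a::euclidean_space \<Rightarrow> real"
  assumes S: "open S" and f: "Ck 2 S f" and V: "\<And>j. j < m \<Longrightarrow> Ck 1 UNIV (V j)" and z: "z \<in> S"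
  shows "heat_op m V f z = (\<Sum>j<m. \<Sum>b\<in>Basis. \<Sum>c\<in>Basis.
      (liftx (V j) z \<bullet> b) * (liftx (V j) z \<bullet> c) * dpart [b, c] f z +
      (liftx (V j) z \<bullet> b) * pd b (\<lambda>y. liftx (V j) y \<bullet> c) z * dpart [c] f z) - dpart [(1, 0)] f z"
proof -
  have "vf (liftx (V j)) (vf (liftx (V j)) f) z = (\<Sum>b\<in>Basis. \<Sum>c\<in>Basis.
      (liftx (V j) z \<bullet> b) * (liftx (V j) z \<bullet> c) * dpart [b, c] f z +
      (liftx (V j) z \<bullet> b) * pd b (\<lambda>y. liftx (V j) y \<bullet> c) z * dpart [c] f z)" if j: "j < m" for j
  proof -
    let ?W = "liftx (V j)"
    have pf: "pd c f differentiable (at z)" if "c \<in> Basis" for c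
      using Ck_differentiable[OF Ck_pd_less[OF f, of 1] _ z] that by simp
    have "Ck 1 UNIV (\<lambda>y. ?W y \<bullet> c)" for c by (intro Ck_inner Ck_liftx V j) auto
    then have W: "(\<lambda>y. ?W y \<bullet> c) differentiable (at z)" for c by (rule Ck_differentiable) auto
    have "((\<lambda>y. \<Sum>c\<in>Basis. (?W y \<bullet> c) * pd c f y) has_derivative
        (\<lambda>k. \<Sum>c\<in>Basis. (?W z \<bullet> c) * frechet_derivative (pd c f) (at z) k + frechet_derivative (\<lambda>y. ?W y \<bullet> c) (at z) k * pd c f z)) (at z)"
      by (intro has_derivative_sum has_derivative_mult frechet_derivative_worksI pf W)
    from has_derivative_pd[OF this]
    have "pd b (\<lambda>y. \<Sum>c\<in>Basis. (?W y \<bullet> c) * pd c f y) z =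
        (\<Sum>c\<in>Basis. (?W z \<bullet> c) * pd b (pd c f) z + pd b (\<lambda>y. ?W y \<bullet> c) z * pd c f z)" for b
      by (simp add: pd_def)
    then have "vf ?W (\<lambda>y. \<Sum>c\<in>Basis. (?W y \<bullet> c) * pd c f y) z = (\<Sum>b\<in>Basis. \<Sum>c\<in>Basis.
        (?W z \<bullet> b) * (?W z \<bullet> c) * dpart [b, c] f z + (?W z \<bullet> b) * pd b (\<lambda>y. ?W y \<bullet> c) z * dpart [c] f z)"
      by (simp add: vf_def sum_distrib_left distrib_left mult.assoc)
    then show ?thesis by (simp add: vf_def[abs_def])
  qed
  then show ?thesis by (simp add: heat_op_def)
qed

text \<open>The existential hides the coefficients, since all that matters is that they do not
  depend on \<open>f\<close>: the operator at a point is a fixed linear combination of partial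
  derivatives, and so commutes with integration whenever these do.\<close>

lemma heat_op_coefficients:
  fixes V :: "nat \<Rightarrow> 'a::euclidean_space \<Rightarrow> 'a"
  assumes "open S" "\<forall>j<m. Ck 1 UNIV (V j)" "z \<in> S"
  shows "\<exists>A B. \<forall>f. Ck 2 S f \<longrightarrow> heat_op m V f z =
    (\<Sum>j<m. \<Sum>b\<in>Basis. \<Sum>c\<in>Basis. A j b c * dpart [b, c] f z + B j b c * dpart [c] f z) - dpart [(1, 0)] f z"
proof (intro exI allI impI)
  show "heat_op m V f z = (\<Sum>j<m. \<Sum>b\<in>Basis. \<Sum>c\<in>Basis.
      (liftx (V j) z \<bullet> b) * (liftx (V j) z \<bullet> c) * dpart [b, c] f z +
      (liftx (V j) z \<bullet> b) * pd b (\<lambda>y. liftx (V j) y \<bullet> c) z * dpart [c] f z) - dpart [(1, 0)] f z"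
    if "Ck 2 S f" for f
    using heat_op_expand[OF assms(1) that _ assms(3)] assms(2) by blast
qed

lemma heat_op_mult_const:
  fixes f :: "real \<times> 'a::euclidean_space \<Rightarrow> real"
  assumes S: "open S" and f: "Ck 2 S f" and V: "\<And>j. j < m \<Longrightarrow> Ck 1 UNIV (V j)" and z: "z \<in> S"
  shows "heat_op m V (\<lambda>y. f y * k) z = heat_op m V f z * k"
proof -
  have fk: "Ck 2 S (\<lambda>y. f y * k)" by (intro Ck_mult S f Ck_const)
  have d: "dpart bs (\<lambda>y. f y * k) z = dpart bs f z * k" if "set bs \<subseteq> Basis" "length bs \<le> 2" for bs
    by (rule dpart_mult_const[OF S Ck_mono[OF f that(2)] that(1) z])
  have d2: "dpart [b, c] (\<lambda>y. f y * k) z = dpart [b, c] f z * k" if "b \<in> Basis" "c \<in> Basis" for b c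
    by (rule d) (use that in auto)
  have d1: "dpart [c] (\<lambda>y. f y * k) z = dpart [c] f z * k" if "c \<in> Basis" for c
    by (rule d) (use that in auto)
  have "\<forall>j<m. Ck 1 UNIV (V j)" using V by blast
  from heat_op_coefficients[OF S this z] obtain A B where E: "\<forall>f. Ck 2 S f \<longrightarrow> heat_op m V f z =
    (\<Sum>j<m. \<Sum>b\<in>Basis. \<Sum>c\<in>Basis. A j b c * dpart [b, c] f z + B j b c * dpart [c] f z) - dpart [(1, 0)] f z"
    by (elim exE)
  show ?thesis
    unfolding E[rule_format, OF fk] E[rule_format, OF f] left_diff_distrib sum_distrib_right
    by (intro arg_cong2[where f="(-)"] sum.cong refl d1 time_Basis)
      (simp only: d1 d2 distrib_right mult.assoc)
qed

lemma heat_op_integral: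
  fixes f :: "real \<times> 'a::euclidean_space \<Rightarrow> real" and F :: "real \<times> 'a \<Rightarrow> 'g \<Rightarrow> real"
  assumes S: "open S" and f: "Ck 2 S f" and F: "\<And>g. Ck 2 S (\<lambda>y. F y g)"
    and V: "\<And>j. j < m \<Longrightarrow> Ck 1 UNIV (V j)" and z: "z \<in> S"
    and int: "\<And>bs. set bs \<subseteq> Basis \<Longrightarrow> length bs \<le> 2 \<Longrightarrow>
      has_bochner_integral M (\<lambda>g. dpart bs (\<lambda>y. F y g) z) (dpart bs f z)"
  shows "heat_op m V f z = (\<integral>g. heat_op m V (\<lambda>y. F y g) z \<partial>M)"
proof -
  have "\<forall>j<m. Ck 1 UNIV (V j)" using V by blast
  from heat_op_coefficients[OF S this z] obtain A B where E: "\<forall>f. Ck 2 S f \<longrightarrow> heat_op m V f z =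
    (\<Sum>j<m. \<Sum>b\<in>Basis. \<Sum>c\<in>Basis. A j b c * dpart [b, c] f z + B j b c * dpart [c] f z) - dpart [(1, 0)] f z"
    by (elim exE)
  have "has_bochner_integral M (\<lambda>g. heat_op m V (\<lambda>y. F y g) z) (heat_op m V f z)"
    unfolding E[rule_format, OF F] E[rule_format, OF f]
    by (intro has_bochner_integral_diff has_bochner_integral_sum has_bochner_integral_add
        has_bochner_integral_mult_right int) (auto simp: time_Basis)
  then show ?thesis by (simp add: has_bochner_integral_integral_eq)
qed

lemma vf_liftx_prod:
  fixes f :: "'a::euclidean_space \<Rightarrow> real"
  assumes "f differentiable (at x)" "p differentiable (at t)"
  shows "vf (liftx V) (\<lambda>z. p (fst z) * f (snd z)) (t, x) = p t * vf V f x"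
    and "pd (1, 0) (\<lambda>z. p (fst z) * f (snd z)) (t, x) = pd 1 p t * f x"
proof -
  have "((\<lambda>z::real \<times> 'a. p (fst z)) has_derivative (\<lambda>k. frechet_derivative p (at t) (fst k))) (at (t, x))"
    by (rule has_derivative_compose[where f=fst and g=p])
      (use frechet_derivative_worksI[OF assms(2)] in \<open>auto intro!: derivative_eq_intros\<close>)
  moreover have "((\<lambda>z. f (snd z)) has_derivative (\<lambda>k. frechet_derivative f (at x) (snd k))) (at (t, x))"
    by (rule has_derivative_compose[where f=snd and g=f])
      (use frechet_derivative_worksI[OF assms(1)] in \<open>auto intro!: derivative_eq_intros\<close>)
  ultimately have D: "((\<lambda>z. p (fst z) * f (snd z)) has_derivative
      (\<lambda>k. p (fst (t, x)) * frechet_derivative f (at x) (snd k) + frechet_derivative p (at t) (fst k) * f (snd (t, x)))) (at (t, x))"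
    by (rule has_derivative_mult)
  show "vf (liftx V) (\<lambda>z. p (fst z) * f (snd z)) (t, x) = p t * vf V f x"
    unfolding has_derivative_vf[OF D] vf_eq_frechet[OF assms(1)]
    by (simp add: liftx_def linear_0[OF linear_frechet_derivative[OF assms(2)]])
  show "pd (1, 0) (\<lambda>z. p (fst z) * f (snd z)) (t, x) = pd 1 p t * f x"
    unfolding has_derivative_pd[OF D]
    by (simp add: pd_def linear_0[OF linear_frechet_derivative[OF assms(1)]])
qed

lemma fst_borel: "fst \<in> borel_measurable (borel :: ('a::euclidean_space \<times> 'b::euclidean_space) measure)"
  and snd_borel: "snd \<in> borel_measurable (borel :: ('a::euclidean_space \<times> 'b::euclidean_space) measure)"
  by (rule borel_measurable_continuous_onI, intro continuous_intros)+

section \<open>Time slices of the kernel, its total mass, and its convolution with bounded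
  data\<close>

context heat_kernel
begin

lemma kernel_slice_measurable [measurable]: "(\<lambda>z. \<gamma> (t, z)) \<in> borel_measurable borel"
proof -
  have "(\<lambda>z. (t, z)) \<in> borel_measurable (borel :: 'a measure)"
    by (intro borel_measurable_continuous_onI continuous_intros)
  then show ?thesis using measurable_compose[OF _ kernel_measurable] by simp
qed

lemma kernel_slice_integrable:
  assumes "0 < t"
  shows "integrable lborel (\<lambda>z. \<gamma> (t, z))"
proof -
  obtain C where C: "\<And>g. \<bar>cvk ((t, 0), g)\<bar> \<le> C * majorant g"
    using kernel_bound[of "[]" t 0] assms by force
  have m: "(\<lambda>g. \<gamma> (t, gi g)) \<in> borel_measurable borel" by measurable
  have "integrable lborel (\<lambda>g. \<gamma> (t, gi g))"
    by (rule Bochner_Integration.integrable_bound[OF integrable_mult_right[OF majorant_integrable, of C]])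
      (use C m in \<open>auto simp: cvk_def intro!: AE_I2 order_trans[OF _ abs_ge_self]\<close>)
  then show ?thesis using integral_gi(2)[OF kernel_slice_measurable] by simp
qed

definition "mass = (\<integral>z. \<gamma> (1, z) \<partial>lborel)"

lemma kernel_slice_dl:
  assumes "0 < t"
  shows "\<gamma> (t, dl \<omega> (sqrt t) z) = sqrt t powr (- Q) * \<gamma> (1, z)"
  using kernel_dl[of "sqrt t" "(1, z)"] assms by (simp add: D_pair zero_prod_def)

lemma kernel_slice_integral:
  assumes t: "0 < t"
  shows "(\<integral>z. \<gamma> (t, z) \<partial>lborel) = mass"
proof -
  have "(\<integral>z. \<gamma> (t, z) \<partial>lborel) = sqrt t powr Q * (\<integral>z. \<gamma> (t, dl \<omega> (sqrt t) z) \<partial>lborel)"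
    by (rule integral_dl) (use t in auto)
  also have "\<dots> = mass" using t by (simp add: kernel_slice_dl mass_def powr_minus)
  finally show ?thesis .
qed

text \<open>Supplies the dominating function for \<open>mass_eq_1\<close>. By positivity a slice at
  positive time has \<open>L1\<close> norm \<open>mass\<close>, slices at negative time vanish, and
  the slice through the pole is negligible.\<close>

lemma kernel_slab_integrable:
  "integrable lborel (\<lambda>z. indicator {-1..1} (fst z) * \<gamma> z)"
proof -
  let ?f = "\<lambda>z. indicator {-1..1} (fst z) * \<gamma> z"
  have m: "?f \<in> borel_measurable (lborel \<Otimes>\<^sub>M lborel)"
  proof -
    have "?f \<in> borel_measurable borel" by (intro borel_measurable_times measurable_compose[OF fst_borel] kernel_measurable) measurable
    then show ?thesis unfolding lborel_prod by simp
  qed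
  have inner: "(\<integral>x. norm (?f (t, x)) \<partial>lborel) = indicator {0..1} t * mass" if "t \<noteq> 0" for t
  proof (cases "0 < t")
    case True
    then have "norm (?f (t, x)) = indicator {0..1} t * \<gamma> (t, x)" for x
      using kernel_nonneg[of "(t, x)"] by (auto simp: indicator_def zero_prod_def)
    then show ?thesis using kernel_slice_integral[OF True] by simp
  next
    case False
    then show ?thesis using that kernel_neg_time[of "(t, _)"] by (auto simp: indicator_def)
  qed
  have ae: "AE t in lborel. t \<noteq> (0::real)" by (rule AE_lborel_singleton)
  have "integrable (lborel \<Otimes>\<^sub>M lborel) ?f"
  proof (rule lborel_pair.Fubini_integrable[OF m])
    have im: "(\<lambda>t. \<integral>x. norm (?f (t, x)) \<partial>lborel) \<in> borel_measurable lborel"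
      by (rule lborel.borel_measurable_lebesgue_integral) (use m in \<open>simp add: case_prod_unfold\<close>)
    have "integrable lborel (\<lambda>t. indicator {0..1::real} t * mass)"
      by (intro integrable_mult_left integrable_real_indicator) auto
    then show "integrable lborel (\<lambda>t. \<integral>x. norm (?f (t, x)) \<partial>lborel)"
      by (rule integrable_cong_AE_imp[OF _ im]) (use ae inner in \<open>auto elim!: eventually_mono\<close>)
    show "AE t in lborel. integrable lborel (\<lambda>x. ?f (t, x))"
      using ae
    proof eventually_elim
      case (elim t)
      then show ?case
        using kernel_slice_integrable[of t] kernel_neg_time[of "(t, _)"] by (cases "0 < t") auto
    qed
  qed
  then show ?thesis by (simp add: lborel_prod)
qed

text \<open>The equation is tested with \<open>\<psi>(t)\<close> times \<open>\<kappa>\<close>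
  dilated by \<open>r\<close>, where \<open>r\<close> tends to 0. The sum of squares contributes a
  multiple of \<open>r\<^sup>2\<close> and the space factor flattens to \<open>\<kappa> 0\<close>,
  so the integral of \<open>\<gamma>\<close> against the derivative of \<open>\<psi>\<close> is
  \<open>- \<psi> 0\<close>. All slices at positive time have the same mass, hence that integral is
  also \<open>mass * (\<psi> 1 - \<psi> 0)\<close>, and \<open>\<psi> 1\<close> is 0.\<close>

lemma mass_eq_1: "mass = 1"
proof -
  define \<psi> :: "real \<Rightarrow> real" where "\<psi> = bump 0 1"
  define \<kappa> :: "'a \<Rightarrow> real" where "\<kappa> = bump 0 1"
  have \<psi>_Ck: "Ck k UNIV \<psi>" and \<kappa>_Ck: "Ck k UNIV \<kappa>" for k unfolding \<psi>_def \<kappa>_def by (rule Ck_bump)+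
  have \<psi>0: "t \<notin> {-1..1} \<Longrightarrow> \<psi> t = 0" for t unfolding \<psi>_def by (rule bump_eq_0) auto
  have \<kappa>0: "x \<notin> cball 0 1 \<Longrightarrow> \<kappa> x = 0" for x unfolding \<kappa>_def by (rule bump_eq_0) auto
  have \<psi>d: "\<psi> differentiable (at t)" for t by (rule Ck_differentiable[OF \<psi>_Ck[of 1]]) auto
  have \<psi>': "(\<psi> has_real_derivative pd 1 \<psi> t) (at t)" for t
  proof -
    have "frechet_derivative \<psi> (at t) h = pd 1 \<psi> t * h" for h
      using linear_scale[OF linear_frechet_derivative[OF \<psi>d], of t h 1] by (simp add: pd_def)
    then have "frechet_derivative \<psi> (at t) = (*) (pd 1 \<psi> t)" by blast
    then show ?thesis using frechet_derivative_worksI[OF \<psi>d[of t]] by (simp only: has_field_derivative_def)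
  qed
  have \<psi>'_Ck: "Ck 0 UNIV (pd 1 \<psi>)" by (rule Ck_pd_less[OF \<psi>_Ck[of 1]]) auto
  have \<psi>'0: "t \<notin> {-1..1} \<Longrightarrow> pd 1 \<psi> t = 0" for t
    by (rule pd_eq_0_outside[of "{-1..1}" \<psi>]) (use \<psi>0 in auto)
  define \<Lambda> where "\<Lambda> x = (\<Sum>j<m. vf (Z j) (vf (Z j) \<kappa>) x)" for x
  have vf1: "Ck k UNIV (vf (Z j) \<kappa>)" if "j < m" for j k
    by (rule Ck_vf[OF open_UNIV smooth_Z[OF that] \<kappa>_Ck])
  have \<Lambda>_Ck: "Ck 0 UNIV \<Lambda>"
    unfolding \<Lambda>_def[abs_def] by (intro Ck_sum open_UNIV Ck_vf smooth_Z vf1) auto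
  have vf0: "vf W f x = 0" if "\<And>x. x \<notin> cball 0 1 \<Longrightarrow> f x = 0" "x \<notin> cball 0 1" for W x and f :: "'a \<Rightarrow> real"
    using pd_eq_0_outside[of "cball 0 1" f x] that by (simp add: vf_def)
  have \<Lambda>0: "x \<notin> cball 0 1 \<Longrightarrow> \<Lambda> x = 0" for x
    unfolding \<Lambda>_def by (intro sum.neutral ballI vf0 \<kappa>0)
  obtain C1 where C1: "0 \<le> C1" "\<And>x. \<bar>\<Lambda> x\<bar> \<le> C1"
    using bounded_of_compact_support[OF compact_cball \<Lambda>0 continuous_on_subset[OF Ck_continuous[OF \<Lambda>_Ck] subset_UNIV]] by blast
  obtain C2 where C2: "0 \<le> C2" "\<And>t. \<bar>pd 1 \<psi> t\<bar> \<le> C2"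
    using bounded_of_compact_support[OF compact_Icc \<psi>'0 continuous_on_subset[OF Ck_continuous[OF \<psi>'_Ck] subset_UNIV]] by blast
  define \<phi> where "\<phi> r z = \<psi> (fst z) * \<kappa> (dl \<omega> r (snd z))" for r z
  have \<kappa>r_Ck: "Ck k UNIV (\<lambda>x. \<kappa> (dl \<omega> r x))" for k r
    by (intro Ck_compose_UNIV[OF _ _ \<kappa>_Ck] Ck_linear bounded_linear_dl) auto
  have \<phi>_Ck: "Ck k UNIV (\<phi> r)" for k r
    unfolding \<phi>_def[abs_def]
    by (intro Ck_mult Ck_compose_UNIV[OF _ _ \<psi>_Ck] Ck_compose_UNIV[OF _ _ \<kappa>r_Ck] Ck_linear
        bounded_linear_fst bounded_linear_snd) auto
  have H\<phi>: "heat_op_adj m Z (\<phi> r) (t, x) = r\<^sup>2 * \<psi> t * \<Lambda> (dl \<omega> r x) + pd 1 \<psi> t * \<kappa> (dl \<omega> r x)"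
    if r: "0 < r" for r t x
  proof -
    have d: "dl \<omega> r differentiable (at x)" for x
      by (rule differentiableI[OF bounded_linear_imp_has_derivative[OF bounded_linear_dl]])
    have rel: "frechet_derivative (dl \<omega> r) (at x) (Z j x) = r *\<^sub>R Z j (dl \<omega> r x)" if "j < m" for j x
      using dl_Z[OF that r] frechet_derivative_at[OF bounded_linear_imp_has_derivative[OF bounded_linear_dl], of \<omega> r x]
      by metis
    have diff: "f differentiable (at y)" if "Ck 1 UNIV f" for f :: "'a \<Rightarrow> real" and y
      using Ck_differentiable[OF that] by simp
    have scale: "vf (Z j) (\<lambda>x. f (dl \<omega> r x)) x = r * vf (Z j) f (dl \<omega> r x)"
      if "j < m" "Ck 1 UNIV f" for j x and f :: "'a \<Rightarrow> real"
      by (rule vf_related[where h="dl \<omega> r" and f=f and Y="Z j" and W="Z j", OF d diff[OF that(2)] rel[OF that(1)]])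
    have mult: "vf (Z j) (\<lambda>x. c * f x) x = c * vf (Z j) f x" if "Ck 1 UNIV f" for j c x and f :: "'a \<Rightarrow> real"
      using has_derivative_vf[OF has_derivative_mult_right[OF frechet_derivative_worksI[OF diff[OF that]]], of "Z j" c x]
        vf_eq_frechet[OF diff[OF that]] by simp
    have "vf (liftx (Z j)) (vf (liftx (Z j)) (\<phi> r)) (t, x) = r\<^sup>2 * \<psi> t * vf (Z j) (vf (Z j) \<kappa>) (dl \<omega> r x)" if j: "j < m" for j
    proof -
      have 1: "vf (liftx (Z j)) (\<phi> r) = (\<lambda>z. \<psi> (fst z) * (r * vf (Z j) \<kappa> (dl \<omega> r (snd z))))"
      proof
        fix z :: "real \<times> 'a"
        show "vf (liftx (Z j)) (\<phi> r) z = \<psi> (fst z) * (r * vf (Z j) \<kappa> (dl \<omega> r (snd z)))"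
          unfolding \<phi>_def[abs_def] using vf_liftx_prod(1)[where x="snd z" and t="fst z" and V="Z j", OF diff[OF \<kappa>r_Ck[where r=r and k=1]] \<psi>d]
            scale[OF j \<kappa>_Ck] by simp
      qed
      have k: "Ck 1 UNIV (\<lambda>x. vf (Z j) \<kappa> (dl \<omega> r x))"
        by (intro Ck_compose_UNIV[OF _ _ vf1[OF j]] Ck_linear bounded_linear_dl) auto
      then have k': "Ck 1 UNIV (\<lambda>x. r * vf (Z j) \<kappa> (dl \<omega> r x))" by (intro Ck_cmult) auto
      show ?thesis
        unfolding 1 vf_liftx_prod(1)[OF diff[OF k'] \<psi>d] mult[OF k] scale[OF j vf1[OF j]]
        by (simp add: power2_eq_square)
    qed
    moreover have "pd (1, 0) (\<phi> r) (t, x) = pd 1 \<psi> t * \<kappa> (dl \<omega> r x)"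
      unfolding \<phi>_def[abs_def] by (rule vf_liftx_prod(2)[OF diff[OF \<kappa>r_Ck] \<psi>d])
    ultimately show ?thesis
      by (simp add: heat_op_adj_eq[OF \<phi>_Ck] subl_def \<Lambda>_def sum_distrib_left)
  qed
  have test: "(\<integral>z. \<gamma> z * heat_op_adj m Z (\<phi> r) z \<partial>lborel) = - (\<psi> 0 * \<kappa> 0)" if r: "0 < r" for r
  proof -
    have K: "compact ({-1..1::real} \<times> dl \<omega> (1 / r) ` cball 0 1)"
      by (intro compact_Times compact_continuous_image linear_continuous_on bounded_linear_dl) auto
    have "\<phi> r z = 0" if z: "z \<notin> {-1..1} \<times> dl \<omega> (1 / r) ` cball 0 1" for z
    proof (cases "fst z \<in> {-1..1}")
      case True
      then have "snd z \<notin> dl \<omega> (1 / r) ` cball 0 1" using z by (cases z) auto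
      then have "dl \<omega> r (snd z) \<notin> cball 0 1" using dl_inverse(2)[OF r] by (metis imageI)
      then show ?thesis using \<kappa>0 by (simp add: \<phi>_def)
    qed (use \<psi>0 in \<open>simp add: \<phi>_def\<close>)
    from weak_kernel_test(2)[where f="\<phi> r", OF kernel _ K this]
    show ?thesis using \<phi>_Ck by (simp add: smooth_on_iff_Ck \<phi>_def)
  qed
  define r where "r n = 1 / real (Suc n)" for n
  have r: "0 < r n" "r n \<le> 1" for n by (auto simp: r_def)
  have r_lim: "filterlim r (at_right 0) sequentially"
    unfolding r_def[abs_def] filterlim_at using LIMSEQ_Suc[OF lim_1_over_n] by auto
  have \<psi>'_m [measurable]: "pd 1 \<psi> \<in> borel_measurable borel" and \<Lambda>_m [measurable]: "\<Lambda> \<in> borel_measurable borel"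
    and \<psi>_m [measurable]: "\<psi> \<in> borel_measurable borel" and \<kappa>_m [measurable]: "\<kappa> \<in> borel_measurable borel"
    by (rule borel_measurable_continuous_onI, rule Ck_continuous[OF \<psi>'_Ck] Ck_continuous[OF \<Lambda>_Ck]
        Ck_continuous[OF \<psi>_Ck[of 0]] Ck_continuous[OF \<kappa>_Ck[of 0]])+
  let ?g = "\<lambda>n z. \<gamma> z * ((r n)\<^sup>2 * \<psi> (fst z) * \<Lambda> (dl \<omega> (r n) (snd z)) + pd 1 \<psi> (fst z) * \<kappa> (dl \<omega> (r n) (snd z)))"
  have g_test: "(\<integral>z. ?g n z \<partial>lborel) = - (\<psi> 0 * \<kappa> 0)" for n
  proof -
    have "heat_op_adj m Z (\<phi> (r n)) z = (r n)\<^sup>2 * \<psi> (fst z) * \<Lambda> (dl \<omega> (r n) (snd z)) + pd 1 \<psi> (fst z) * \<kappa> (dl \<omega> (r n) (snd z))" for z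
      using H\<phi>[OF r(1)[of n], of "fst z" "snd z"] by simp
    then show ?thesis using test[OF r(1)[of n]] by simp
  qed
  have "(\<lambda>n. \<integral>z. ?g n z \<partial>lborel) \<longlonglongrightarrow> (\<integral>z. \<gamma> z * (pd 1 \<psi> (fst z) * \<kappa> 0) \<partial>lborel)"
  proof (rule integral_dominated_convergence[where w="\<lambda>z. (C1 + C2) * \<bar>indicator {-1..1} (fst z) * \<gamma> z\<bar>"])
    show "integrable lborel (\<lambda>z. (C1 + C2) * \<bar>indicator {-1..1} (fst z) * \<gamma> z\<bar>)"
      using kernel_slab_integrable by (intro integrable_mult_right integrable_abs)
    show "AE z in lborel. (\<lambda>n. ?g n z) \<longlonglongrightarrow> \<gamma> z * (pd 1 \<psi> (fst z) * \<kappa> 0)"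
    proof (rule AE_I2)
      fix z :: "real \<times> 'a"
      have d0: "(\<lambda>n. dl \<omega> (r n) (snd z)) \<longlonglongrightarrow> 0"
        by (rule filterlim_compose[OF dl_tendsto_0[OF weight_pos] r_lim])
      have "isCont \<kappa> 0" "isCont \<Lambda> 0"
        using Ck_continuous[OF \<kappa>_Ck[of 0]] Ck_continuous[OF \<Lambda>_Ck] by (simp_all add: continuous_on_eq_continuous_at)
      then have "(\<lambda>n. \<kappa> (dl \<omega> (r n) (snd z))) \<longlonglongrightarrow> \<kappa> 0" "(\<lambda>n. \<Lambda> (dl \<omega> (r n) (snd z))) \<longlonglongrightarrow> \<Lambda> 0"
        using d0 isCont_tendsto_compose by blast+
      moreover have "r \<longlonglongrightarrow> 0" using r_lim by (simp add: filterlim_at)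
      ultimately have "(\<lambda>n. ?g n z) \<longlonglongrightarrow> \<gamma> z * (0\<^sup>2 * \<psi> (fst z) * \<Lambda> 0 + pd 1 \<psi> (fst z) * \<kappa> 0)"
        by (intro tendsto_intros)
      then show "(\<lambda>n. ?g n z) \<longlonglongrightarrow> \<gamma> z * (pd 1 \<psi> (fst z) * \<kappa> 0)" by simp
    qed
    show "AE z in lborel. norm (?g n z) \<le> (C1 + C2) * \<bar>indicator {-1..1} (fst z) * \<gamma> z\<bar>" for n
    proof (rule AE_I2)
      fix z :: "real \<times> 'a"
      show "norm (?g n z) \<le> (C1 + C2) * \<bar>indicator {-1..1} (fst z) * \<gamma> z\<bar>"
      proof (cases "fst z \<in> {-1..1}")
        case True
        have "\<bar>(r n)\<^sup>2 * \<psi> (fst z) * \<Lambda> (dl \<omega> (r n) (snd z))\<bar> \<le> 1 * 1 * C1"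
          unfolding abs_mult
          by (intro mult_mono C1) (use r[of n] in \<open>auto simp: \<psi>_def bump_le_1 power_le_one\<close>)
        moreover have "\<bar>pd 1 \<psi> (fst z) * \<kappa> (dl \<omega> (r n) (snd z))\<bar> \<le> C2 * 1"
          unfolding abs_mult by (intro mult_mono C2) (auto simp: \<kappa>_def bump_le_1)
        ultimately have "\<bar>(r n)\<^sup>2 * \<psi> (fst z) * \<Lambda> (dl \<omega> (r n) (snd z)) + pd 1 \<psi> (fst z) * \<kappa> (dl \<omega> (r n) (snd z))\<bar> \<le> C1 + C2"
          by linarith
        from mult_right_mono[OF this, of "\<bar>\<gamma> z\<bar>"] show ?thesis using True by (simp add: abs_mult mult.commute)
      next
        case False
        then show ?thesis using \<psi>0 \<psi>'0 by simp
      qed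
    qed
    have dm: "(\<lambda>z::real \<times> 'a. f (dl \<omega> (r n) (snd z))) \<in> borel_measurable borel"
      if "f \<in> borel_measurable borel" for f :: "'a \<Rightarrow> real" and n
      by (rule measurable_compose[OF measurable_compose[OF snd_borel dl_measurable] that])
    have "(\<lambda>z. \<gamma> z * (pd 1 \<psi> (fst z) * \<kappa> 0)) \<in> borel_measurable borel" "?g n \<in> borel_measurable borel" for n
      by (intro borel_measurable_times borel_measurable_add borel_measurable_const kernel_measurable
          measurable_compose[OF fst_borel \<psi>'_m] measurable_compose[OF fst_borel \<psi>_m] dm \<Lambda>_m \<kappa>_m)+
    then show "(\<lambda>z. \<gamma> z * (pd 1 \<psi> (fst z) * \<kappa> 0)) \<in> borel_measurable lborel" "?g n \<in> borel_measurable lborel" for n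
      by simp_all
  qed
  then have "(\<integral>z. \<gamma> z * (pd 1 \<psi> (fst z) * \<kappa> 0) \<partial>lborel) = - (\<psi> 0 * \<kappa> 0)"
    unfolding g_test by (simp add: LIMSEQ_const_iff)
  moreover have pos: "0 < \<psi> 0" "0 < \<kappa> 0" by (auto simp: \<psi>_def \<kappa>_def bump_pos_iff)
  moreover have "\<gamma> z * (pd 1 \<psi> (fst z) * \<kappa> 0) = \<kappa> 0 * (\<gamma> z * pd 1 \<psi> (fst z))" for z by simp
  ultimately have "\<kappa> 0 * (\<integral>z. \<gamma> z * pd 1 \<psi> (fst z) \<partial>lborel) = \<kappa> 0 * - \<psi> 0" by simp
  then have lhs: "(\<integral>z. \<gamma> z * pd 1 \<psi> (fst z) \<partial>lborel) = - \<psi> 0"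
    unfolding mult_cancel_left using pos(2) by auto
  have k_m: "(\<lambda>z. \<gamma> z * pd 1 \<psi> (fst z)) \<in> borel_measurable borel"
    by (intro borel_measurable_times kernel_measurable measurable_compose[OF fst_borel \<psi>'_m])
  let ?k = "\<lambda>z. \<gamma> z * pd 1 \<psi> (fst z)"
  have k_int: "integrable lborel ?k"
  proof (rule Bochner_Integration.integrable_bound[OF integrable_mult_right[OF kernel_slab_integrable, of C2]])
    show "AE z in lborel. norm (?k z) \<le> norm (C2 * (indicator {-1..1} (fst z) * \<gamma> z))"
    proof (rule AE_I2)
      fix z :: "real \<times> 'a"
      show "norm (?k z) \<le> norm (C2 * (indicator {-1..1} (fst z) * \<gamma> z))"
        using C2 \<psi>'0[of "fst z"] mult_right_mono[OF C2(2)[of "fst z"], of "\<bar>\<gamma> z\<bar>"]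
        by (cases "fst z \<in> {-1..1}") (auto simp: abs_mult mult.commute)
    qed
  qed (use k_m in simp)
  have "(\<integral>z. ?k z \<partial>lborel) = (\<integral>t. (\<integral>x. ?k (t, x) \<partial>lborel) \<partial>lborel)"
    using lborel_pair.integral_fst'[of ?k] k_int by (simp add: lborel_prod)
  also have "\<dots> = (\<integral>t. mass * (pd 1 \<psi> t * indicator {0..1} t) \<partial>lborel)"
  proof (rule integral_cong_AE)
    show "(\<lambda>t. \<integral>x. ?k (t, x) \<partial>lborel) \<in> borel_measurable lborel"
    proof (rule lborel.borel_measurable_lebesgue_integral)
      show "(\<lambda>(t, x). ?k (t, x)) \<in> borel_measurable (lborel \<Otimes>\<^sub>M lborel)"
        using k_m by (simp add: lborel_prod case_prod_unfold)
    qed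
    have ae: "AE t in lborel. t \<noteq> (0::real)" by (rule AE_lborel_singleton)
    then show "AE t in lborel. (\<integral>x. ?k (t, x) \<partial>lborel) = mass * (pd 1 \<psi> t * indicator {0..1} t)"
    proof eventually_elim
      case (elim t)
      consider "t < 0" | "0 < t" "t \<le> 1" | "1 < t" using elim by linarith
      then show ?case
      proof cases
        case 1
        then show ?thesis using kernel_neg_time[of "(t, _)"] by simp
      next
        case 2
        then show ?thesis using kernel_slice_integral[of t] by simp
      next
        case 3
        then show ?thesis using \<psi>'0[of t] by simp
      qed
    qed
  qed measurable
  also have "\<dots> = mass * (\<psi> 1 - \<psi> 0)"
  proof -
    have "(\<integral>t. pd 1 \<psi> t * indicator {0..1} t \<partial>lborel) = \<psi> 1 - \<psi> 0"
      by (rule integral_FTC_Icc_real)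
        (use \<psi>' Ck_continuous[OF \<psi>'_Ck] in \<open>auto simp: continuous_on_eq_continuous_at\<close>)
    then show ?thesis by simp
  qed
  also have "\<psi> 1 = 0" unfolding \<psi>_def by (rule bump_eq_0) auto
  finally show ?thesis using lhs pos(1) by simp
qed

text \<open>Substituting the dilation of \<open>z\<close> by \<open>sqrt t\<close> in the convolution of \<open>\<gamma>\<close> with \<open>\<Phi>\<close> makes the kernel
  independent of \<open>t\<close>, so continuity up to \<open>t = 0\<close> is dominated convergence; the maximum with 0 only
  extends the formula continuously to negative times.\<close>

definition extn :: "('a \<Rightarrow> real) \<Rightarrow> real \<times> 'a \<Rightarrow> real" where
  "extn \<Phi> y = (\<integral>z. \<gamma> (1, z) * \<Phi> (gm (snd y) (gi (dl \<omega> (sqrt (max (fst y) 0)) z))) \<partial>lborel)"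

context
  fixes \<Phi> :: "'a \<Rightarrow> real" and C :: real
  assumes \<Phi>_cont: "continuous_on UNIV \<Phi>" and \<Phi>_le: "\<And>x. \<bar>\<Phi> x\<bar> \<le> C"
begin

lemma \<Phi>_measurable [measurable]: "\<Phi> \<in> borel_measurable borel"
  by (rule borel_measurable_continuous_onI) (rule \<Phi>_cont)

lemma kernel_1_nonneg: "0 \<le> \<gamma> (1, z)"
  by (rule kernel_nonneg) (simp add: zero_prod_def)

lemma extn_integrand_le: "\<bar>\<gamma> (1, z) * \<Phi> x\<bar> \<le> C * \<gamma> (1, z)"
  using mult_right_mono[OF \<Phi>_le[of x] kernel_1_nonneg[of z]] kernel_1_nonneg[of z] by (simp add: abs_mult mult.commute)

lemma extn_continuous: "continuous_on UNIV (extn \<Phi>)"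
proof -
  have "isCont (extn \<Phi>) y" for y
    unfolding extn_def[abs_def]
  proof (rule isCont_integral[where e=1 and B="\<lambda>z. C * \<gamma> (1, z)"])
    fix z
    have "continuous_on UNIV (\<lambda>y::real \<times> 'a. dl \<omega> (sqrt (max (fst y) 0)) z)"
      unfolding dl_def using weight_pos
      by (intro continuous_on_sum continuous_on_scaleR continuous_on_mult continuous_on_powr'
          continuous_on_const continuous_on_real_sqrt continuous_on_max continuous_on_fst continuous_on_id) auto
    then have "continuous_on UNIV (\<lambda>y. \<Phi> (gm (snd y) (gi (dl \<omega> (sqrt (max (fst y) 0)) z))))"
      by (intro continuous_on_compose2[OF \<Phi>_cont] continuous_gm continuous_gi continuous_on_snd continuous_on_id) auto
    then have "continuous_on UNIV (\<lambda>y. \<gamma> (1, z) * \<Phi> (gm (snd y) (gi (dl \<omega> (sqrt (max (fst y) 0)) z))))"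
      by (intro continuous_on_mult continuous_on_const)
    then show "isCont (\<lambda>y. \<gamma> (1, z) * \<Phi> (gm (snd y) (gi (dl \<omega> (sqrt (max (fst y) 0)) z)))) y"
      using continuous_on_eq_continuous_at[OF open_UNIV] by blast
  next
    show "integrable lborel (\<lambda>z. C * \<gamma> (1, z))" by (intro integrable_mult_right kernel_slice_integrable) simp
  qed (use extn_integrand_le in auto)
  then show ?thesis by (intro continuous_at_imp_continuous_on) auto
qed

text \<open>Dilation by 0 collapses the integration variable to the origin, since
  \<open>0 powr a\<close> is 0. The integrand becomes a constant multiple of the slice, whose mass
  is 1.\<close>

lemma extn_0: "extn \<Phi> (0, w) = \<Phi> w"
  using mass_eq_1 by (simp add: extn_def dl_0 mass_def)

lemma extn_le: "\<bar>extn \<Phi> y\<bar> \<le> C"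
proof -
  have "\<bar>extn \<Phi> y\<bar> \<le> (\<integral>z. \<bar>\<gamma> (1, z) * \<Phi> (gm (snd y) (gi (dl \<omega> (sqrt (max (fst y) 0)) z)))\<bar> \<partial>lborel)"
    unfolding extn_def by (rule integral_abs_bound)
  also have "\<dots> \<le> (\<integral>z. C * \<gamma> (1, z) \<partial>lborel)"
  proof (rule integral_mono')
    show "integrable lborel (\<lambda>z. C * \<gamma> (1, z))" by (intro integrable_mult_right kernel_slice_integrable) simp
    show "0 \<le> C * \<gamma> (1, z)" for z using \<Phi>_le[of 0] kernel_1_nonneg[of z] by (intro mult_nonneg_nonneg) auto
  qed (rule extn_integrand_le)
  also have "\<dots> = C" using mass_eq_1 by (simp add: mass_def)
  finally show ?thesis .
qed

lemma extn_eq: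
  assumes t: "0 < t"
  shows "extn \<Phi> (t, w) = (\<integral>z. \<gamma> (t, z) * \<Phi> (gm w (gi z)) \<partial>lborel)"
proof -
  have "(\<integral>z. \<gamma> (t, z) * \<Phi> (gm w (gi z)) \<partial>lborel) =
      sqrt t powr Q * (\<integral>z. \<gamma> (t, dl \<omega> (sqrt t) z) * \<Phi> (gm w (gi (dl \<omega> (sqrt t) z))) \<partial>lborel)"
    by (rule integral_dl) (use t in auto)
  also have "\<dots> = extn \<Phi> (t, w)"
    using t by (simp add: kernel_slice_dl extn_def powr_minus mult.assoc)
  finally show ?thesis by simp
qed

lemma extn_eq_cvk:
  assumes t: "0 < t"
  shows "extn \<Phi> (t, w) = (\<integral>g. cvk ((t, w), g) * \<Phi> g \<partial>lborel)"
proof -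
  let ?f = "\<lambda>g. \<gamma> (t, gm (gi g) w) * \<Phi> g"
  have f: "?f \<in> borel_measurable borel" by measurable
  then have f': "(\<lambda>x. ?f (gm w x)) \<in> borel_measurable borel" by measurable
  have eq: "gm (gi (gm w (gi z))) w = z" for z by (simp add: gi_gm assoc)
  then show ?thesis
    using integral_left(1)[OF f, of w] integral_gi(1)[OF f'] extn_eq[OF t, of w] unfolding eq by (simp add: cvk_def)
qed

text \<open>For regularity the form with the pole as integration variable is the right one: all
  derivatives then fall on the kernel, and continuity and boundedness of \<open>\<Phi>\<close>
  suffice.\<close>

lemma extn_heat:
  shows "Ck 2 ({0<..} \<times> UNIV) (extn \<Phi>)"
    and "z \<in> {0<..} \<times> UNIV \<Longrightarrow> heat_op m Z (extn \<Phi>) z = 0"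
proof -
  let ?S = "{0::real<..} \<times> (UNIV :: 'a set)" and ?F = "\<lambda>y g. cvk (y, g) * \<Phi> g"
  have S: "open ?S" by (intro open_Times) auto
  have cvk_Ck: "Ck k ?S (\<lambda>y. cvk (y, g))" for k g
    by (rule Ck_subset[OF Ck_joint_slice[OF open_cvk_dom Ck_cvk]]) (auto simp: cvk_dom_def)
  have F_Ck: "Ck 2 ?S (\<lambda>y. ?F y g)" for g by (intro Ck_mult S cvk_Ck Ck_const)
  have dF: "dpart bs (\<lambda>y. ?F y g) y = dpart bs (\<lambda>y. cvk (y, g)) y * \<Phi> g"
    if "set bs \<subseteq> Basis" "y \<in> ?S" for bs y g
    by (rule dpart_mult_const[OF S cvk_Ck that])
  have DUI: "Ck 2 ?S (\<lambda>y. \<integral>g. ?F y g \<partial>lborel) \<and> (\<forall>bs x. set bs \<subseteq> Basis \<longrightarrow> length bs \<le> 2 \<longrightarrow> x \<in> ?S \<longrightarrow>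
    integrable lborel (\<lambda>g. dpart bs (\<lambda>y. ?F y g) x) \<and>
    dpart bs (\<lambda>y. \<integral>g. ?F y g \<partial>lborel) x = (\<integral>g. dpart bs (\<lambda>y. ?F y g) x \<partial>lborel))"
  proof (rule Ck_integral[OF S F_Ck])
    show "(\<lambda>g. ?F y g) \<in> borel_measurable lborel" for y
      unfolding cvk_def fst_conv snd_conv by measurable
    fix bs :: "(real \<times> 'a) list" and x assume bs: "set bs \<subseteq> Basis" and x: "x \<in> ?S"
    have "0 < fst x" using x by auto
    from kernel_bound[OF bs this, of "snd x"]
    obtain e K where e: "0 < e" and "\<forall>y\<in>ball (fst x, snd x) e. \<forall>g. \<bar>dpart bs (\<lambda>y. cvk (y, g)) y\<bar> \<le> K * majorant g"
      by blast
    then have K: "\<bar>dpart bs (\<lambda>y. cvk (y, g)) y\<bar> \<le> K * majorant g" if "y \<in> ball x e" for y g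
      using that by (simp only: prod.collapse)
    obtain e' where e': "0 < e'" "ball x e' \<subseteq> ?S" using S x by (meson open_contains_ball)
    show "\<exists>e>0. \<exists>B. integrable lborel B \<and> (\<forall>y\<in>ball x e. \<forall>g\<in>space lborel. \<bar>dpart bs (\<lambda>y. ?F y g) y\<bar> \<le> B g)"
    proof (rule exI[of _ "min e e'"], intro conjI exI[of _ "\<lambda>g. C * (K * majorant g)"] ballI)
      show "integrable lborel (\<lambda>g. C * (K * majorant g))"
        by (intro integrable_mult_right majorant_integrable)
      fix y g assume y: "y \<in> ball x (min e e')"
      then have "y \<in> ?S" using e'(2) by auto
      moreover have "\<bar>dpart bs (\<lambda>y. cvk (y, g)) y\<bar> * \<bar>\<Phi> g\<bar> \<le> K * majorant g * C"
        using K[of y g] y by (intro mult_mono \<Phi>_le) auto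
      ultimately show "\<bar>dpart bs (\<lambda>y. ?F y g) y\<bar> \<le> C * (K * majorant g)"
        by (subst dF[OF bs]) (simp_all only: abs_mult mult_ac)
    qed (use e e' in auto)
  qed
  have eq: "extn \<Phi> y = (\<integral>g. ?F y g \<partial>lborel)" if "y \<in> ?S" for y
    using extn_eq_cvk[of "fst y" "snd y"] that by auto
  have "Ck 2 ?S (extn \<Phi>) = Ck 2 ?S (\<lambda>y. \<integral>g. ?F y g \<partial>lborel)" by (rule Ck_cong[OF S eq])
  then show Ck: "Ck 2 ?S (extn \<Phi>)" using conjunct1[OF DUI] by (rule ssubst)
  assume z: "z \<in> ?S"
  note DUI2 = conjunct2[OF DUI, rule_format, OF _ _ z]
  have dz: "dpart bs (extn \<Phi>) z = (\<integral>g. dpart bs (\<lambda>y. ?F y g) z \<partial>lborel)"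
    if "set bs \<subseteq> Basis" "length bs \<le> 2" for bs
    by (rule trans[OF dpart_cong_open[OF S z eq] conjunct2[OF DUI2[OF that]]])
  have iz: "integrable lborel (\<lambda>g. dpart bs (\<lambda>y. ?F y g) z)"
    if "set bs \<subseteq> Basis" "length bs \<le> 2" for bs
    by (rule conjunct1[OF DUI2[OF that]])
  have Z1: "Ck 1 UNIV (Z j)" if "j < m" for j using that by (rule smooth_Z)
  have zero: "heat_op m Z (\<lambda>y. ?F y g) z = 0" for g
  proof -
    have "heat_op m Z (\<lambda>y. ?F y g) z = heat_op m Z (\<lambda>y. cvk (y, g)) z * \<Phi> g"
      by (rule heat_op_mult_const[OF S cvk_Ck Z1 z])
    also have "heat_op m Z (\<lambda>y. cvk (y, g)) z = 0"
    proof -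
      \<comment> \<open>For fixed \<open>g\<close> this is \<open>\<gamma>\<close> after left
        translation by the inverse of \<open>g\<close>, which commutes with the operator. Positive
        time keeps the translated point off the pole.\<close>
      have eqk: "(\<lambda>y. cvk (y, g)) = (\<lambda>(t, x). \<gamma> (1\<^sup>2 * t + 0, gm (gi g) x))" by (auto simp: cvk_def)
      have rel: "frechet_derivative (gm (gi g)) (at x) (Z j x) = 1 *\<^sub>R Z j (gm (gi g) x)" if "j < m" for j x
        using left_Z[OF that] by simp
      have nz: "(1\<^sup>2 * fst z + 0, gm (gi g) (snd z)) \<in> - {0}" using z by (auto simp: zero_prod_def)
      note r = heat_related[where T="- {0}" and Z=Z and W=Z and m=m,
          OF open_Compl[OF closed_singleton] weak_kernel_Ck[OF kernel] gm_differentiable rel Z1 nz]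
      have "heat_op m Z (\<lambda>y. cvk (y, g)) (fst z, snd z) = heat_op m Z \<gamma> (1\<^sup>2 * fst z + 0, gm (gi g) (snd z))"
        unfolding heat_op_subl eqk using r by simp
      then show ?thesis using weak_kernel_heat_eq[OF kernel] nz by simp
    qed
    finally show ?thesis by simp
  qed
  have "heat_op m Z (extn \<Phi>) z = (\<integral>g. heat_op m Z (\<lambda>y. ?F y g) z \<partial>lborel)"
  proof (rule heat_op_integral[OF S Ck F_Ck Z1 z])
    fix bs :: "(real \<times> 'a) list" assume bs: "set bs \<subseteq> Basis" "length bs \<le> 2"
    show "has_bochner_integral lborel (\<lambda>g. dpart bs (\<lambda>y. ?F y g) z) (dpart bs (extn \<Phi>) z)"
      unfolding dz[OF bs] by (rule has_bochner_integral_integrable[OF iz[OF bs]])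
  qed
  then show "heat_op m Z (extn \<Phi>) z = 0" unfolding zero by simp
qed

end

end

section \<open>Uniqueness of bounded solutions\<close>

lemma heat_op_cong_open:
  assumes "open S" "z \<in> S" "\<And>y. y \<in> S \<Longrightarrow> f y = g y"
  shows "heat_op m V f z = heat_op m V g z"
proof -
  have "vf (liftx (V j)) f y = vf (liftx (V j)) g y" if "y \<in> S" for j y
    by (rule vf_cong_open[OF assms(1) that assms(3)])
  then have "vf (liftx (V j)) (vf (liftx (V j)) f) z = vf (liftx (V j)) (vf (liftx (V j)) g) z" for j
    by (intro vf_cong_open[OF assms(1,2)])
  then show ?thesis
    using pd_cong_open[OF assms, where b="(1, 0)"] by (simp add: heat_op_def)
qed

lemma vf_linear_combination:
  fixes f g :: "'a::euclidean_space \<Rightarrow> real"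
  assumes "f differentiable (at x)" "g differentiable (at x)"
  shows "vf V (\<lambda>y. a * f y + b * g y) x = a * vf V f x + b * vf V g x"
    and "pd c (\<lambda>y. a * f y + b * g y) x = a * pd c f x + b * pd c g x"
proof -
  note D = has_derivative_add[OF has_derivative_mult_right[OF frechet_derivative_worksI[OF assms(1)]]
      has_derivative_mult_right[OF frechet_derivative_worksI[OF assms(2)]]]
  show "vf V (\<lambda>y. a * f y + b * g y) x = a * vf V f x + b * vf V g x"
    unfolding has_derivative_vf[OF D] vf_eq_frechet[OF assms(1)] vf_eq_frechet[OF assms(2)] ..
  show "pd c (\<lambda>y. a * f y + b * g y) x = a * pd c f x + b * pd c g x"
    unfolding has_derivative_pd[OF D] by (simp add: pd_def)
qed

lemma heat_op_linear_combination:
  fixes f g :: "real \<times> 'a::euclidean_space \<Rightarrow> real"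
  assumes S: "open S" and f: "Ck 2 S f" and g: "Ck 2 S g" and V: "\<And>j. j < m \<Longrightarrow> Ck 1 UNIV (V j)" and z: "z \<in> S"
  shows "heat_op m V (\<lambda>y. a * f y + b * g y) z = a * heat_op m V f z + b * heat_op m V g z"
proof -
  have d: "h differentiable (at y)" if "Ck 2 S h" "y \<in> S" for h :: "real \<times> 'a \<Rightarrow> real" and y
    using Ck_differentiable[OF that(1) _ that(2)] by simp
  have "vf (liftx (V j)) (vf (liftx (V j)) (\<lambda>y. a * f y + b * g y)) z =
      a * vf (liftx (V j)) (vf (liftx (V j)) f) z + b * vf (liftx (V j)) (vf (liftx (V j)) g) z" if j: "j < m" for j
  proof -
    have v1: "vf (liftx (V j)) h differentiable (at z)" if "Ck 2 S h" for h
      using Ck_differentiable[OF Ck_vf_less[OF S that _ Ck_subset[OF Ck_liftx[OF V[OF j]] subset_UNIV]] _ z] by simp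
    have "vf (liftx (V j)) (vf (liftx (V j)) (\<lambda>y. a * f y + b * g y)) z =
        vf (liftx (V j)) (\<lambda>y. a * vf (liftx (V j)) f y + b * vf (liftx (V j)) g y) z"
      by (rule vf_cong_open[OF S z]) (rule vf_linear_combination(1)[OF d[OF f] d[OF g]])
    then show ?thesis using vf_linear_combination(1)[OF v1[OF f] v1[OF g]] by simp
  qed
  then have "subl m V (\<lambda>y. a * f y + b * g y) z = a * subl m V f z + b * subl m V g z"
    by (simp add: subl_def sum.distrib sum_distrib_left)
  then show ?thesis
    using vf_linear_combination(2)[OF d[OF f z] d[OF g z]] by (simp add: heat_op_subl algebra_simps)
qed

lemma heat_op_space:
  fixes f :: "'a::euclidean_space \<Rightarrow> real"
  assumes f: "Ck 2 UNIV f" and V: "\<And>j. j < m \<Longrightarrow> Ck 1 UNIV (V j)"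
  shows "heat_op m V (\<lambda>z. f (snd z)) z = (\<Sum>j<m. vf (V j) (vf (V j) f) (snd z))"
proof -
  have lift: "vf (liftx W) (\<lambda>z. g (snd z)) y = vf W g (snd y)" "pd (1, 0) (\<lambda>z. g (snd z)) y = 0"
    if "Ck 1 UNIV g" for W and g :: "'a \<Rightarrow> real" and y :: "real \<times> 'a"
  proof -
    have "g differentiable (at (snd y))" using Ck_differentiable[OF that] by simp
    from vf_liftx_prod[OF this, of "\<lambda>_. 1" "fst y"]
    show "vf (liftx W) (\<lambda>z. g (snd z)) y = vf W g (snd y)" "pd (1, 0) (\<lambda>z. g (snd z)) y = 0"
      by (simp_all add: has_derivative_pd[OF has_derivative_const])
  qed
  have f1: "Ck 1 UNIV f" by (rule Ck_mono[OF f]) simp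
  have "vf (liftx (V j)) (vf (liftx (V j)) (\<lambda>z. f (snd z))) z = vf (V j) (vf (V j) f) (snd z)" if j: "j < m" for j
  proof -
    have "vf (liftx (V j)) (\<lambda>z. f (snd z)) = (\<lambda>z. vf (V j) f (snd z))" using lift(1)[OF f1] by blast
    moreover have "Ck 1 UNIV (vf (V j) f)" by (rule Ck_vf_less[OF _ f _ V[OF j]]) auto
    ultimately show ?thesis using lift(1) by simp
  qed
  then show ?thesis by (simp add: heat_op_def lift(2)[OF f1])
qed

lemma Ck_snd_comp: "Ck k UNIV f \<Longrightarrow> Ck k UNIV (\<lambda>z::real \<times> 'a::euclidean_space. f (snd z))"
  by (rule Ck_compose_UNIV[where g=snd and f=f]) (auto intro: Ck_linear bounded_linear_snd)

text \<open>The barrier is a rescaled bump \<open>\<theta> \<circ> \<delta>\<^sub>r\<close> with \<open>r \<rightarrow> 0\<close>: by homogeneity its image under the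
  sum of squares is \<open>O(r\<^sup>2)\<close>, so no growing supersolution is needed.\<close>

lemma heat_cauchy_min_principle:
  fixes \<omega> :: "'a::euclidean_space" and v :: "real \<times> 'a \<Rightarrow> real"
  assumes \<omega>: "\<And>b. b \<in> Basis \<Longrightarrow> 1 \<le> \<omega> \<bullet> b"
    and X: "\<And>j. j < m \<Longrightarrow> Ck 1 UNIV (X j)"
    and dl_X: "\<And>j r x. j < m \<Longrightarrow> 0 < r \<Longrightarrow> dl \<omega> r (X j x) = r *\<^sub>R X j (dl \<omega> r x)"
    and v: "Ck 2 ({0<..} \<times> UNIV) v" "continuous_on ({0..} \<times> UNIV) v"
    and heat: "\<And>z. z \<in> {0<..} \<times> UNIV \<Longrightarrow> heat_op m X v z = 0"
    and init: "\<And>x. 0 \<le> v (0, x)" and bound: "\<And>z. z \<in> {0<..} \<times> UNIV \<Longrightarrow> \<bar>v z\<bar> \<le> M"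
    and z0: "z0 \<in> {0<..} \<times> UNIV"
  shows "0 \<le> v z0"
proof (rule ccontr)
  assume "\<not> 0 \<le> v z0"
  then have neg: "v z0 < 0" by simp
  define t0 where "t0 = fst z0"
  define x0 where "x0 = snd z0"
  have z0_eq: "z0 = (t0, x0)" and t0: "0 < t0" using z0 by (auto simp: t0_def x0_def)
  have M: "0 \<le> M" using bound[OF z0] by linarith
  let ?S = "{0::real<..} \<times> (UNIV :: 'a set)"
  have S: "open ?S" by (intro open_Times) auto
  define \<kappa> where "\<kappa> = flat 1"
  have \<kappa>: "0 < \<kappa>" by (simp add: \<kappa>_def)
  \<comment> \<open>An inverted bump, vanishing at the origin and equal to the positive constant
    \<open>\<kappa>\<close> outside the unit ball. Contracting by small \<open>r\<close> makes its
    value at \<open>x0\<close> as small as desired while it remains \<open>\<kappa>\<close> far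
    out.\<close>
  define \<theta> :: "'a \<Rightarrow> real" where "\<theta> x = \<kappa> - bump 0 1 x" for x
  have \<theta>_Ck: "Ck k UNIV \<theta>" for k unfolding \<theta>_def by (intro Ck_diff Ck_bump) auto
  have \<theta>0: "\<theta> 0 = 0" by (simp add: \<theta>_def bump_def \<kappa>_def)
  have \<theta>1: "\<theta> x = \<kappa>" if "x \<notin> cball 0 1" for x
    using bump_eq_0[of 1 x 0] that by (simp add: \<theta>_def)
  have flat_mono: "flat s \<le> flat 1" if "s \<le> 1" for s
  proof (cases "s \<le> 0")
    case False
    then have "1 \<le> 1 / s" using that by simp
    then show ?thesis using False by (simp add: flat_def)
  qed (simp add: flat_def)
  have \<theta>_nonneg: "0 \<le> \<theta> x" for x
    unfolding \<theta>_def \<kappa>_def bump_def using flat_mono by simp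
  define \<Lambda> where "\<Lambda> x = (\<Sum>j<m. vf (X j) (vf (X j) \<theta>) x)" for x
  have vf1: "Ck 1 UNIV (vf (X j) \<theta>)" if "j < m" for j
    by (rule Ck_vf[OF open_UNIV X[OF that] \<theta>_Ck])
  have \<Lambda>_Ck: "Ck 0 UNIV \<Lambda>"
    unfolding \<Lambda>_def[abs_def]
    by (intro Ck_sum open_UNIV Ck_vf_less[OF open_UNIV vf1] Ck_mono[OF X]) auto
  have \<Lambda>0: "\<Lambda> x = 0" if x: "x \<notin> cball 0 1" for x
  proof -
    have op: "open (- cball (0::'a) 1)" by auto
    have vf_const: "vf W (\<lambda>_. c) y = 0" for W :: "'a \<Rightarrow> 'a" and c :: real and y
      by (simp add: vf_def has_derivative_pd[OF has_derivative_const])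
    have 1: "vf W \<theta> y = 0" if "y \<in> - cball 0 1" for W y
      using vf_cong_open[OF op that, of \<theta> "\<lambda>_. \<kappa>" W] \<theta>1 vf_const by simp
    have "vf W (vf W \<theta>) x = 0" for W
      using vf_cong_open[OF op, of x "vf W \<theta>" "\<lambda>_. 0" W] 1 x vf_const by simp
    then show ?thesis by (simp add: \<Lambda>_def)
  qed
  obtain C where C: "0 \<le> C" "\<And>x. \<bar>\<Lambda> x\<bar> \<le> C"
    using bounded_of_compact_support[OF compact_cball \<Lambda>0 continuous_on_subset[OF Ck_continuous[OF \<Lambda>_Ck] subset_UNIV]] by blast
  \<comment> \<open>With this factor the barrier equals \<open>M\<close> far out and outweighs the
    lower bound \<open>- M\<close> of \<open>v\<close>.\<close>
  define A where "A = M / \<kappa>"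
  have A: "0 \<le> A" "A * \<kappa> = M" using M \<kappa> by (auto simp: A_def)
  \<comment> \<open>A third of \<open>\<bar>v z0\<bar>\<close> is allotted to the barrier terms at
    \<open>z0\<close> and a third to \<open>\<epsilon> * t0\<close>, so the corrected function is
    still negative at \<open>z0\<close>.\<close>
  define \<epsilon> where "\<epsilon> = - v z0 / (3 * t0)"
  have \<epsilon>: "0 < \<epsilon>" "\<epsilon> * t0 = - v z0 / 3" using neg t0 by (auto simp: \<epsilon>_def divide_neg_pos field_simps)
  have "((\<lambda>r. A * \<theta> (dl \<omega> r x0) + A * C * r\<^sup>2 * t0) \<longlongrightarrow> A * \<theta> 0 + A * C * 0\<^sup>2 * t0) (at_right 0)"
  proof (intro tendsto_intros)
    have "isCont \<theta> 0" using Ck_continuous[OF \<theta>_Ck[of 0]] continuous_on_eq_continuous_at[OF open_UNIV] by blast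
    moreover have "((\<lambda>r. dl \<omega> r x0) \<longlongrightarrow> 0) (at_right 0)"
    proof (rule dl_tendsto_0)
      show "0 < \<omega> \<bullet> b" if "b \<in> Basis" for b using \<omega>[OF that] by linarith
    qed
    ultimately show "((\<lambda>r. \<theta> (dl \<omega> r x0)) \<longlongrightarrow> \<theta> 0) (at_right 0)" by (rule isCont_tendsto_compose)
  qed
  then have "\<forall>\<^sub>F r in at_right 0. A * \<theta> (dl \<omega> r x0) + A * C * r\<^sup>2 * t0 < - v z0 / 3"
    using neg by (intro order_tendstoD(2)) (auto simp: \<theta>0)
  moreover have "\<forall>\<^sub>F r in at_right 0. (0::real) < r" by (simp add: eventually_at_right_less)
  ultimately have "\<forall>\<^sub>F r in at_right 0. 0 < r \<and> A * \<theta> (dl \<omega> r x0) + A * C * r\<^sup>2 * t0 < - v z0 / 3"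
    by eventually_elim auto
  then obtain r where r: "0 < r" and small: "A * \<theta> (dl \<omega> r x0) + A * C * r\<^sup>2 * t0 < - v z0 / 3"
    using eventually_happens'[OF trivial_limit_at_right_real] by blast
  \<comment> \<open>The first summand of the slope absorbs the sum of squares of the barrier, which
    is at most \<open>A * C * r\<^sup>2\<close>; the second makes the inequality strict.\<close>
  define k where "k = A * C * r\<^sup>2 + \<epsilon>"
  have k: "0 \<le> k" using A C \<epsilon> by (simp add: k_def)
  define \<theta>r where "\<theta>r x = \<theta> (dl \<omega> r x)" for x
  have \<theta>r_Ck: "Ck n UNIV \<theta>r" for n
    unfolding \<theta>r_def[abs_def] by (intro Ck_compose_UNIV[OF _ _ \<theta>_Ck] Ck_linear bounded_linear_dl) auto
  define W where "W z = 1 * v z + A * \<theta>r (snd z) + k * fst z" for z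
  have W_z0: "W z0 < 0"
  proof -
    have "W z0 = v z0 + A * \<theta> (dl \<omega> r x0) + (A * C * r\<^sup>2 + \<epsilon>) * t0"
      by (simp add: W_def z0_eq \<theta>r_def k_def)
    also have "\<dots> = v z0 + (A * \<theta> (dl \<omega> r x0) + A * C * r\<^sup>2 * t0) + \<epsilon> * t0" by (simp add: algebra_simps)
    finally show ?thesis using small \<epsilon>(2) neg by linarith
  qed
  let ?K = "{0..t0} \<times> dl \<omega> (1 / r) ` cball 0 1"
  have outside: "0 \<le> W (t, x)" if "0 \<le> t" "t = 0 \<or> x \<notin> dl \<omega> (1 / r) ` cball 0 1" for t x
  proof (cases "t = 0")
    case True
    then show ?thesis using init[of x] A \<theta>_nonneg by (simp add: W_def \<theta>r_def)
  next
    case False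
    then have "x \<notin> dl \<omega> (1 / r) ` cball 0 1" using that by simp
    then have "dl \<omega> r x \<notin> cball 0 1" using dl_inverse(2)[OF r] by (metis imageI)
    then have "A * \<theta>r x = M" using \<theta>1 A by (simp add: \<theta>r_def)
    moreover have "- M \<le> v (t, x)" using bound[of "(t, x)"] False that by auto
    moreover have "0 \<le> k * t" using k that by simp
    ultimately show ?thesis by (simp add: W_def)
  qed
  have K: "compact ?K"
    by (intro compact_Times compact_continuous_image linear_continuous_on bounded_linear_dl) auto
  have z0K: "z0 \<in> ?K" using outside[of t0 x0] W_z0 t0 by (auto simp: z0_eq)
  have "continuous_on ?K W"
    unfolding W_def
    by (intro continuous_on_add continuous_on_mult continuous_on_const continuous_on_fst continuous_on_id
        continuous_on_subset[OF v(2)] continuous_on_subset[OF Ck_continuous[OF Ck_snd_comp[OF \<theta>r_Ck[of 0]]]]) auto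
  then obtain z1 where z1: "z1 \<in> ?K" "\<forall>z\<in>?K. W z1 \<le> W z"
    using continuous_attains_inf[OF K] z0K by (metis empty_iff)
  have Wz1: "W z1 < 0" using z1(2)[rule_format, OF z0K] W_z0 by linarith
  obtain t1 x1 where z1_eq: "z1 = (t1, x1)" by (cases z1)
  \<comment> \<open>The minimum is negative, so it cannot lie at time 0. The case
    \<open>t1 = t0\<close> is harmless because \<open>heat_op_nonneg_at_min\<close> looks only at
    the past.\<close>
  have t1: "0 < t1" "t1 \<le> t0" using z1(1) Wz1 outside[of t1 x1] by (auto simp: z1_eq less_le)
  have min: "W (t1, x1) \<le> W (t, x)" if "0 < t" "t \<le> t1" for t x
  proof (cases "x \<in> dl \<omega> (1 / r) ` cball 0 1")
    case True
    then show ?thesis using z1(2) that t1 by (auto simp: z1_eq)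
  next
    case False
    then show ?thesis using outside[of t x] that Wz1 by (auto simp: z1_eq)
  qed
  let ?B = "\<lambda>z. 1 * v z + A * \<theta>r (snd z)"
  have B_Ck: "Ck 2 ?S ?B"
    by (intro Ck_add Ck_cmult S v(1) Ck_subset[OF Ck_snd_comp[OF \<theta>r_Ck]]) auto
  have time_Ck: "Ck 2 ?S (\<lambda>z. k * fst z)"
    by (intro Ck_cmult S Ck_linear bounded_linear_fst)
  have W_Ck: "Ck 2 ?S W" unfolding W_def[abs_def] by (rule Ck_add[OF S B_Ck time_Ck])
  have z1S: "(t1, x1) \<in> ?S" using t1 by simp
  have "0 \<le> heat_op m X W (t1, x1)"
    by (rule heat_op_nonneg_at_min[OF S W_Ck X z1S t1(1)]) (use min in auto)
  moreover have "heat_op m X W (t1, x1) = heat_op m X ?B (t1, x1) - k"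
    unfolding W_def[abs_def]
    by (rule heat_op_add_time[OF S B_Ck z1S, of "\<lambda>t. k * t" "\<lambda>_. k"]) (auto intro!: derivative_eq_intros)
  moreover have "heat_op m X ?B (t1, x1) = 1 * heat_op m X v (t1, x1) + A * heat_op m X (\<lambda>z. \<theta>r (snd z)) (t1, x1)"
    by (rule heat_op_linear_combination[OF S v(1) Ck_subset[OF Ck_snd_comp[OF \<theta>r_Ck] subset_UNIV] X z1S])
  moreover have "heat_op m X (\<lambda>z. \<theta>r (snd z)) (t1, x1) = r\<^sup>2 * \<Lambda> (dl \<omega> r x1)"
  proof -
    have d: "dl \<omega> r differentiable (at x)" for x
      by (rule differentiableI[OF bounded_linear_imp_has_derivative[OF bounded_linear_dl]])
    have rel: "frechet_derivative (dl \<omega> r) (at x) (X j x) = r *\<^sub>R X j (dl \<omega> r x)" if "j < m" for j x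
      using dl_X[OF that r] frechet_derivative_at[OF bounded_linear_imp_has_derivative[OF bounded_linear_dl], of \<omega> r x]
      by metis
    have diff: "f differentiable (at y)" if "Ck 1 UNIV f" for f :: "'a \<Rightarrow> real" and y
      using Ck_differentiable[OF that] by simp
    have scale: "vf (X j) (\<lambda>x. f (dl \<omega> r x)) x = r * vf (X j) f (dl \<omega> r x)"
      if "j < m" "Ck 1 UNIV f" for j x and f :: "'a \<Rightarrow> real"
      by (rule vf_related[where h="dl \<omega> r" and f=f and Y="X j" and W="X j", OF d diff[OF that(2)] rel[OF that(1)]])
    have "vf (X j) (vf (X j) \<theta>r) x = r\<^sup>2 * vf (X j) (vf (X j) \<theta>) (dl \<omega> r x)" if j: "j < m" for j x
    proof -
      have 1: "vf (X j) \<theta>r = (\<lambda>x. r * vf (X j) \<theta> (dl \<omega> r x) + 0 * 0)"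
        unfolding \<theta>r_def[abs_def] using scale[OF j \<theta>_Ck] by auto
      have "Ck 1 UNIV (\<lambda>x. vf (X j) \<theta> (dl \<omega> r x))"
        by (intro Ck_compose_UNIV[OF _ _ vf1[OF j]] Ck_linear bounded_linear_dl) auto
      from vf_linear_combination(1)[OF diff[OF this] differentiable_const[of 0], of "X j" r 0 x]
      show ?thesis
        unfolding 1 scale[OF j vf1[OF j]] by (simp add: power2_eq_square)
    qed
    then show ?thesis
      using heat_op_space[OF \<theta>r_Ck X] by (simp add: \<Lambda>_def sum_distrib_left)
  qed
  ultimately have "0 \<le> A * (r\<^sup>2 * \<Lambda> (dl \<omega> r x1)) - k" using heat[OF z1S] by simp
  moreover have "A * (r\<^sup>2 * \<Lambda> (dl \<omega> r x1)) \<le> A * (r\<^sup>2 * C)"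
    using C(2)[of "dl \<omega> r x1"] A by (intro mult_left_mono) auto
  ultimately show False using \<epsilon>(1) by (simp add: k_def algebra_simps)
qed

section \<open>The lifted group\<close>

lemma dil_eq_dl: "dil \<sigma> r x = dl \<sigma> r x"
  by (simp add: vec_eq_iff dil_def cart_eq_inner_axis[of "dl \<sigma> r x"] dl_inner)
    (simp add: cart_eq_inner_axis)

lemma Dil_eq_dl: "Dil \<sigma> \<sigma>' r z = dl (\<sigma>, \<sigma>') r z"
  by (cases z) (simp add: Dil_def dil_eq_dl dl_Pair)

lemma vf_inner:
  fixes h :: "'a::euclidean_space \<Rightarrow> 'b::euclidean_space"
  assumes "h differentiable (at z)"
  shows "vf V (\<lambda>y. h y \<bullet> b) z = frechet_derivative h (at z) (V z) \<bullet> b"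
  using has_derivative_vf[OF has_derivative_inner_left[OF frechet_derivative_worksI[OF assms]]] .

lemma vf_coordinate: "vf V (\<lambda>y. y \<bullet> b) z = V z \<bullet> b"
  using vf_inner[of "\<lambda>y. y" z V b] by simp

lemma smooth_coordinate: "smooth (\<lambda>y::'a::euclidean_space. y \<bullet> b)"
  unfolding smooth_on_iff_Ck by (intro allI Ck_inner Ck_ident Ck_const open_UNIV)

text \<open>Homogeneity is assumed for the field as a derivation. Testing it on the coordinate
  functions turns it into an identity of coefficient vectors.\<close>

lemma field_dl_of_homogeneous:
  fixes V :: "'a::euclidean_space \<Rightarrow> 'a"
  assumes "\<And>f::'a \<Rightarrow> real. smooth f \<Longrightarrow> vf V (f \<circ> dl \<omega> r) z = r * vf V f (dl \<omega> r z)"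
  shows "dl \<omega> r (V z) = r *\<^sub>R V (dl \<omega> r z)"
proof (rule euclidean_eqI)
  fix b :: 'a assume "b \<in> Basis"
  have "vf V (\<lambda>y. dl \<omega> r y \<bullet> b) z = dl \<omega> r (V z) \<bullet> b"
    by (rule has_derivative_vf[OF has_derivative_inner_left[OF bounded_linear_imp_has_derivative[OF bounded_linear_dl]]])
  then show "dl \<omega> r (V z) \<bullet> b = (r *\<^sub>R V (dl \<omega> r z)) \<bullet> b"
    using assms[OF smooth_coordinate, of b] by (simp add: o_def vf_coordinate)
qed

section \<open>Uniqueness for ordinary differential equations and the descent of right
  translations\<close>

lemma C1_lipschitz_on_ball:
  fixes A :: "'a::euclidean_space \<Rightarrow> 'b::real_normed_vector"
  assumes A: "Ck 1 UNIV A"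
  obtains L where "0 \<le> L" "\<And>x y. x \<in> cball 0 R \<Longrightarrow> y \<in> cball 0 R \<Longrightarrow> norm (A x - A y) \<le> L * norm (x - y)"
proof -
  have "\<exists>C. \<forall>x\<in>cball 0 R. norm (pd b A x) \<le> C" if "b \<in> Basis" for b
  proof -
    have "Ck 0 UNIV (pd b A)" by (rule Ck_pd_less[OF A _ that]) simp
    then have "continuous_on (cball 0 R) (pd b A)" using continuous_on_subset by auto
    then have "bounded (pd b A ` cball 0 R)" by (intro compact_imp_bounded compact_continuous_image) auto
    then show ?thesis by (auto simp only: bounded_iff)
  qed
  then obtain C where C: "\<And>b x. b \<in> Basis \<Longrightarrow> x \<in> cball 0 R \<Longrightarrow> norm (pd b A x) \<le> C b" by metis
  define L where "L = (\<Sum>b\<in>Basis. \<bar>C b\<bar>)"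
  have Ad: "A differentiable (at x)" for x using Ck_differentiable[OF A] by simp
  have on: "onorm (frechet_derivative A (at x)) \<le> L" if x: "x \<in> cball 0 R" for x
  proof (rule onorm_le)
    fix h
    have "norm (frechet_derivative A (at x) h) \<le> (\<Sum>b\<in>Basis. norm ((h \<bullet> b) *\<^sub>R pd b A x))"
      unfolding frechet_derivative_pd[OF Ad] by (rule norm_sum)
    also have "\<dots> \<le> (\<Sum>b\<in>Basis. \<bar>C b\<bar> * norm h)"
    proof (rule sum_mono)
      fix b :: 'a assume b: "b \<in> Basis"
      have "norm (pd b A x) \<le> \<bar>C b\<bar>" using C[OF b x] by linarith
      then have "\<bar>h \<bullet> b\<bar> * norm (pd b A x) \<le> norm h * \<bar>C b\<bar>"
        using Basis_le_norm[OF b, of h] by (intro mult_mono) auto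
      then show "norm ((h \<bullet> b) *\<^sub>R pd b A x) \<le> \<bar>C b\<bar> * norm h" by (simp add: mult.commute)
    qed
    finally show "norm (frechet_derivative A (at x) h) \<le> L * norm h" by (simp add: L_def sum_distrib_right)
  qed
  show ?thesis
  proof (rule that[of L])
    show "0 \<le> L" by (simp add: L_def sum_nonneg)
    fix x y :: 'a assume xy: "x \<in> cball 0 R" "y \<in> cball 0 R"
    have "(A has_derivative frechet_derivative A (at z)) (at z within cball 0 R)" for z
      by (rule has_derivative_at_withinI[OF frechet_derivative_worksI[OF Ad]])
    from differentiable_bound[OF convex_cball this on xy]
    show "norm (A x - A y) \<le> L * norm (x - y)" .
  qed
qed

text \<open>The squared norm of \<open>y\<close>, damped by \<open>exp (- (2 * K * s))\<close>, is
  nonincreasing, nonnegative and initially 0.\<close>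

lemma gronwall_zero:
  fixes y :: "real \<Rightarrow> 'a::real_inner"
  assumes y: "\<And>s. 0 \<le> s \<Longrightarrow> s \<le> 1 \<Longrightarrow> (y has_vector_derivative y' s) (at s)"
    and le: "\<And>s. 0 \<le> s \<Longrightarrow> s \<le> 1 \<Longrightarrow> norm (y' s) \<le> K * norm (y s)" and y0: "y 0 = 0"
  shows "y 1 = 0"
proof -
  define q where "q s = exp (- (2 * K * s)) * (y s \<bullet> y s)" for s
  have "q 1 \<le> q 0"
  proof (rule DERIV_nonpos_imp_nonincreasing[where f=q and a=0 and b=1])
    fix s :: real assume s: "0 \<le> s" "s \<le> 1"
    have "((\<lambda>s. y s \<bullet> y s) has_derivative (\<lambda>h. y s \<bullet> (h *\<^sub>R y' s) + (h *\<^sub>R y' s) \<bullet> y s)) (at s)"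
      using y[OF s] unfolding has_vector_derivative_def by (intro has_derivative_inner)
    moreover have "(\<lambda>h. y s \<bullet> (h *\<^sub>R y' s) + (h *\<^sub>R y' s) \<bullet> y s) = (*) (2 * (y s \<bullet> y' s))"
      by (auto simp: inner_commute)
    ultimately have d: "((\<lambda>s. y s \<bullet> y s) has_real_derivative 2 * (y s \<bullet> y' s)) (at s)"
      by (simp add: has_field_derivative_def)
    have "(q has_real_derivative exp (- (2 * K * s)) * (2 * (y s \<bullet> y' s)) + (- (2 * K)) * exp (- (2 * K * s)) * (y s \<bullet> y s)) (at s)"
      unfolding q_def[abs_def] by (auto intro!: derivative_eq_intros d)
    moreover have "exp (- (2 * K * s)) * (2 * (y s \<bullet> y' s)) + (- (2 * K)) * exp (- (2 * K * s)) * (y s \<bullet> y s) \<le> 0"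
    proof -
      have "y s \<bullet> y' s \<le> norm (y s) * norm (y' s)" by (rule norm_cauchy_schwarz)
      also have "\<dots> \<le> norm (y s) * (K * norm (y s))" by (intro mult_left_mono le s) auto
      also have "\<dots> = K * (y s \<bullet> y s)" by (simp add: power2_norm_eq_inner[symmetric] power2_eq_square)
      finally have "2 * (y s \<bullet> y' s) - 2 * K * (y s \<bullet> y s) \<le> 0" by simp
      then have "exp (- (2 * K * s)) * (2 * (y s \<bullet> y' s) - 2 * K * (y s \<bullet> y s)) \<le> 0"
        by (intro mult_nonneg_nonpos) auto
      then show ?thesis by (simp add: algebra_simps)
    qed
    ultimately show "\<exists>d. (q has_real_derivative d) (at s) \<and> d \<le> 0" by blast
  qed simp
  then have "exp (- (2 * K)) * (y 1 \<bullet> y 1) \<le> 0" using y0 by (simp add: q_def)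
  moreover have "0 \<le> y 1 \<bullet> y 1" by simp
  ultimately have "y 1 \<bullet> y 1 = 0" by (smt (verit) exp_gt_zero mult_pos_pos)
  then show ?thesis by simp
qed

text \<open>If the left-invariant fields project along a linear map, so does right translation: both
  projected curves solve the same ordinary differential equation along \<open>s \<mapsto> s g\<close>.\<close>

lemma (in hom_group) right_translation_projects:
  fixes P :: "'a \<Rightarrow> 'c::euclidean_space" and J :: "'c \<Rightarrow> 'a"
  assumes P: "bounded_linear P" and J: "bounded_linear J" and PJ: "\<And>x. P (J x) = x"
    and proj: "\<And>v w w'. P w = P w' \<Longrightarrow>
      P (frechet_derivative (gm w) (at 0) v) = P (frechet_derivative (gm w') (at 0) v)"
    and w: "P w = P w'"
  shows "P (gm w g) = P (gm w' g)"
proof -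
  \<comment> \<open>The vector at \<open>x\<close> of the projected left-invariant field with value
    \<open>v\<close> at the identity. By \<open>proj\<close> it does not depend on the point
    \<open>J x\<close> chosen over \<open>x\<close>.\<close>
  define A where "A v x = P (frechet_derivative (gm (J x)) (at 0) v)" for v x
  \<comment> \<open>The velocity of the line \<open>s \<mapsto> s g\<close>, carried back to the
    identity by left translation. It depends on \<open>s\<close>, as the line need not be a
    one-parameter subgroup, but not on the starting point, so both projected curves obey one
    time-dependent equation.\<close>
  define vel where "vel s = frechet_derivative (gm (gi (s *\<^sub>R g))) (at (s *\<^sub>R g)) g" for s :: real
  let ?G = "\<lambda>p. gm (fst p) (snd p)"
  have Gd: "?G differentiable (at p)" for p by (rule Ck_differentiable[OF smooth_gm[of 1]]) auto
  have slice: "frechet_derivative (gm a) (at z) v = frechet_derivative ?G (at (a, z)) (0, v)" for a z v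
  proof -
    have "((\<lambda>z. ?G (a, z)) has_derivative (\<lambda>h. frechet_derivative ?G (at (a, z)) (0, h))) (at z)"
      by (rule has_derivative_compose[where f="\<lambda>z. (a, z)" and g="?G", OF _ frechet_derivative_worksI[OF Gd]])
        (auto intro!: derivative_eq_intros)
    then have "(gm a has_derivative (\<lambda>h. frechet_derivative ?G (at (a, z)) (0, h))) (at z)" by simp
    then show ?thesis using frechet_derivative_at by metis
  qed
  have lin: "linear (frechet_derivative (gm a) (at z))" for a z
    by (rule linear_frechet_derivative[OF gm_differentiable])
  have G_pd: "Ck 1 UNIV (pd (0, b) ?G)" if "b \<in> Basis" for b
    by (rule Ck_pd_less[OF smooth_gm[of 2]]) (use that in \<open>auto simp: Basis_prod_def\<close>)
  have pd_slice: "frechet_derivative (gm a) (at z) b = pd (0, b) ?G (a, z)" for a z b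
    unfolding slice pd_def ..
  have pd_slice2: "pd b (gm a) z = pd (0, b) ?G (a, z)" for a z b
    unfolding pd_def slice ..
  have A_Ck: "Ck 1 UNIV (A b)" if b: "b \<in> Basis" for b
  proof -
    have "Ck 1 UNIV (\<lambda>x. P (pd (0, b) ?G (J x, 0)))"
      by (intro Ck_bounded_linear[OF P] Ck_compose_UNIV[OF _ _ G_pd[OF b]] Ck_Pair Ck_linear[OF J] Ck_const open_UNIV)
    then show ?thesis by (simp add: A_def[abs_def] pd_slice)
  qed
  have A_sum: "A v x = (\<Sum>b\<in>Basis. (v \<bullet> b) *\<^sub>R A b x)" for v x
  proof -
    have "frechet_derivative (gm (J x)) (at 0) v = (\<Sum>b\<in>Basis. (v \<bullet> b) *\<^sub>R frechet_derivative (gm (J x)) (at 0) b)"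
      using frechet_derivative_pd[OF gm_differentiable, of "J x" 0 v] by (simp add: pd_def)
    then show ?thesis
      unfolding A_def using bounded_linear.linear[OF P] by (simp add: linear_sum linear_scale)
  qed
  have vel_cont: "continuous_on {0..1} vel"
  proof -
    have "vel s = (\<Sum>b\<in>Basis. (g \<bullet> b) *\<^sub>R pd (0, b) ?G (gi (s *\<^sub>R g), s *\<^sub>R g))" for s
      unfolding vel_def frechet_derivative_pd[OF gm_differentiable, of "gi (s *\<^sub>R g)" "s *\<^sub>R g" g] pd_slice2 ..
    moreover have "continuous_on {0..1} (\<lambda>s::real. pd (0, b) ?G (gi (s *\<^sub>R g), s *\<^sub>R g))" if "b \<in> Basis" for b
      by (rule continuous_on_compose2[OF Ck_continuous[OF G_pd[OF that]]])
        (auto intro!: continuous_on_Pair continuous_gi continuous_on_scaleR continuous_on_id continuous_on_const)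
    ultimately show ?thesis by (simp add: continuous_on_sum continuous_on_scaleR)
  qed
  then have "bounded (vel ` {0..1})" by (intro compact_imp_bounded compact_continuous_image) auto
  then obtain B where "\<forall>x\<in>vel ` {0..1}. norm x \<le> B" by (auto simp only: bounded_iff)
  then have B: "norm (vel s) \<le> B" if "s \<in> {0..1}" for s using that by blast
  have curve: "((\<lambda>s. P (gm a (s *\<^sub>R g))) has_vector_derivative A (vel s) (P (gm a (s *\<^sub>R g)))) (at s)" for a s
  proof -
    let ?c = "gm a (s *\<^sub>R g)"
    let ?D = "frechet_derivative (gm ?c) (at 0)" and ?E = "frechet_derivative (gm (gi (s *\<^sub>R g))) (at (s *\<^sub>R g))"
    have "((\<lambda>r. gm (gi (s *\<^sub>R g)) (r *\<^sub>R g)) has_derivative (\<lambda>h. ?E (h *\<^sub>R g))) (at s)"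
      by (rule has_derivative_compose[where f="\<lambda>r. r *\<^sub>R g" and g="gm (gi (s *\<^sub>R g))"])
        (auto intro!: derivative_eq_intros frechet_derivative_worksI gm_differentiable)
    moreover have "gm (gi (s *\<^sub>R g)) (s *\<^sub>R g) = 0" by simp
    ultimately have "((\<lambda>r. gm ?c (gm (gi (s *\<^sub>R g)) (r *\<^sub>R g))) has_derivative (\<lambda>h. ?D (?E (h *\<^sub>R g)))) (at s)"
      by (intro has_derivative_compose[where g="gm ?c" and f="\<lambda>r. gm (gi (s *\<^sub>R g)) (r *\<^sub>R g)"])
        (auto intro!: frechet_derivative_worksI gm_differentiable)
    moreover have "gm ?c (gm (gi (s *\<^sub>R g)) (r *\<^sub>R g)) = gm a (r *\<^sub>R g)" for r by (simp add: assoc)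
    moreover have "?D (?E (h *\<^sub>R g)) = h *\<^sub>R ?D (vel s)" for h
      using linear_scale[OF lin] by (simp add: vel_def)
    ultimately have "((\<lambda>r. gm a (r *\<^sub>R g)) has_derivative (\<lambda>h. h *\<^sub>R ?D (vel s))) (at s)" by simp
    from bounded_linear.has_derivative[OF P this]
    have "((\<lambda>r. P (gm a (r *\<^sub>R g))) has_vector_derivative P (?D (vel s))) (at s)"
      using bounded_linear.linear[OF P] by (simp add: has_vector_derivative_def linear_scale)
    moreover have "P (?D (vel s)) = A (vel s) (P ?c)"
      unfolding A_def by (rule proj) (simp add: PJ)
    ultimately show ?thesis by simp
  qed
  define f where "f a s = P (gm a (s *\<^sub>R g))" for a and s :: real
  have f: "(f a has_vector_derivative A (vel s) (f a s)) (at s)" for a s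
    unfolding f_def[abs_def] by (rule curve)
  have "continuous_on {0..1} (f a)" for a
    by (intro continuous_at_imp_continuous_on ballI has_derivative_continuous[OF f[unfolded has_vector_derivative_def]])
  then have "bounded (f a ` {0..1})" for a by (intro compact_imp_bounded compact_continuous_image) auto
  then have "\<exists>R. \<forall>s\<in>{0..1}. norm (f a s) \<le> R" for a by (auto simp: bounded_iff)
  then obtain R1 R2 where R12: "\<forall>s\<in>{0..1}. norm (f w s) \<le> R1" "\<forall>s\<in>{0..1}. norm (f w' s) \<le> R2" by meson
  define R where "R = max R1 R2"
  have R: "f w s \<in> cball 0 R" "f w' s \<in> cball 0 R" if "s \<in> {0..1}" for s
    using R12 that by (auto simp: R_def le_max_iff_disj)
  have "\<exists>L. 0 \<le> L \<and> (\<forall>x\<in>cball 0 R. \<forall>y\<in>cball 0 R. norm (A b x - A b y) \<le> L * norm (x - y))" if b: "b \<in> Basis" for b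
    by (rule C1_lipschitz_on_ball[OF A_Ck[OF b], of R]) blast
  then obtain L where L: "\<And>b. b \<in> Basis \<Longrightarrow> 0 \<le> L b"
    "\<And>b x y. b \<in> Basis \<Longrightarrow> x \<in> cball 0 R \<Longrightarrow> y \<in> cball 0 R \<Longrightarrow> norm (A b x - A b y) \<le> L b * norm (x - y)"
    by metis
  have "f w 1 - f w' 1 = 0"
  \<comment> \<open>\<open>B\<close> bounds the components of the velocity and \<open>L b\<close> is
    a Lipschitz constant of the projected coordinate field on a ball containing both curves.\<close>
  proof (rule gronwall_zero[where y="\<lambda>s. f w s - f w' s" and K="\<Sum>b\<in>Basis. B * L b"])
    show "((\<lambda>s. f w s - f w' s) has_vector_derivative A (vel s) (f w s) - A (vel s) (f w' s)) (at s)" for s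
      by (intro has_vector_derivative_diff f)
    show "f w 0 - f w' 0 = 0" using w by (simp add: f_def)
    fix s :: real assume "0 \<le> s" "s \<le> 1"
    then have s: "s \<in> {0..1}" by simp
    have "norm (A (vel s) (f w s) - A (vel s) (f w' s)) = norm (\<Sum>b\<in>Basis. (vel s \<bullet> b) *\<^sub>R (A b (f w s) - A b (f w' s)))"
      unfolding A_sum[of "vel s"] by (simp add: sum_subtractf scaleR_diff_right)
    also have "\<dots> \<le> (\<Sum>b\<in>Basis. norm ((vel s \<bullet> b) *\<^sub>R (A b (f w s) - A b (f w' s))))" by (rule norm_sum)
    also have "\<dots> \<le> (\<Sum>b\<in>Basis. B * (L b * norm (f w s - f w' s)))"
    proof (rule sum_mono)
      fix b :: 'a assume b: "b \<in> Basis"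
      have "\<bar>vel s \<bullet> b\<bar> \<le> B" using Basis_le_norm[OF b, of "vel s"] B[OF s] by linarith
      moreover have "norm (A b (f w s) - A b (f w' s)) \<le> L b * norm (f w s - f w' s)"
        by (rule L(2)[OF b R[OF s]])
      ultimately show "norm ((vel s \<bullet> b) *\<^sub>R (A b (f w s) - A b (f w' s))) \<le> B * (L b * norm (f w s - f w' s))"
        unfolding norm_scaleR by (intro mult_mono) auto
    qed
    finally show "norm (A (vel s) (f w s) - A (vel s) (f w' s)) \<le> (\<Sum>b\<in>Basis. B * L b) * norm (f w s - f w' s)"
      by (simp add: sum_distrib_right mult.assoc)
  qed
  then show ?thesis by (simp add: f_def)
qed

lemma frechet_left_translation:
  fixes G :: "'a::euclidean_space \<Rightarrow> 'a"
  assumes G: "G differentiable (at z)"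
    and left: "\<And>f::'a \<Rightarrow> real. smooth f \<Longrightarrow> vf V (\<lambda>y. f (G y)) z = vf V f (G z)"
  shows "frechet_derivative G (at z) (V z) = V (G z)"
proof (rule euclidean_eqI)
  fix b :: 'a
  show "frechet_derivative G (at z) (V z) \<bullet> b = V (G z) \<bullet> b"
    using left[OF smooth_coordinate, of b] by (simp add: vf_inner[OF G] vf_coordinate)
qed

section \<open>The concrete lift as an instance of the abstract setting\<close>

locale lifted_group =
  fixes m :: nat
    and X :: "nat \<Rightarrow> real^'n \<Rightarrow> real^'n"
    and \<sigma> :: "real^'n" and \<sigma>' :: "real^'p"
    and gop :: "(real^'n) \<times> (real^'p) \<Rightarrow> (real^'n) \<times> (real^'p) \<Rightarrow> (real^'n) \<times> (real^'p)"
    and ginv :: "(real^'n) \<times> (real^'p) \<Rightarrow> (real^'n) \<times> (real^'p)"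
    and Z :: "nat \<Rightarrow> (real^'n) \<times> (real^'p) \<Rightarrow> (real^'n) \<times> (real^'p)"
  assumes hX: "hyp_X m X \<sigma> TYPE('p)" and hG: "carnot_lift m X \<sigma> \<sigma>' gop ginv Z"
begin

lemmas lift_assoc = hG[unfolded carnot_lift_def, THEN conjunct1, rule_format]
  and lift_group = hG[unfolded carnot_lift_def, THEN conjunct2, THEN conjunct1, rule_format]
  and lift_dil = hG[unfolded carnot_lift_def, THEN conjunct2, THEN conjunct2, THEN conjunct2, THEN conjunct2, THEN conjunct2, THEN conjunct1, rule_format]
  and lift_smooth_Z = hG[unfolded carnot_lift_def, THEN conjunct2, THEN conjunct2, THEN conjunct2, THEN conjunct2, THEN conjunct2, THEN conjunct2, THEN conjunct1, rule_format]
  and lift_left = hG[unfolded carnot_lift_def, THEN conjunct2, THEN conjunct2, THEN conjunct2, THEN conjunct2, THEN conjunct2, THEN conjunct2, THEN conjunct2, THEN conjunct1, rule_format]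
  and lift_dil_Z = hG[unfolded carnot_lift_def, THEN conjunct2, THEN conjunct2, THEN conjunct2, THEN conjunct2, THEN conjunct2, THEN conjunct2, THEN conjunct2, THEN conjunct2, THEN conjunct1, rule_format]
  and lie_gen_eq = hG[unfolded carnot_lift_def, THEN conjunct2, THEN conjunct2, THEN conjunct2, THEN conjunct2, THEN conjunct2, THEN conjunct2, THEN conjunct2, THEN conjunct2, THEN conjunct2, THEN conjunct1]
  and lift_fst = hG[unfolded carnot_lift_def, THEN conjunct2, THEN conjunct2, THEN conjunct2, THEN conjunct2, THEN conjunct2, THEN conjunct2, THEN conjunct2, THEN conjunct2, THEN conjunct2, THEN conjunct2, rule_format]

lemma weight_X: "b \<in> Basis \<Longrightarrow> 1 \<le> \<sigma> \<bullet> b"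
proof -
  assume "b \<in> Basis"
  then obtain i where "b = axis i 1" by (auto simp: Basis_vec_def)
  then show ?thesis using hX by (simp add: hyp_X_def cart_eq_inner_axis[symmetric])
qed

lemma weight_fibre: "b \<in> Basis \<Longrightarrow> 1 \<le> \<sigma>' \<bullet> b"
proof -
  assume "b \<in> Basis"
  then obtain i where "b = axis i 1" by (auto simp: Basis_vec_def)
  then show ?thesis using hG by (simp add: carnot_lift_def cart_eq_inner_axis[symmetric])
qed

sublocale hom_group "(\<sigma>, \<sigma>')" gop ginv
proof
  show "1 \<le> (\<sigma>, \<sigma>') \<bullet> b" if "b \<in> Basis" for b
    using that weight_X weight_fibre by (auto simp: Basis_prod_def)
  have "smooth (\<lambda>w. gop (fst w) (snd w))" "smooth ginv"
    using hG unfolding carnot_lift_def by blast+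
  then show "Ck k UNIV (\<lambda>w. gop (fst w) (snd w))" "Ck k UNIV ginv" for k
    by (simp_all only: smooth_on_iff_Ck)
  show "dl (\<sigma>, \<sigma>') r (gop a b) = gop (dl (\<sigma>, \<sigma>') r a) (dl (\<sigma>, \<sigma>') r b)" if "0 < r" for r a b
    using lift_dil[OF that] by (simp only: Dil_eq_dl)
qed (auto simp only: lift_assoc lift_group)

sublocale heat_group "(\<sigma>, \<sigma>')" gop ginv m Z
proof
  show "Ck k UNIV (Z j)" if "j < m" for j k
  proof (rule smooth_on_Ck)
    show "smooth (Z j)" by (rule lift_smooth_Z[OF that])
  qed
  show "frechet_derivative (gop a) (at z) (Z j z) = Z j (gop a z)" if "j < m" for j a z
  proof (rule frechet_left_translation[OF gm_differentiable])
    show "vf (Z j) (\<lambda>y. f (gop a y)) z = vf (Z j) f (gop a z)"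
      if "smooth f" for f :: "(real^'n) \<times> (real^'p) \<Rightarrow> real"
      by (rule lift_left[OF \<open>j < m\<close> that])
  qed
  show "dl (\<sigma>, \<sigma>') r (Z j z) = r *\<^sub>R Z j (dl (\<sigma>, \<sigma>') r z)" if "j < m" "0 < r" for j r z
  proof (rule field_dl_of_homogeneous)
    fix f :: "(real^'n) \<times> (real^'p) \<Rightarrow> real" assume f: "smooth f"
    have "Dil \<sigma> \<sigma>' r = dl (\<sigma>, \<sigma>') r" by (simp add: fun_eq_iff Dil_eq_dl)
    from lift_dil_Z[OF that f, unfolded this]
    show "vf (Z j) (f \<circ> dl (\<sigma>, \<sigma>') r) z = r * vf (Z j) f (dl (\<sigma>, \<sigma>') r z)" .
  qed
qed

lemma smooth_X: "j < m \<Longrightarrow> Ck k UNIV (X j)"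
  using hX by (simp add: hyp_X_def smooth_on_iff_Ck)

lemma dl_X: "j < m \<Longrightarrow> 0 < r \<Longrightarrow> dl \<sigma> r (X j x) = r *\<^sub>R X j (dl \<sigma> r x)"
proof (rule field_dl_of_homogeneous)
  fix f :: "real^'n \<Rightarrow> real" assume "j < m" "0 < r" "smooth f"
  moreover have "dl \<sigma> r = dil \<sigma> r" by (simp add: fun_eq_iff dil_eq_dl)
  ultimately show "vf (X j) (f \<circ> dl \<sigma> r) x = r * vf (X j) f (dl \<sigma> r x)"
    using hX by (simp add: hyp_X_def)
qed

lemma fst_Z:
  assumes "j < m"
  shows "fst (Z j z) = X j (fst z)"
proof (rule euclidean_eqI)
  fix b :: "real^'n"
  have "vf (Z j) (\<lambda>w. fst w \<bullet> b) z = fst (Z j z) \<bullet> b"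
    by (rule has_derivative_vf[OF has_derivative_inner_left[OF bounded_linear_imp_has_derivative[OF bounded_linear_fst]]])
  moreover have "vf (Z j) (\<lambda>w. fst w \<bullet> b) z = vf (X j) (\<lambda>y. y \<bullet> b) (fst z)"
    by (rule lift_fst[OF assms smooth_coordinate])
  ultimately show "fst (Z j z) \<bullet> b = X j (fst z) \<bullet> b" by (simp add: vf_coordinate)
qed

text \<open>Fields whose first component depends only on the base point are closed under brackets:
  the first component of a bracket is the bracket of the projected fields. The generators have this
  property because they lift the \<open>X j\<close>.\<close>

lemma lie_gen_projects:
  assumes "V \<in> lie_gen (Z ` {..<m})" "fst z = fst z'"
  shows "fst (V z) = fst (V z')"
  using assms
proof (induction arbitrary: z z' rule: lie_gen.induct)
  case (base V)
  then obtain j where "j < m" "V = Z j" by auto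
  then show ?case using fst_Z[of j] base.prems by simp
next
  case (add V W)
  show ?case using add.IH[OF add.prems] by simp
next
  case (scale V c)
  show ?case using scale.IH[OF scale.prems] by simp
next
  case (br V W)
  \<comment> \<open>As a function, the first component of \<open>W\<close> factors through
    \<open>fst\<close> as \<open>?w\<close>, so differentiating it along \<open>V\<close> sees only
    the first component of \<open>V\<close>.\<close>
  have fst_vf: "fst (vf V W z) = frechet_derivative (\<lambda>x. fst (W (x, 0))) (at (fst z)) (fst (V z))"
    if W: "W \<in> lie_gen (Z ` {..<m})"
      and proj: "\<And>z z'. fst z = fst z' \<Longrightarrow> fst (W z) = fst (W z')" for V W z
  proof -
    let ?w = "\<lambda>x. fst (W (x, 0))"
    have "smooth W" using W by (simp add: lie_gen_eq)
    then have W1: "Ck 1 UNIV W" by (rule smooth_on_Ck)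
    then have "Ck 1 UNIV ?w"
      by (intro Ck_fst Ck_compose_UNIV[OF _ _ W1] Ck_Pair) auto
    then have w: "(?w has_derivative frechet_derivative ?w (at (fst z))) (at (fst z))"
      by (intro frechet_derivative_worksI Ck_differentiable[where k=1]) auto
    have "((\<lambda>y. ?w (fst y)) has_derivative (\<lambda>h. frechet_derivative ?w (at (fst z)) (fst h))) (at z)"
      by (rule has_derivative_compose[where f=fst and g="?w", OF _ w])
        (rule bounded_linear_imp_has_derivative[OF bounded_linear_fst])
    moreover have "(\<lambda>y. ?w (fst y)) = (\<lambda>y. fst (W y))"
    proof
      show "?w (fst y) = fst (W y)" for y by (rule proj) simp
    qed
    moreover have Wd: "W differentiable (at z)" using Ck_differentiable[OF W1] by simp
    then have "((\<lambda>y. fst (W y)) has_derivative (\<lambda>h. fst (frechet_derivative W (at z) h))) (at z)"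
      by (intro has_derivative_fst frechet_derivative_worksI)
    ultimately have "(\<lambda>h. fst (frechet_derivative W (at z) h)) = (\<lambda>h. frechet_derivative ?w (at (fst z)) (fst h))"
      using has_derivative_unique by metis
    from fun_cong[OF this, of "V z"] show ?thesis by (simp add: vf_eq_frechet[OF Wd])
  qed
  have "fst (vf V W z) = fst (vf V W z')" "fst (vf W V z) = fst (vf W V z')"
    using fst_vf[OF br.hyps(2) br.IH(2)] fst_vf[OF br.hyps(1) br.IH(1)]
      br.IH[OF br.prems] br.prems by simp_all
  then show ?case by (simp add: lie_br_def)
qed

text \<open>This is where Lie generation enters: a left-invariant field with arbitrary value
  \<open>v\<close> at the identity is reached from the generators, and so
  \<open>lie_gen_projects\<close> applies to it.\<close>

lemma left_invariant_field_in_lie_gen: "(\<lambda>w. frechet_derivative (gop w) (at 0) v) \<in> lie_gen (Z ` {..<m})"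
proof -
  let ?V = "\<lambda>w. frechet_derivative (gop w) (at 0) v" and ?G = "\<lambda>p. gop (fst p) (snd p)"
  have Gd: "?G differentiable (at p)" for p by (rule Ck_differentiable[OF smooth_gm[of 1]]) auto
  have V: "?V w = (\<Sum>b\<in>Basis. (v \<bullet> b) *\<^sub>R pd (0, b) ?G (w, 0))" for w
  proof -
    have "((\<lambda>z. ?G (w, z)) has_derivative (\<lambda>h. frechet_derivative ?G (at (w, 0)) (0, h))) (at 0)"
      by (rule has_derivative_compose[where f="\<lambda>z. (w, z)" and g="?G", OF _ frechet_derivative_worksI[OF Gd]])
        (auto intro!: derivative_eq_intros)
    then have "(gop w has_derivative (\<lambda>h. frechet_derivative ?G (at (w, 0)) (0, h))) (at 0)" by simp
    from has_derivative_pd[OF this] have "pd b (gop w) 0 = pd (0, b) ?G (w, 0)" for b by (simp add: pd_def)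
    then show ?thesis unfolding frechet_derivative_pd[OF gm_differentiable] by simp
  qed
  have "Ck k UNIV ?V" for k
    unfolding V
  proof (intro Ck_sum Ck_scaleR Ck_const open_UNIV)
    fix b :: "(real^'n) \<times> (real^'p)" assume b: "b \<in> Basis"
    have "Ck k UNIV (pd (0, b) ?G)"
      by (rule Ck_pd_less[OF smooth_gm[of "Suc k"]]) (use b in \<open>auto simp: Basis_prod_def\<close>)
    then show "Ck k UNIV (\<lambda>w. pd (0, b) ?G (w, 0))"
      by (rule Ck_compose_UNIV[rotated 2]) (auto intro: Ck_Pair)
  qed
  then have "smooth ?V" by (simp add: smooth_on_iff_Ck)
  moreover have "vf ?V (\<lambda>y. f (gop a y)) z = vf ?V f (gop a z)"
    if f: "smooth f" for a z and f :: "(real^'n) \<times> (real^'p) \<Rightarrow> real"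
  proof -
    have "((\<lambda>g. gop a (gop z g)) has_derivative (\<lambda>h. frechet_derivative (gop a) (at (gop z 0)) (frechet_derivative (gop z) (at 0) h))) (at 0)"
      by (rule has_derivative_compose[OF frechet_derivative_worksI[OF gm_differentiable] frechet_derivative_worksI[OF gm_differentiable]])
    moreover have "(\<lambda>g. gop a (gop z g)) = gop (gop a z)" by (simp add: fun_eq_iff assoc)
    ultimately have "frechet_derivative (gop (gop a z)) (at 0) =
        (\<lambda>h. frechet_derivative (gop a) (at z) (frechet_derivative (gop z) (at 0) h))"
      using frechet_derivative_at by (metis right_zero)
    from fun_cong[OF this, of v]
    have "frechet_derivative (gop a) (at z) (?V z) = 1 *\<^sub>R ?V (gop a z)" by simp
    then show ?thesis
      using vf_related[of "gop a" z f ?V 1 ?V] gm_differentiable Ck_differentiable[OF smooth_on_Ck[OF f, of 1]]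
      by simp
  qed
  ultimately show ?thesis unfolding lie_gen_eq by blast
qed

lemma fst_gop_cong:
  assumes "fst w = fst w'"
  shows "fst (gop w g) = fst (gop w' g)"
proof (rule right_translation_projects[where P=fst and J="\<lambda>x. (x, 0)"])
  show "bounded_linear (\<lambda>x::real^'n. (x, 0::real^'p))"
    by (intro bounded_linear_Pair bounded_linear_ident bounded_linear_zero)
  show "fst (frechet_derivative (gop w) (at 0) v) = fst (frechet_derivative (gop w') (at 0) v)"
    if "fst w = fst w'" for v w w'
    by (rule lie_gen_projects[OF left_invariant_field_in_lie_gen that])
qed (use assms in \<open>auto intro: bounded_linear_fst\<close>)

text \<open>The map sends \<open>(y, \<eta>)\<close> to \<open>(y, 0)\<inverse> (x, \<eta>)\<close>,
  the argument of the kernel in \<open>Gam\<close>. It is homogeneous jointly with the parameter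
  \<open>x\<close>, and for \<open>x = 0\<close> its derivative at the origin is -1 on the base
  directions and 1 on the fibre directions, so it preserves Lebesgue measure.\<close>

lemma integral_section:
  fixes h :: "(real^'n) \<times> (real^'p) \<Rightarrow> real"
  assumes h: "h \<in> borel_measurable borel"
  shows "(\<integral>w. h (gop (ginv (fst w, 0)) (x, snd w)) \<partial>lborel) = (\<integral>z. h z \<partial>lborel)"
    and "integrable lborel (\<lambda>w. h (gop (ginv (fst w, 0)) (x, snd w))) \<longleftrightarrow> integrable lborel h"
proof -
  define F where "F p = gop (ginv (fst (snd p), 0)) (fst p, snd (snd p))"
    for p :: "(real^'n) \<times> ((real^'n) \<times> (real^'p))"
  have F: "Ck 1 UNIV F"
    unfolding F_def[abs_def]
    by (intro Ck_gm Ck_gi Ck_Pair Ck_fst Ck_snd Ck_ident Ck_const open_UNIV)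
  have pres: "distr lborel borel (\<lambda>w. F (x, w)) = lborel"
  proof (rule homogeneous_lborel[where \<omega>p=\<sigma> and \<omega>="(\<sigma>, \<sigma>')" and e="\<lambda>b. if snd b = 0 then - 1 else 1"
        and G="\<lambda>w. F (0, w)" and G'="\<lambda>w. (- fst w, snd w)"])
    show "F (dl \<sigma> r p, dl (\<sigma>, \<sigma>') r w) = dl (\<sigma>, \<sigma>') r (F (p, w))" if r: "0 < r" for r p w
    proof -
      have "dl (\<sigma>, \<sigma>') r (F (p, w)) = gop (ginv (dl (\<sigma>, \<sigma>') r (fst w, 0))) (dl (\<sigma>, \<sigma>') r (p, snd w))"
        by (simp add: F_def dl_gm[OF r] dl_gi[OF r])
      then show ?thesis by (cases w) (simp add: F_def dl_Pair)
    qed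
    show "((\<lambda>w. F (0, w)) has_derivative (\<lambda>w. (- fst w, snd w))) (at 0)"
    proof -
      let ?q = "\<lambda>w::(real^'n) \<times> (real^'p). (ginv (fst w, 0), (0::real^'n, snd w))"
      have b1: "bounded_linear (\<lambda>w::(real^'n) \<times> (real^'p). (fst w, 0::real^'p))"
        by (intro bounded_linear_Pair bounded_linear_fst bounded_linear_zero)
      have b2: "bounded_linear (\<lambda>w::(real^'n) \<times> (real^'p). (0::real^'n, snd w))"
        by (intro bounded_linear_Pair bounded_linear_snd bounded_linear_zero)
      have "((\<lambda>w::(real^'n) \<times> (real^'p). ginv (fst w, 0)) has_derivative (\<lambda>w. - (fst w, 0))) (at 0)"
        by (rule has_derivative_compose[where f="\<lambda>w. (fst w, 0)" and g=ginv, OF bounded_linear_imp_has_derivative[OF b1]])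
          (use gi_has_derivative_0 in \<open>simp add: zero_prod_def[symmetric]\<close>)
      then have q: "(?q has_derivative (\<lambda>w. (- (fst w, 0), (0, snd w)))) (at 0)"
        by (intro has_derivative_Pair[OF _ bounded_linear_imp_has_derivative[OF b2]])
      have "((\<lambda>w. gop (fst (?q w)) (snd (?q w))) has_derivative
          (\<lambda>w. fst (- (fst w, 0::real^'p), (0::real^'n, snd w)) + snd (- (fst w, 0::real^'p), (0::real^'n, snd w)))) (at 0)"
        by (rule has_derivative_compose[where g="\<lambda>w. gop (fst w) (snd w)", OF q])
          (use gm_has_derivative_0 in \<open>simp add: zero_prod_def[symmetric]\<close>)
      then show ?thesis by (simp add: F_def)
    qed
    show "(- fst c, snd c) = (if snd c = 0 then - 1 else 1) *\<^sub>R c" if "c \<in> Basis" for c :: "(real^'n) \<times> (real^'p)"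
      using that by (auto simp: Basis_prod_def)
    show "0 < \<sigma> \<bullet> b" if "b \<in> Basis" for b using weight_X[OF that] by linarith
  qed (use F weight_pos in auto)
  have m: "(\<lambda>w. F (x, w)) \<in> borel_measurable borel"
    by (intro borel_measurable_continuous_onI continuous_on_compose2[OF Ck_continuous[OF F]]
        continuous_on_Pair continuous_on_const continuous_on_id) auto
  from integral_lborel_preserving[OF m pres h]
  show "(\<integral>w. h (gop (ginv (fst w, 0)) (x, snd w)) \<partial>lborel) = (\<integral>z. h z \<partial>lborel)"
    and "integrable lborel (\<lambda>w. h (gop (ginv (fst w, 0)) (x, snd w))) \<longleftrightarrow> integrable lborel h"
    by (simp_all add: F_def)
qed

end

section \<open>The Cauchy problem on the base\<close>

theorem theorem4p1:
  fixes m :: nat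
    and X :: "nat \<Rightarrow> real^'n \<Rightarrow> real^'n"
    and \<sigma> :: "real^'n" and \<sigma>' :: "real^'p"
    and gop :: "(real^'n) \<times> (real^'p) \<Rightarrow> (real^'n) \<times> (real^'p) \<Rightarrow> (real^'n) \<times> (real^'p)"
    and ginv :: "(real^'n) \<times> (real^'p) \<Rightarrow> (real^'n) \<times> (real^'p)"
    and Z :: "nat \<Rightarrow> (real^'n) \<times> (real^'p) \<Rightarrow> (real^'n) \<times> (real^'p)"
    and \<gamma> :: "real \<times> ((real^'n) \<times> (real^'p)) \<Rightarrow> real"
    and \<phi> :: "real^'n \<Rightarrow> real"
  assumes hX: "hyp_X m X \<sigma> TYPE('p)"
    and hG: "carnot_lift m X \<sigma> \<sigma>' gop ginv Z"
    and h\<gamma>: "fund_sol_0 m Z \<gamma>"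
    and h\<phi>c: "continuous_on UNIV \<phi>"
    and h\<phi>b: "bounded (range \<phi>)"
  defines "u \<equiv> (\<lambda>(t, x). if t = 0 then \<phi> x
                          else (LINT y|lborel. Gam \<gamma> gop ginv 0 y t x * \<phi> y))"
  shows "classical_sol m X \<phi> u \<and> bounded (u ` ({0<..} \<times> UNIV))
       \<and> (\<forall>w. classical_sol m X \<phi> w \<and> bounded (w ` ({0<..} \<times> UNIV))
               \<longrightarrow> (\<forall>z\<in>{0..} \<times> UNIV. w z = u z))
       \<and> (\<forall>z\<in>{0<..} \<times> UNIV. \<bar>u z\<bar> \<le> (SUP y. \<bar>\<phi> y\<bar>))"
proof -
  interpret lifted_group m X \<sigma> \<sigma>' gop ginv Z by standard (rule hX, rule hG)
  interpret heat_kernel "(\<sigma>, \<sigma>')" gop ginv m Z \<gamma>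
    by standard (use h\<gamma> in \<open>simp add: fund_sol_0_weak_kernel\<close>)
  define C where "C = (SUP y. \<bar>\<phi> y\<bar>)"
  obtain B where "\<forall>x\<in>range \<phi>. norm x \<le> B" using h\<phi>b by (auto simp only: bounded_iff)
  then have "bdd_above (range (\<lambda>y. \<bar>\<phi> y\<bar>))" by (intro bdd_aboveI[of _ B]) auto
  then have C: "\<bar>\<phi> y\<bar> \<le> C" for y unfolding C_def by (intro cSUP_upper) auto
  define \<Phi> where "\<Phi> g = \<phi> (fst g)" for g :: "(real^'n) \<times> (real^'p)"
  have "continuous_on UNIV \<Phi>"
    unfolding \<Phi>_def[abs_def]
    by (rule continuous_on_compose2[OF h\<phi>c continuous_on_fst[OF continuous_on_id]]) auto
  moreover have "\<bar>\<Phi> g\<bar> \<le> C" for g unfolding \<Phi>_def by (rule C)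
  ultimately have \<Phi>: "continuous_on UNIV \<Phi>" "\<And>g. \<bar>\<Phi> g\<bar> \<le> C" by blast+
  note \<Phi>_m = \<Phi>_measurable[OF \<Phi>]
  let ?S = "{0::real<..} \<times> (UNIV :: (real^'n) set)" and ?S' = "{0::real<..} \<times> (UNIV :: ((real^'n) \<times> (real^'p)) set)"
  have S: "open ?S" and S': "open ?S'" by (auto intro: open_Times)
  \<comment> \<open>In the convolution \<open>w\<close> occurs only through the first component of
    \<open>w z\<inverse>\<close>, and this depends on \<open>w\<close> only through
    \<open>fst w\<close>.\<close>
  have extn_fst: "extn \<Phi> (t, w) = extn \<Phi> (t, (fst w, 0))" if "0 < t" for t w
    unfolding extn_eq[OF \<Phi> that] \<Phi>_def using fst_gop_cong[of w "(fst w, 0)"] by simp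
  have u_pos: "u (t, x) = extn \<Phi> (t, (x, 0))" if t: "0 < t" for t x
  proof -
    let ?h = "\<lambda>z. \<gamma> (t, z) * \<Phi> (gop (x, 0) (ginv z))"
    let ?T = "\<lambda>w. gop (ginv (fst w, 0)) (x, snd w)"
    have "(\<lambda>z. gop (x, 0) (ginv z)) \<in> borel_measurable borel" by measurable
    then have "(\<lambda>z. \<Phi> (gop (x, 0) (ginv z))) \<in> borel_measurable borel" by (rule measurable_compose[OF _ \<Phi>_m])
    then have h_m: "?h \<in> borel_measurable borel"
      by (intro borel_measurable_times kernel_slice_measurable)
    have h_int: "integrable lborel ?h"
    proof (rule Bochner_Integration.integrable_bound[OF integrable_mult_right[OF kernel_slice_integrable[OF t], of C]])
      show "?h \<in> borel_measurable lborel" using h_m by simp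
      show "AE z in lborel. norm (?h z) \<le> norm (C * \<gamma> (t, z))"
      proof (rule AE_I2)
        fix z
        show "norm (?h z) \<le> norm (C * \<gamma> (t, z))"
          using mult_right_mono[OF order_trans[OF \<Phi>(2)[of "gop (x, 0) (ginv z)"] abs_ge_self], of "\<bar>\<gamma> (t, z)\<bar>"]
          by (simp add: abs_mult mult.commute)
      qed
    qed
    \<comment> \<open>Moving \<open>(x, 0)\<close> within its fibre to \<open>(x, \<eta>)\<close>
      does not change the first component of the product, and multiplying \<open>(x, \<eta>)\<close>
      by the inverse of \<open>(y, 0)\<inverse> (x, \<eta>)\<close> leaves \<open>(y, 0)\<close>.
      Thus the datum is evaluated exactly at the integration point \<open>y\<close>.\<close>
    have hT: "?h (?T w) = \<gamma> (t, ?T w) * \<phi> (fst w)" for w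
    proof -
      have "fst (gop (x, 0) (ginv (?T w))) = fst (gop (x, snd w) (ginv (?T w)))" by (rule fst_gop_cong) simp
      also have "gop (x, snd w) (ginv (?T w)) = (fst w, 0)" by (simp add: gi_gm)
      finally show ?thesis by (simp add: \<Phi>_def)
    qed
    have int: "integrable (lborel \<Otimes>\<^sub>M lborel) (\<lambda>w. ?h (?T w))"
      using integral_section(2)[OF h_m, of x] h_int by (simp add: lborel_prod)
    have "extn \<Phi> (t, (x, 0)) = (\<integral>w. ?h (?T w) \<partial>lborel)"
      unfolding extn_eq[OF \<Phi> t] integral_section(1)[OF h_m] ..
    also have "\<dots> = (\<integral>y. (\<integral>\<eta>. ?h (?T (y, \<eta>)) \<partial>lborel) \<partial>lborel)"
      using lborel_pair.integral_fst'[OF int] by (simp add: lborel_prod)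
    also have "\<dots> = (\<integral>y. Gam \<gamma> gop ginv 0 y t x * \<phi> y \<partial>lborel)"
      unfolding hT by (simp add: Gam_def)
    finally show ?thesis using t by (simp add: u_def)
  qed
  have u_eq: "u z = extn \<Phi> (fst z, (snd z, 0))" if "z \<in> {0..} \<times> UNIV" for z
  proof (cases "fst z = 0")
    case True
    have "extn \<Phi> (0, (snd z, 0)) = \<phi> (fst (snd z, 0::real^'p))"
      unfolding extn_0[OF \<Phi>] \<Phi>_def ..
    then show ?thesis using True by (cases z) (simp add: u_def)
  next
    case False
    then show ?thesis using u_pos[of "fst z" "snd z"] that by auto
  qed
  let ?L = "\<lambda>z::real \<times> (real^'n). (fst z, (snd z, 0::real^'p))"
  have L: "Ck k UNIV ?L" for k
    by (intro Ck_Pair Ck_fst Ck_snd Ck_ident Ck_const open_UNIV)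
  have u_Ck: "Ck 2 ?S u"
  proof -
    have "Ck 2 ?S (\<lambda>z. extn \<Phi> (?L z))"
      by (rule Ck_compose[OF S S' Ck_subset[OF L subset_UNIV] _ extn_heat(1)[OF \<Phi>]]) auto
    moreover have "Ck 2 ?S u = Ck 2 ?S (\<lambda>z. extn \<Phi> (?L z))"
      by (rule Ck_cong[OF S]) (use u_eq in auto)
    ultimately show ?thesis by simp
  qed
  have u_cont: "continuous_on ({0..} \<times> UNIV) u"
  proof -
    have "continuous_on UNIV (\<lambda>z. extn \<Phi> (?L z))"
      by (rule continuous_on_compose2[OF extn_continuous[OF \<Phi>] Ck_continuous[OF L[of 0]]]) auto
    then have "continuous_on ({0..} \<times> UNIV) (\<lambda>z. extn \<Phi> (?L z))" by (rule continuous_on_subset) auto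
    then show ?thesis using u_eq by (simp cong: continuous_on_cong)
  qed
  have u_heat: "heat_op m X u z = 0" if z: "z \<in> ?S" for z
  proof -
    let ?z = "(fst z, (snd z, 0::real^'p))"
    have zS: "?z \<in> ?S'" using z by auto
    have d: "(fst :: (real^'n) \<times> (real^'p) \<Rightarrow> _) differentiable (at w)" for w
      by (rule differentiableI[OF bounded_linear_imp_has_derivative[OF bounded_linear_fst]])
    have rel: "frechet_derivative fst (at w) (Z j w) = 1 *\<^sub>R X j (fst w)" if "j < m" for j w
      using fst_Z[OF that] frechet_derivative_at[OF bounded_linear_imp_has_derivative[OF bounded_linear_fst], of w]
      by (metis scaleR_one)
    have z1: "(1\<^sup>2 * fst z + 0, fst (snd z, 0::real^'p)) \<in> ?S" using z by auto
    let ?w = "(1\<^sup>2 * fst z + 0, fst (snd z, 0::real^'p))"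
    have r1: "subl m Z (\<lambda>(t, x). u (1\<^sup>2 * t + 0, fst x)) ?z = 1\<^sup>2 * subl m X u ?w"
      by (rule heat_related(1)[OF S u_Ck d rel smooth_X z1])
    have r2: "pd (1, 0) (\<lambda>(t, x). u (1\<^sup>2 * t + 0, fst x)) ?z = 1\<^sup>2 * pd (1, 0) u ?w"
      by (rule heat_related(2)[OF S u_Ck d rel smooth_X z1])
    \<comment> \<open>The fields \<open>Z j\<close> and \<open>X j\<close> are related by the
      projection, so the operator on the base applied to \<open>u\<close> is the operator on the
      group applied to the pullback of \<open>u\<close>, which is \<open>extn \<Phi>\<close> at
      positive times.\<close>
    have "heat_op m X u z = heat_op m Z (\<lambda>(t, x). u (1\<^sup>2 * t + 0, fst x)) ?z"
      unfolding heat_op_subl r1 r2 by (simp only: one_power2 mult_1 add_0_right fst_conv prod.collapse)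
    also have "\<dots> = heat_op m Z (extn \<Phi>) ?z"
    proof (rule heat_op_cong_open[OF S' zS])
      fix y assume "y \<in> ?S'"
      then have t: "0 < fst y" by auto
      show "(case y of (t, x) \<Rightarrow> u (1\<^sup>2 * t + 0, fst x)) = extn \<Phi> y"
        using u_pos[OF t, of "fst (snd y)"] extn_fst[OF t, of "snd y"] by (simp add: case_prod_beta)
    qed
    also have "\<dots> = 0" by (rule extn_heat(2)[OF \<Phi> zS])
    finally show ?thesis .
  qed
  have u_le: "\<bar>u z\<bar> \<le> C" if "z \<in> ?S" for z
    using extn_le[OF \<Phi>, of "?L z"] u_eq[of z] that by auto
  have u_sol: "classical_sol m X \<phi> u"
    unfolding classical_sol_def C2_on_iff_Ck using u_Ck u_heat u_cont by (auto simp: u_def)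
  \<comment> \<open>The difference of two bounded solutions with equal data is a bounded solution
    with data 0; exchanging the roles of the two gives equality.\<close>
  have compare: "v z \<le> w z"
    if v: "classical_sol m X \<phi> v" "\<And>z. z \<in> ?S \<Longrightarrow> \<bar>v z\<bar> \<le> M"
      and w: "classical_sol m X \<phi> w" "\<And>z. z \<in> ?S \<Longrightarrow> \<bar>w z\<bar> \<le> M'" and z: "z \<in> ?S" for v w M M' z
  proof -
    have v': "Ck 2 ?S v" "\<And>z. z \<in> ?S \<Longrightarrow> heat_op m X v z = 0" "continuous_on ({0..} \<times> UNIV) v" "\<And>x. v (0, x) = \<phi> x"
      using v(1) unfolding classical_sol_def C2_on_iff_Ck by auto
    have w': "Ck 2 ?S w" "\<And>z. z \<in> ?S \<Longrightarrow> heat_op m X w z = 0" "continuous_on ({0..} \<times> UNIV) w" "\<And>x. w (0, x) = \<phi> x"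
      using w(1) unfolding classical_sol_def C2_on_iff_Ck by auto
    have "0 \<le> 1 * w z + (- 1) * v z"
    proof (rule heat_cauchy_min_principle[where M="M + M'" and v="\<lambda>z. 1 * w z + (- 1) * v z", OF weight_X smooth_X dl_X])
      show "Ck 2 ?S (\<lambda>z. 1 * w z + (- 1) * v z)" by (intro Ck_add Ck_cmult S v' w')
      show "continuous_on ({0..} \<times> UNIV) (\<lambda>z. 1 * w z + (- 1) * v z)"
        by (intro continuous_on_add continuous_on_mult continuous_on_const v' w')
      show "heat_op m X (\<lambda>z. 1 * w z + (- 1) * v z) y = 0" if "y \<in> ?S" for y
      proof -
        have "heat_op m X (\<lambda>z. 1 * w z + (- 1) * v z) y = 1 * heat_op m X w y + (- 1) * heat_op m X v y"
          by (rule heat_op_linear_combination[OF S w'(1) v'(1) smooth_X that])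
        then show ?thesis unfolding v'(2)[OF that] w'(2)[OF that] by simp
      qed
      show "\<bar>1 * w y + (- 1) * v y\<bar> \<le> M + M'" if "y \<in> ?S" for y
        using v(2)[OF that] w(2)[OF that] by auto
    qed (use v' w' z in auto)
    then show ?thesis by simp
  qed
  have unique: "w z = u z" if w: "classical_sol m X \<phi> w" "bounded (w ` ?S)" and z: "z \<in> {0..} \<times> UNIV" for w z
  proof (cases "fst z = 0")
    case True
    then show ?thesis using w(1) u_sol by (cases z) (simp add: classical_sol_def)
  next
    case False
    then have zS: "z \<in> ?S" using z by auto
    obtain M where "\<forall>x\<in>w ` ?S. norm x \<le> M" using w(2) by (auto simp only: bounded_iff)
    then have M: "\<And>z. z \<in> ?S \<Longrightarrow> \<bar>w z\<bar> \<le> M" by auto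
    show ?thesis
      using compare[OF w(1) M u_sol u_le zS] compare[OF u_sol u_le w(1) M zS] by simp
  qed
  have "bounded (u ` ?S)" unfolding bounded_iff using u_le by (intro exI[of _ C]) auto
  then show ?thesis using u_sol unique u_le unfolding C_def by blast
qed

end
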